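(* Let $m\ge 3$ and $1\le j<m$ with $\gcd(m,j)=1$. Then every substitution tiling with respect to the Pythia substitution $\rho_{m,j}$ is of statistical circular symmetry.
   Context: Identify $\mathbb{R}^2$ with $\mathbb{C}$. $R_\alpha$ is the rotation through the angle $\alpha$ about the origin, and a bar denotes reflection in the horizontal axis. A tiling of $\mathbb{R}^2$ is a covering of $\mathbb{R}^2$ by compact sets (tiles) with nonempty interior which is also a packing (distinct tiles have disjoint interiors). General notions. Given prototiles $T_1,\dots,T_m$, a copy of $T_i$ is a tile $R_\alpha T_i+t$ or (reflected copy) $R_\alpha\overline{T_i}+t$ with $\alpha\in[0,2\pi)$, $t\in\mathbb{R}^2$; such a tile $T$ is of type $i$ and has angle $\alpha(T)=\alpha$. A self-similar substitution $\sigma$ with substitution factor $\lambda>1$ assigns to each $T_i$ a finite set $\sigma(T_i)$ of copies of prototiles with pairwise disjoint interiors and union $\lambda T_i$; it is extended to copies by $\sigma(R_\alpha T_i+t)=R_\alpha\sigma(T_i)+\lambda t$, $\sigma(R_\alpha\overline{T_i}+t)=R_\alpha\overline{\sigma(T_i)}+\lambda t$, and to sets of copies by taking unions, so iterates are defined. A patch of a tiling is a finite subset of it. A tiling $\mathcal{T}$ by copies of the prototiles is a substitution tiling with respect to $\sigma$ if each patch in $\mathcal{T}$ is congruent (by a rigid motion, reflections allowed) to a patch in $\sigma^n(T_i)$ for some $n,i$. Statistical circular symmetry. Enumerate the tiles of a substitution tiling $\mathcal{T}$ as a sequence $(S_k)_{k\ge1}$ in order of non-decreasing distance from the origin (ties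 broken arbitrarily). $\mathcal{T}$ is of statistical circular symmetry if for all $0\le x<y<2\pi$, $$\lim_{n\to\infty}\frac1n\sum_{k=1}^n 1_{[x,y]}(\alpha(S_k))=\frac{y-x}{2\pi}.$$ Prototiles. Let $m\ge3$, $1\le j<m$, $\gcd(m,j)=1$. Let $\eta>1$ be the Perron eigenvalue of the companion matrix of $x^m-x^j-1$ (the unique positive root of this polynomial) and $\lambda=\sqrt{\eta}$, so $\lambda^{2m}=\lambda^{2j}+1$. Put $a=\lambda^{-m}$. Let $T_1$ be the right triangle with vertices $(0,0)$, $(-a,0)$, $(-a,\sqrt{1-a^2})$; it has legs $\lambda^{-m}<\lambda^{j-m}$ and hypotenuse $1$. Let $T_{i+1}=\lambda^iT_1$ for $1\le i\le m-1$. These triangles are scalene and of different sizes, so type, chirality and angle of each copy are determined by its shape as a subset of the plane. Pythagoras substitution $\sigma_{m,j}$ (substitution factor $\lambda$). $\sigma_{m,j}(T_i)=\{T_{i+1}\}$ for $1\le i\le m-1$; and $\sigma_{m,j}(T_m)$ consists of the two triangles into which the altitude on the hypotenuse dissects $\lambda T_m$. One of these is congruent to $T_1$ (hypotenuse $1$), the other to $T_{j+1}$ (hypotenuse $\lambda^j$). Pythia substitution $\rho_{m,j}$ (substitution factor $\lambda^{2m}$, same prototiles). Let $C$ be the right-angle vertex of the triangle $\lambda^{2m}T_1$, let $A$ be the other endpoint of its short leg and $B$ the other endpoint of its long leg. Let $H$ be the foot of the altitude from $C$ on the hypotenuse $AB$, and let $P$ and $Q$ be the feet of the perpendiculars from $H$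 to $CA$ and $CB$. The patch $(\sigma_{m,j})^{2m}(T_1)$ consists of: the triangle $AHP$ (of type $1$); the two triangles $CHP$ and $CHQ$ (both of type $j+1$), which together form the rectangle $CPHQ$; and tiles dissecting the triangle $HQB$ (congruent to $\lambda^{2j}T_1$), namely the image of $(\sigma_{m,j})^{2j}(T_1)$ under the rigid motion mapping $\lambda^{2j}T_1$ onto $HQB$. The patch $\rho_{m,j}(T_1)$ is obtained from $(\sigma_{m,j})^{2m}(T_1)$ by choosing the other diagonal of the rectangle: the two tiles $CHP$, $CHQ$ are replaced by the two triangles $CPQ$, $HPQ$ (again both of type $j+1$), all other tiles being kept. For $2\le i\le m$, $\rho_{m,j}(T_i)=(\sigma_{m,j})^{i-1}(\rho_{m,j}(T_1))$. *)

theory Defs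
  imports "HOL-Analysis.Analysis"
begin

text \<open>
  Tiles are subsets of the plane \<open>complex\<close>, and prototiles are a family \<open>T 1, \<dots>, T N\<close> of
  such sets. Type, chirality and angle of a copy are recovered from its shape, which is legitimate
  because the prototiles considered below are scalene triangles of pairwise different sizes.
\<close>

text \<open>The flag says whether reflection in the horizontal axis precedes the rotation.\<close>

definition motion :: "bool \<Rightarrow> real \<Rightarrow> complex \<Rightarrow> complex \<Rightarrow> complex" where
  "motion flip \<alpha> t z = cis \<alpha> * (if flip then cnj z else z) + t"

definition copy_at :: "complex set \<Rightarrow> bool \<Rightarrow> real \<Rightarrow> complex \<Rightarrow> complex set \<Rightarrow> bool" where
  "copy_at T0 flip \<alpha> t S \<longleftrightarrow> 0 \<le> \<alpha> \<and> \<alpha> < 2 * pi \<and> S = motion flip \<alpha> t ` T0"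

definition is_copy :: "nat \<Rightarrow> (nat \<Rightarrow> complex set) \<Rightarrow> complex set \<Rightarrow> bool" where
  "is_copy N T S \<longleftrightarrow> (\<exists>i\<in>{1..N}. \<exists>flip \<alpha> t. copy_at (T i) flip \<alpha> t S)"

definition tile_angle :: "nat \<Rightarrow> (nat \<Rightarrow> complex set) \<Rightarrow> complex set \<Rightarrow> real" where
  "tile_angle N T S = (THE \<alpha>. \<exists>i\<in>{1..N}. \<exists>flip t. copy_at (T i) flip \<alpha> t S)"

text \<open>
  A substitution with factor \<open>l\<close> is given by its values \<open>s i\<close> on the prototiles \<open>T i\<close>; the
  following is its extension to sets of copies. The presentation of a tile as a copy being unique,
  each tile \<open>S\<close> of \<open>P\<close> contributes exactly one moved patch \<open>s i\<close>.
\<close>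

definition subst_ext ::
  "nat \<Rightarrow> (nat \<Rightarrow> complex set) \<Rightarrow> real \<Rightarrow> (nat \<Rightarrow> complex set set) \<Rightarrow>
   complex set set \<Rightarrow> complex set set" where
  "subst_ext N T l s P =
     {motion flip \<alpha> (of_real l * t) ` U | flip \<alpha> t U i S.
        S \<in> P \<and> i \<in> {1..N} \<and> copy_at (T i) flip \<alpha> t S \<and> U \<in> s i}"

definition tiling :: "complex set set \<Rightarrow> bool" where
  "tiling \<T> \<longleftrightarrow>
     (\<forall>S\<in>\<T>. compact S \<and> interior S \<noteq> {}) \<and> \<Union>\<T> = UNIV \<and>
     (\<forall>S\<in>\<T>. \<forall>S'\<in>\<T>. S \<noteq> S' \<longrightarrow> interior S \<inter> interior S' = {})"

definition congruent_patches :: "complex set set \<Rightarrow> complex set set \<Rightarrow> bool" where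
  "congruent_patches P Q \<longleftrightarrow> (\<exists>flip \<alpha> t. Q = (\<lambda>S. motion flip \<alpha> t ` S) ` P)"

definition substitution_tiling ::
  "nat \<Rightarrow> (nat \<Rightarrow> complex set) \<Rightarrow> real \<Rightarrow> (nat \<Rightarrow> complex set set) \<Rightarrow> complex set set \<Rightarrow> bool" where
  "substitution_tiling N T l s \<T> \<longleftrightarrow>
     tiling \<T> \<and> (\<forall>S\<in>\<T>. is_copy N T S) \<and>
     (\<forall>P. finite P \<and> P \<subseteq> \<T> \<longrightarrow>
        (\<exists>n. \<exists>i\<in>{1..N}. \<exists>Q. Q \<subseteq> (subst_ext N T l s ^^ n) {T i} \<and> congruent_patches P Q))"

definition distance_enumeration :: "complex set set \<Rightarrow> (nat \<Rightarrow> complex set) \<Rightarrow> bool" where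
  "distance_enumeration \<T> S \<longleftrightarrow>
     bij_betw S {1..} \<T> \<and> (\<forall>k\<ge>1. infdist 0 (S k) \<le> infdist 0 (S (Suc k)))"

text \<open>
  Ties in the enumeration may be broken arbitrarily, hence the quantification over all
  enumerations; the first conjunct excludes vacuous truth.
\<close>

definition statistical_circular_symmetry ::
  "nat \<Rightarrow> (nat \<Rightarrow> complex set) \<Rightarrow> complex set set \<Rightarrow> bool" where
  "statistical_circular_symmetry N T \<T> \<longleftrightarrow>
     (\<exists>S. distance_enumeration \<T> S) \<and>
     (\<forall>S. distance_enumeration \<T> S \<longrightarrow>
        (\<forall>x y. 0 \<le> x \<and> x < y \<and> y < 2 * pi \<longrightarrow>
           (\<lambda>n. 1 / real n * (\<Sum>k=1..n. indicator {x..y} (tile_angle N T (S k))))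
             \<longlonglongrightarrow> (y - x) / (2 * pi)))"

definition eta :: "nat \<Rightarrow> nat \<Rightarrow> real" where
  "eta m j = (THE x. 0 < x \<and> x ^ m - x ^ j - 1 = 0)"

lemma eta_unique:
  assumes "1 \<le> j" "j < m"
  shows "\<exists>!x::real. 0 < x \<and> x ^ m - x ^ j - 1 = 0"
proof -
  have eq: "x ^ m - x ^ j - 1 = x ^ j * (x ^ (m - j) - 1) - 1" for x :: real
  proof -
    have "x ^ m = x ^ j * x ^ (m - j)"
      using assms by (metis le_add_diff_inverse less_imp_le power_add)
    then show ?thesis by (simp add: right_diff_distrib)
  qed
  have gt1: "x > 1" if "0 < x" "x ^ m - x ^ j - 1 = 0" for x :: real
  proof (rule ccontr)
    assume "\<not> x > 1"
    then have "x ^ (m - j) \<le> 1" using that by (simp add: power_le_one)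
    then have "x ^ j * (x ^ (m - j) - 1) \<le> 0"
      using that by (simp add: mult_nonneg_nonpos)
    then show False using that(2) unfolding eq by linarith
  qed
  have less: "x ^ m - x ^ j - 1 < y ^ m - y ^ j - 1" if "1 < x" "x < y" for x y :: real
  proof -
    have "x ^ j < y ^ j" "x ^ (m - j) < y ^ (m - j)"
      using that assms by (auto intro!: power_strict_mono)
    moreover have "x ^ j > 0" "x ^ (m - j) > 1"
      using that assms by (auto intro!: one_less_power)
    ultimately have "x ^ j * (x ^ (m - j) - 1) < y ^ j * (y ^ (m - j) - 1)"
      by (intro mult_strict_mono) auto
    then show ?thesis unfolding eq by linarith
  qed
  have "(2::real) ^ Suc j \<le> 2 ^ m" "(2::real) ^ j \<ge> 1"
    using assms by (auto intro!: power_increasing simp del: power_Suc)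
  then have "(0::real) \<le> 2 ^ m - 2 ^ j - 1"
    unfolding power_Suc by linarith
  moreover have "continuous_on {1..2} (\<lambda>x::real. x ^ m - x ^ j - 1)"
    by (intro continuous_intros)
  ultimately obtain x :: real where "1 \<le> x" "x ^ m - x ^ j - 1 = 0"
    using IVT'[of "\<lambda>x::real. x ^ m - x ^ j - 1" 1 0 2] by auto
  then have x: "0 < x \<and> x ^ m - x ^ j - 1 = 0" by simp
  show ?thesis
  proof (intro ex1I[of _ x] x)
    fix y :: real
    assume y: "0 < y \<and> y ^ m - y ^ j - 1 = 0"
    show "y = x"
      using less[of x y] less[of y x] gt1[of x] gt1[of y] x y by linarith
  qed
qed

definition lam :: "nat \<Rightarrow> nat \<Rightarrow> real" where
  "lam m j = sqrt (eta m j)"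

text \<open>
  Vertices of the first prototile: the acute vertices \<open>vA\<close> (on the short leg) and \<open>vB\<close> (on the
  long leg), and the right-angle vertex \<open>vC\<close>.
\<close>

definition vA :: complex where
  "vA = 0"

definition vC :: "nat \<Rightarrow> nat \<Rightarrow> complex" where
  "vC m j = Complex (- (1 / lam m j ^ m)) 0"

definition vB :: "nat \<Rightarrow> nat \<Rightarrow> complex" where
  "vB m j = Complex (- (1 / lam m j ^ m)) (sqrt (1 - (1 / lam m j ^ m)\<^sup>2))"

abbreviation triangle :: "complex \<Rightarrow> complex \<Rightarrow> complex \<Rightarrow> complex set" where
  "triangle p q r \<equiv> convex hull {p, q, r}"

definition prototile :: "nat \<Rightarrow> nat \<Rightarrow> nat \<Rightarrow> complex set" where
  "prototile m j i = (\<lambda>z. of_real (lam m j ^ (i - 1)) * z) ` triangle vA (vC m j) (vB m j)"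

text \<open>Foot of the perpendicular from \<open>p\<close> to the line through \<open>a\<close> and \<open>b\<close>.\<close>

definition foot :: "complex \<Rightarrow> complex \<Rightarrow> complex \<Rightarrow> complex" where
  "foot p a b = a + ((p - a) \<bullet> (b - a) / (norm (b - a))\<^sup>2) *\<^sub>R (b - a)"

text \<open>Note that \<open>lam m j\<close> times the last prototile is \<open>lam m j ^ m\<close> times the first one.\<close>

definition pythagoras :: "nat \<Rightarrow> nat \<Rightarrow> nat \<Rightarrow> complex set set" where
  "pythagoras m j i =
     (if i < m then {prototile m j (Suc i)}
      else let c = of_real (lam m j ^ m); A = c * vA; B = c * vB m j; C = c * vC m j;
               H = foot C A B
           in {triangle A H C, triangle C H B})"

abbreviation pythagoras_ext :: "nat \<Rightarrow> nat \<Rightarrow> complex set set \<Rightarrow> complex set set" where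
  "pythagoras_ext m j \<equiv> subst_ext m (prototile m j) (lam m j) (pythagoras m j)"

text \<open>The \<open>2 * m\<close>-th iterate of the Pythagoras substitution cuts the rectangle \<open>C P H Q\<close> along its diagonal \<open>C H\<close>; the
  diagonal \<open>P Q\<close> is chosen instead.\<close>

definition pythia_first :: "nat \<Rightarrow> nat \<Rightarrow> complex set set" where
  "pythia_first m j =
     (let c = of_real (lam m j ^ (2 * m)); A = c * vA; B = c * vB m j; C = c * vC m j;
          H = foot C A B; P = foot H C A; Q = foot H C B
      in ((pythagoras_ext m j ^^ (2 * m)) {prototile m j 1} - {triangle C H P, triangle C H Q})
         \<union> {triangle C P Q, triangle H P Q})"

definition pythia :: "nat \<Rightarrow> nat \<Rightarrow> nat \<Rightarrow> complex set set" where
  "pythia m j i = (pythagoras_ext m j ^^ (i - 1)) (pythia_first m j)"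

end

theory Submission
  imports Defs "HOL-Computational_Algebra.Fundamental_Theorem_Algebra"
begin

text \<open>
  The tiles met by a large disc form a patch that is congruent to a part of some supertile, hence
  decomposes into supertiles of any fixed level \<open>L\<close> and a negligible remainder close to the
  boundary circle. By Weyl's criterion it is therefore enough that for each \<open>e \<ge> 1\<close> the mean of
  \<open>exp (i e \<alpha>)\<close> over the tiles of a supertile of level \<open>L\<close> tends to 0 as \<open>L\<close> grows. With tiles weighted
  by area, each step of the substitution contracts these means strictly as soon as some level contains, in every
  supertile, two tiles of the same type and chirality on which \<open>exp (i e \<alpha>)\<close> differs. Let \<open>\<theta>\<close> be the
  angle of the triangles between hypotenuse and short leg. Modulo right angles, the flipped diagonals shift angles by
  \<open>\<theta>\<close>, and repeating this yields tiles with angles shifted by all multiples of \<open>\<theta>\<close>, so by the pigeonhole principle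
  such a pair exists provided \<open>\<theta> / \<pi>\<close> is irrational. If it were rational, all conjugates of
  \<open>\<eta> ^ (-m) = cos \<theta> ^ 2\<close> would lie in \<open>[0, 1]\<close>, and their product could not be \<open>\<plusminus>1\<close>, although \<open>\<eta>\<close> is a unit.
\<close>

section \<open>Equidistribution from power means\<close>

text \<open>What blocks rotation in the Pythagoras substitution is a coupling of angle and
  chirality. Up to right angles, every dissection reverses chirality and turns by
  \<open>cnj \<omega>\<close>. As a reversal conjugates all rotations below it, the next dissection
  undoes the previous turn, and only finitely many directions occur. The flipped diagonal reverses
  chirality without a turn. The dissection after it therefore turns by \<omega>, restores chirality
  and leaves a net turn, which can be repeated without end. The contraction looks at one type and
  chirality at a time because supertiles of different kinds have unrelated angle sums, and no
  cancellation between them can be guaranteed; tiles of equal kind carry the same sum up to a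
  rotation. Areas are the right weights because they multiply by one common factor for every type. A
  strict loss at a single level then becomes one ratio below 1 for all supertiles and can be
  iterated, and bounds on the areas turn weights back into numbers of tiles.\<close>

inductive trig :: "(complex \<Rightarrow> complex) \<Rightarrow> bool" where
  trig_monom: "trig (\<lambda>z. z ^ a * cnj z ^ b)"
| trig_scale: "trig f \<Longrightarrow> trig (\<lambda>z. c * f z)"
| trig_add: "trig f \<Longrightarrow> trig g \<Longrightarrow> trig (\<lambda>z. f z + g z)"

lemma trig_mult:
  assumes "trig f" "trig g"
  shows "trig (\<lambda>z. f z * g z)"
  using assms(1)
proof (induction rule: trig.induct)
  case (trig_monom a b)
  show ?case using assms(2)
  proof (induction rule: trig.induct)
    case (trig_monom a' b')
    show ?case
      using trig.trig_monom[of "a + a'" "b + b'"] by (simp add: power_add mult_ac)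
  next
    case (trig_scale f c)
    then show ?case
      using trig.trig_scale[OF trig_scale.IH, of c] by (simp add: mult_ac)
  next
    case (trig_add f g)
    then show ?case
      using trig.trig_add[OF trig_add.IH] by (simp add: algebra_simps)
  qed
next
  case (trig_scale f c)
  then show ?case
    using trig.trig_scale[OF trig_scale.IH, of c] by (simp add: mult_ac)
next
  case (trig_add f g)
  then show ?case
    using trig.trig_add[OF trig_add.IH] by (simp add: algebra_simps)
qed

text \<open>\<open>Re z\<close> and \<open>Im z\<close> are combinations of \<open>z\<close> and
  \<open>cnj z\<close>. The polynomials supplied by Stone-Weierstrass thus become combinations of
  monomials, whose means along the sequence are known.\<close>

lemma trig_real_polynomial_function:
  assumes "real_polynomial_function f"
  shows "trig (\<lambda>z. of_real (f z))"
  using assms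
proof (induction rule: real_polynomial_function.induct)
  case (linear f)
  interpret bounded_linear f by fact
  have "(\<lambda>z. of_real (f z)) =
      (\<lambda>z. (of_real (f 1) / 2 - \<i> * of_real (f \<i>) / 2) * (z ^ 1 * cnj z ^ 0) +
           (of_real (f 1) / 2 + \<i> * of_real (f \<i>) / 2) * (z ^ 0 * cnj z ^ 1))"
  proof
    fix z :: complex
    have "z = Re z *\<^sub>R 1 + Im z *\<^sub>R \<i>"
      by (simp add: complex_eq_iff)
    then have "f z = Re z * f 1 + Im z * f \<i>"
      by (metis add scaleR real_scaleR_def)
    then show "of_real (f z) =
      (of_real (f 1) / 2 - \<i> * of_real (f \<i>) / 2) * (z ^ 1 * cnj z ^ 0) +
           (of_real (f 1) / 2 + \<i> * of_real (f \<i>) / 2) * (z ^ 0 * cnj z ^ 1)"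
      by (simp add: complex_eq_iff field_simps)
  qed
  then show ?case
    by (simp only:) (intro trig.intros)
next
  case (const c)
  then show ?case
    using trig_scale[OF trig_monom[of 0 0], of "of_real c"] by simp
next
  case (add f g)
  then show ?case by (simp add: trig_add)
next
  case (mult f g)
  then show ?case by (simp add: trig_mult)
qed

lemma has_integral_cis_power:
  assumes "k \<ge> 1"
  shows "((\<lambda>t. cis t ^ k) has_integral 0) {c - pi..c + pi}"
proof -
  have "((\<lambda>t. cis t ^ k) has_integral
      (- \<i> / of_nat k * cis (real k * (c + pi)) - (- \<i> / of_nat k * cis (real k * (c - pi))))) {c - pi..c + pi}"
  proof (rule fundamental_theorem_of_calculus)
    fix t assume "t \<in> {c - pi..c + pi}"
    have "((\<lambda>t. - \<i> / of_nat k * exp (\<i> * of_real (real k * t))) has_vector_derivative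
        (- \<i> / of_nat k * (\<i> * of_real (real k) * exp (\<i> * of_real (real k * t)))))
        (at t within {c - pi..c + pi})"
      unfolding has_real_derivative_iff_has_vector_derivative[symmetric]
      by (rule has_vector_derivative_eq_rhs)
         (rule derivative_eq_intros exp_scaleR_has_vector_derivative_right refl
           has_vector_derivative_real_field | simp add: field_simps)+
    then show "((\<lambda>t. - \<i> / of_nat k * cis (real k * t)) has_vector_derivative cis t ^ k)
        (at t within {c - pi..c + pi})"
      using assms by (simp add: cis_conv_exp exp_of_nat_mult[symmetric] mult_ac)
  qed auto
  moreover have "cis (real k * (c + pi)) = cis (real k * (c - pi))"
  proof -
    have "cis (real k * (c + pi)) = cis (real k * (c - pi)) * cis (2 * pi) ^ k"
      unfolding Complex.DeMoivre cis_mult by (rule arg_cong[of _ _ cis]) (simp add: algebra_simps)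
    then show ?thesis by simp
  qed
  ultimately show ?thesis by simp
qed

locale vanishing_power_means =
  fixes u :: "nat \<Rightarrow> complex"
  assumes norm_u: "\<And>i. i \<ge> 1 \<Longrightarrow> cmod (u i) = 1"
    and power_means: "\<And>k. k \<ge> 1 \<Longrightarrow> (\<lambda>n. (\<Sum>i=1..n. u i ^ k) / of_nat n) \<longlonglongrightarrow> 0"
begin

text \<open>On the unit circle a monomial is 1, a positive power of \<open>z\<close> or the
  conjugate of one. In each case the limit of the means is the normalised integral over a full turn,
  and both sides are linear.\<close>

lemma trig_mean:
  assumes "trig g"
  shows "\<exists>M. (\<lambda>n. (\<Sum>i=1..n. g (u i)) / of_nat n) \<longlonglongrightarrow> M \<and>
     ((\<lambda>t. g (cis t)) has_integral 2 * of_real pi * M) {c - pi..c + pi}"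
  using assms
proof (induction rule: trig.induct)
  case (trig_monom a b)
  consider "a = b" | "b < a" | "a < b" by linarith
  then show ?case
  proof cases
    case 1
    have one: "z ^ a * cnj z ^ b = 1" if "cmod z = 1" for z
      using complex_norm_square[of z] that 1 by (simp flip: power_mult_distrib)
    have "(\<Sum>i=1..n. u i ^ a * cnj (u i) ^ b) / of_nat n = (1 :: complex)" if "n \<ge> 1" for n
      using that by (simp add: one norm_u)
    then have "(\<lambda>n. (\<Sum>i=1..n. u i ^ a * cnj (u i) ^ b) / of_nat n) \<longlonglongrightarrow> 1"
      by (intro tendsto_eventually eventually_sequentiallyI[of 1])
    moreover have "((\<lambda>t. cis t ^ a * cnj (cis t) ^ b) has_integral 2 * of_real pi * 1) {c - pi..c + pi}"
      using has_integral_const_real[of "1 :: complex" "c - pi" "c + pi"]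
      by (simp add: one scaleR_conv_of_real)
    ultimately show ?thesis by blast
  next
    case 2
    have eq: "z ^ a * cnj z ^ b = z ^ (a - b)" if "cmod z = 1" for z
    proof -
      have "z ^ a * cnj z ^ b = z ^ (a - b) * (z * cnj z) ^ b"
        using 2 by (simp add: power_mult_distrib mult_ac flip: power_add)
      then show ?thesis
        using complex_norm_square[of z] that by simp
    qed
    have "(\<lambda>n. (\<Sum>i=1..n. u i ^ a * cnj (u i) ^ b) / of_nat n) \<longlonglongrightarrow> 0"
      using power_means[of "a - b"] 2 by (simp add: eq norm_u)
    moreover have "((\<lambda>t. cis t ^ a * cnj (cis t) ^ b) has_integral 2 * of_real pi * 0) {c - pi..c + pi}"
      using has_integral_cis_power[of "a - b" c] 2 by (simp add: eq)
    ultimately show ?thesis by blast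
  next
    case 3
    have eq: "z ^ a * cnj z ^ b = cnj (z ^ (b - a))" if "cmod z = 1" for z
    proof -
      have "z ^ a * cnj z ^ b = cnj (z ^ (b - a)) * (z * cnj z) ^ a"
        using 3 by (simp add: power_mult_distrib mult_ac flip: power_add)
      then show ?thesis
        using complex_norm_square[of z] that by simp
    qed
    have "(\<lambda>n. cnj ((\<Sum>i=1..n. u i ^ (b - a)) / of_nat n)) \<longlonglongrightarrow> cnj 0"
      using power_means[of "b - a"] 3 by (intro tendsto_cnj) simp
    then have "(\<lambda>n. (\<Sum>i=1..n. u i ^ a * cnj (u i) ^ b) / of_nat n) \<longlonglongrightarrow> 0"
      by (simp add: eq norm_u)
    moreover have "((\<lambda>t. cis t ^ a * cnj (cis t) ^ b) has_integral 2 * of_real pi * 0) {c - pi..c + pi}"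
      using has_integral_cnj[of "\<lambda>t. cis t ^ (b - a)" 0 "{c - pi..c + pi}"]
        has_integral_cis_power[of "b - a" c] 3 by (simp add: eq o_def)
    ultimately show ?thesis by blast
  qed
next
  case (trig_scale f d)
  then obtain M where "(\<lambda>n. (\<Sum>i=1..n. f (u i)) / of_nat n) \<longlonglongrightarrow> M"
     "((\<lambda>t. f (cis t)) has_integral 2 * of_real pi * M) {c - pi..c + pi}" by blast
  from tendsto_mult_left[OF this(1), of d] has_integral_mult_right[OF this(2), of d]
  show ?case
    by (intro exI[of _ "d * M"]) (simp add: sum_distrib_left mult_ac)
next
  case (trig_add f g)
  then obtain M M' where
     "(\<lambda>n. (\<Sum>i=1..n. f (u i)) / of_nat n) \<longlonglongrightarrow> M"
     "((\<lambda>t. f (cis t)) has_integral 2 * of_real pi * M) {c - pi..c + pi}"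
     "(\<lambda>n. (\<Sum>i=1..n. g (u i)) / of_nat n) \<longlonglongrightarrow> M'"
     "((\<lambda>t. g (cis t)) has_integral 2 * of_real pi * M') {c - pi..c + pi}" by blast
  from tendsto_add[OF this(1,3)] has_integral_add[OF this(2,4)]
  show ?case
    by (intro exI[of _ "M + M'"]) (simp add: sum.distrib add_divide_distrib algebra_simps)
qed

text \<open>A continuous majorant of the arc's indicator is approximated by a polynomial, whose mean
  is its integral. One-sided bounds suffice, since lower bounds follow from upper bounds for
  complementary arcs.\<close>

lemma arc_frequency_le:
  assumes r: "0 \<le> r" "r < pi" and e: "e > 0"
  shows "\<forall>\<^sub>F n in sequentially.
    (\<Sum>i=1..n. indicator (cis ` {c - r..c + r}) (u i)) / real n < r / pi + e"
proof -
  \<comment> \<open>The error uses up four times \<delta>: two for the integral of the majorant and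
    its approximation, one for strictness, one for returning from \<open>g\<close> to
    \<open>h\<close>. The other bound keeps \<rho> below \<open>pi\<close>.\<close>
  define \<delta> where "\<delta> = min ((pi - r) / 2) (e / 4)"
  define \<rho> where "\<rho> = r + \<delta>"
  have \<delta>: "\<delta> > 0" "\<delta> \<le> e / 4" "\<delta> \<le> (pi - r) / 2"
    using r e unfolding \<delta>_def by (simp, simp, intro min.cobounded1)
  have \<rho>: "r < \<rho>" "\<rho> < pi"
    using \<delta>(1,3) r by (auto simp: \<rho>_def)
  have cos: "cos \<rho> < cos r"
    using cos_monotone_0_pi r \<rho> by simp
  \<comment> \<open>The value depends on the angular distance to \<open>c\<close> only: 1 up to
    \<open>r\<close>, 0 from \<rho> on. Using its cosine makes \<open>h\<close> continuous on the
    circle without choosing a branch of the argument.\<close>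
  define h where "h z = max 0 (min 1 ((Re (z * cis (- c)) - cos \<rho>) / (cos r - cos \<rho>)))" for z
  have h_cis: "h (cis t) = max 0 (min 1 ((cos \<bar>t - c\<bar> - cos \<rho>) / (cos r - cos \<rho>)))" for t
    unfolding h_def by (subst cis_mult) simp
  have h0: "h z \<ge> 0" for z
    by (simp add: h_def)
  have h1: "h (cis t) = 1" if "\<bar>t - c\<bar> \<le> r" for t
  proof -
    have "cos r \<le> cos \<bar>t - c\<bar>"
      by (intro cos_monotone_0_pi_le) (use that r in auto)
    then show ?thesis
      unfolding h_cis using cos by (simp add: le_divide_eq)
  qed
  have h_le: "h (cis t) \<le> (if t \<in> {c - \<rho>..c + \<rho>} then 1 else 0)" if "\<bar>t - c\<bar> \<le> pi" for t
  proof (cases "t \<in> {c - \<rho>..c + \<rho>}")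
    case True
    then show ?thesis by (simp add: h_def)
  next
    case False
    have "cos \<bar>t - c\<bar> \<le> cos \<rho>"
      by (intro cos_monotone_0_pi_le) (use False that r \<rho> in auto)
    then have "(cos \<bar>t - c\<bar> - cos \<rho>) / (cos r - cos \<rho>) \<le> 0"
      using cos by (simp add: divide_le_0_iff)
    then have "h (cis t) = 0"
      unfolding h_cis by linarith
    then show ?thesis using False by simp
  qed
  have "continuous_on (sphere 0 1) h"
    unfolding h_def using cos by (intro continuous_intros) auto
  then obtain g where g: "real_polynomial_function g"
      "\<And>z. z \<in> sphere 0 1 \<Longrightarrow> \<bar>h z - g z\<bar> < \<delta>"
    using Stone_Weierstrass_real_polynomial_function[OF compact_sphere _ \<delta>(1)] by metis
  obtain M where M: "(\<lambda>n. (\<Sum>i=1..n. of_real (g (u i))) / of_nat n) \<longlonglongrightarrow> M"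
     "((\<lambda>t. of_real (g (cis t)) :: complex) has_integral 2 * of_real pi * M) {c - pi..c + pi}"
    using trig_mean[OF trig_real_polynomial_function[OF g(1)]] by blast
  have int_g: "((\<lambda>t. g (cis t)) has_integral 2 * pi * Re M) {c - pi..c + pi}"
    using has_integral_Re[OF M(2)] by simp
  have "((\<lambda>t. 1) has_integral 2 * \<rho>) {c - \<rho>..c + \<rho>}"
    using has_integral_const_real[of "1 :: real" "c - \<rho>" "c + \<rho>"] \<rho> r by simp
  then have "((\<lambda>t. if t \<in> {c - \<rho>..c + \<rho>} then 1 else 0) has_integral 2 * \<rho>) {c - pi..c + pi}"
    by (subst has_integral_restrict) (use \<rho> in auto)
  moreover have "((\<lambda>t. \<delta>) has_integral 2 * pi * \<delta>) {c - pi..c + pi}"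
    using has_integral_const_real[of \<delta> "c - pi" "c + pi"] by simp
  ultimately have "((\<lambda>t. (if t \<in> {c - \<rho>..c + \<rho>} then 1 else 0) + \<delta>) has_integral
      2 * \<rho> + 2 * pi * \<delta>) {c - pi..c + pi}"
    by (rule has_integral_add)
  then have "2 * pi * Re M \<le> 2 * \<rho> + 2 * pi * \<delta>"
  proof (rule has_integral_le[OF int_g])
    fix t assume "t \<in> {c - pi..c + pi}"
    then have "h (cis t) \<le> (if t \<in> {c - \<rho>..c + \<rho>} then 1 else 0)"
      by (intro h_le) auto
    moreover have "\<bar>h (cis t) - g (cis t)\<bar> < \<delta>"
      by (intro g(2)) simp
    ultimately show "g (cis t) \<le> (if t \<in> {c - \<rho>..c + \<rho>} then 1 else 0) + \<delta>"
      by linarith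
  qed
  then have "Re M \<le> \<rho> / pi + \<delta>"
    using pi_gt_zero by (simp add: field_simps)
  also have "\<rho> / pi \<le> r / pi + \<delta>"
  proof -
    have "\<delta> / pi \<le> \<delta>"
      using \<delta>(1) pi_ge_two by (simp add: divide_le_eq)
    then show ?thesis by (simp add: \<rho>_def add_divide_distrib)
  qed
  finally have ReM: "Re M < r / pi + 3 * \<delta>"
    using \<delta> by simp
  have "(\<lambda>n. Re ((\<Sum>i=1..n. of_real (g (u i))) / of_nat n)) \<longlonglongrightarrow> Re M"
    using M(1) by (rule tendsto_Re)
  then have "(\<lambda>n. (\<Sum>i=1..n. g (u i)) / real n) \<longlonglongrightarrow> Re M"
    by (simp add: Re_divide_of_nat)
  then have "\<forall>\<^sub>F n in sequentially. (\<Sum>i=1..n. g (u i)) / real n < r / pi + 3 * \<delta>"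
    by (rule order_tendstoD(2)) (fact ReM)
  moreover have "\<forall>\<^sub>F n in sequentially. n \<ge> 1"
    by (rule eventually_ge_at_top)
  ultimately show ?thesis
  proof eventually_elim
    case (elim n)
    have "indicator (cis ` {c - r..c + r}) (u i) \<le> g (u i) + \<delta>" if "i \<ge> 1" for i
    proof -
      have "indicator (cis ` {c - r..c + r}) (u i) \<le> h (u i)"
        using h0 h1 by (auto simp: indicator_def abs_le_iff)
      moreover have "\<bar>h (u i) - g (u i)\<bar> < \<delta>"
        using norm_u[OF that] by (intro g(2)) simp
      ultimately show ?thesis by linarith
    qed
    then have "(\<Sum>i=1..n. indicator (cis ` {c - r..c + r}) (u i)) \<le> (\<Sum>i=1..n. g (u i) + \<delta>)"
      by (intro sum_mono) auto
    then have "(\<Sum>i=1..n. indicator (cis ` {c - r..c + r}) (u i)) / real n \<le> (\<Sum>i=1..n. g (u i)) / real n + \<delta>"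
      using elim by (simp add: sum.distrib field_simps)
    then show ?case using elim \<delta> by linarith
  qed
qed

end

lemma equidistributed_angles:
  fixes \<alpha> :: "nat \<Rightarrow> real"
  assumes \<alpha>: "\<And>i. i \<ge> 1 \<Longrightarrow> 0 \<le> \<alpha> i \<and> \<alpha> i < 2 * pi"
    and means: "\<And>k. k \<ge> 1 \<Longrightarrow> (\<lambda>n. (\<Sum>i=1..n. cis (\<alpha> i) ^ k) / of_nat n) \<longlonglongrightarrow> 0"
    and xy: "0 \<le> x" "x < y" "y < 2 * pi"
  shows "(\<lambda>n. 1 / real n * (\<Sum>i=1..n. indicator {x..y} (\<alpha> i))) \<longlonglongrightarrow> (y - x) / (2 * pi)"
proof -
  interpret vanishing_power_means "\<lambda>i. cis (\<alpha> i)"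
    by unfold_locales (use means in simp_all)
  define F where "F a b n = (\<Sum>i=1..n. indicator {a..b} (\<alpha> i)) / real n" for a b n
  have upper: "\<forall>\<^sub>F n in sequentially. F a b n < (b - a) / (2 * pi) + e"
    if "a \<le> b" "b - a < 2 * pi" "e > 0" for a b e
  proof -
    have "\<forall>\<^sub>F n in sequentially.
      (\<Sum>i=1..n. indicator (cis ` {(a + b) / 2 - (b - a) / 2..(a + b) / 2 + (b - a) / 2}) (cis (\<alpha> i))) / real n
        < (b - a) / 2 / pi + e"
      using that by (intro arc_frequency_le) auto
    moreover have "(a + b) / 2 - (b - a) / 2 = a" "(a + b) / 2 + (b - a) / 2 = b"
      by (simp_all add: field_simps)
    ultimately have "\<forall>\<^sub>F n in sequentially.
      (\<Sum>i=1..n. indicator (cis ` {a..b}) (cis (\<alpha> i))) / real n < (b - a) / (2 * pi) + e"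
      by simp
    then show ?thesis
    proof eventually_elim
      case (elim n)
      have "F a b n \<le> (\<Sum>i=1..n. indicator (cis ` {a..b}) (cis (\<alpha> i))) / real n"
        unfolding F_def by (intro divide_right_mono sum_mono) (auto simp: indicator_def)
      then show ?case using elim by linarith
    qed
  qed
  \<comment> \<open>The three arcs cover the circle and their lengths add up to
    \<open>2 * pi\<close>, so upper bounds for the outer two give a lower bound for the middle
    one.\<close>
  have cover: "F 0 x n + F x y n + F y (2 * pi) n \<ge> 1" if "n \<ge> 1" for n
  proof -
    have "real n = (\<Sum>i=1..n. 1)" by simp
    also have "\<dots> \<le> (\<Sum>i=1..n. indicator {0..x} (\<alpha> i) + indicator {x..y} (\<alpha> i) +
        indicator {y..2 * pi} (\<alpha> i))"
    proof (rule sum_mono)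
      fix i assume "i \<in> {1..n}"
      then have "0 \<le> \<alpha> i" "\<alpha> i < 2 * pi" using \<alpha>[of i] by auto
      then show "(1::real) \<le> indicator {0..x} (\<alpha> i) + indicator {x..y} (\<alpha> i) + indicator {y..2 * pi} (\<alpha> i)"
        using xy by (auto simp: indicator_def)
    qed
    finally show ?thesis
      using that by (simp add: F_def sum.distrib flip: add_divide_distrib)
  qed
  have "F x y \<longlonglongrightarrow> (y - x) / (2 * pi)"
  proof (rule order_tendstoI)
    fix a assume a: "a < (y - x) / (2 * pi)"
    define e where "e = ((y - x) / (2 * pi) - a) / 2"
    have e: "e > 0" using a by (simp add: e_def)
    have "\<forall>\<^sub>F n in sequentially. F 0 x n < (x - 0) / (2 * pi) + e"
      using xy e by (intro upper) auto
    moreover have "\<forall>\<^sub>F n in sequentially. F y (2 * pi) n < (2 * pi - y) / (2 * pi) + e"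
      using xy e by (intro upper) auto
    moreover have "\<forall>\<^sub>F n in sequentially. n \<ge> 1"
      by (rule eventually_ge_at_top)
    ultimately show "\<forall>\<^sub>F n in sequentially. a < F x y n"
    proof eventually_elim
      case (elim n)
      have "(x - 0) / (2 * pi) + (2 * pi - y) / (2 * pi) = 1 - (a + 2 * e)"
        by (simp add: e_def field_simps)
      then show ?case
        using cover[OF elim(3)] elim(1,2) by argo
    qed
  next
    fix a assume "a > (y - x) / (2 * pi)"
    then show "\<forall>\<^sub>F n in sequentially. F x y n < a"
      using upper[of x y "a - (y - x) / (2 * pi)"] xy by simp
  qed
  then show ?thesis by (simp add: F_def[abs_def])
qed

section \<open>Units and roots of unity\<close>

text \<open>Generic in the ring, so that one integer polynomial can be evaluated at a real number
  and at its complex conjugates.\<close>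

definition ipoly :: "int poly \<Rightarrow> 'a :: {comm_ring_1, ring_char_0} \<Rightarrow> 'a" where
  "ipoly p x = poly (map_poly of_int p) x"

lemma ipoly_simps [simp]:
  shows ipoly_0: "ipoly 0 x = 0"
    and ipoly_1: "ipoly 1 x = 1"
    and ipoly_pCons: "ipoly (pCons a p) x = of_int a + x * ipoly p x"
    and ipoly_add: "ipoly (p + q) x = ipoly p x + ipoly q x"
    and ipoly_diff: "ipoly (p - q) x = ipoly p x - ipoly q x"
    and ipoly_smult: "ipoly (smult c p) x = of_int c * ipoly p x"
    and ipoly_mult: "ipoly (p * q) x = ipoly p x * ipoly q x"
    and ipoly_monom: "ipoly (monom c n) x = of_int c * x ^ n"
proof -
  have pC: "ipoly (pCons a p) x = of_int a + x * ipoly p x" for a p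
    by (simp add: ipoly_def map_poly_pCons)
  show "ipoly 0 x = 0" "ipoly 1 x = 1" by (simp_all add: ipoly_def)
  show "ipoly (pCons a p) x = of_int a + x * ipoly p x" by (fact pC)
  have add: "map_poly of_int (p + q) = map_poly of_int p + (map_poly of_int q :: 'a poly)" for p q
    by (simp add: poly_eq_iff coeff_map_poly)
  show a: "ipoly (p + q) x = ipoly p x + ipoly q x" for p q
    by (simp add: ipoly_def add)
  have diff: "map_poly of_int (p - q) = map_poly of_int p - (map_poly of_int q :: 'a poly)" for p q
    by (simp add: poly_eq_iff coeff_map_poly)
  show "ipoly (p - q) x = ipoly p x - ipoly q x"
    by (simp add: ipoly_def diff)
  have smult: "map_poly of_int (smult c p) = smult (of_int c) (map_poly of_int p :: 'a poly)" for c p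
    by (simp add: poly_eq_iff coeff_map_poly)
  show s: "ipoly (smult c p) x = of_int c * ipoly p x" for c p
    by (simp add: ipoly_def smult)
  show "ipoly (p * q) x = ipoly p x * ipoly q x"
    by (induction p) (use pC[of 0] in \<open>simp_all add: pC a s algebra_simps ipoly_def[of 0]\<close>)
  show "ipoly (monom c n) x = of_int c * x ^ n"
    by (simp add: ipoly_def map_poly_monom poly_monom)
qed

lemma ipoly_pcompose [simp]: "ipoly (p \<circ>\<^sub>p q) x = ipoly p (ipoly q x)"
  by (induction p) (simp_all add: pcompose_pCons)

lemma ipoly_of_real: "ipoly p (of_real x :: complex) = of_real (ipoly p x)"
  by (induction p) simp_all

text \<open>A primitive annihilator of least degree works. Divisibility is obtained over the
  integers, so leading and constant coefficients of \<open>g\<close> divide those of every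
  annihilator.\<close>

lemma minimal_int_poly:
  fixes y :: "'a :: {idom, ring_char_0}"
  assumes "p \<noteq> 0" and "ipoly p y = 0"
  obtains g where "g \<noteq> 0" and "ipoly g y = 0" and "\<And>f. ipoly f y = 0 \<Longrightarrow> g dvd f"
proof -
  define n where "n = (LEAST n. \<exists>q. q \<noteq> 0 \<and> ipoly q y = 0 \<and> degree q = n)"
  have ex: "\<exists>n q. q \<noteq> 0 \<and> ipoly q y = 0 \<and> degree q = n"
    using assms by blast
  obtain h where h: "h \<noteq> 0" "ipoly h y = 0" "degree h = n"
    using LeastI_ex[OF ex] unfolding n_def by blast
  have min: "q = 0" if "ipoly q y = 0" "degree q < n" for q
    using that not_less_Least[of "degree q" "\<lambda>n. \<exists>q. q \<noteq> 0 \<and> ipoly q y = 0 \<and> degree q = n"]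
    unfolding n_def by blast
  define g where "g = primitive_part h"
  have hg: "h = smult (content h) g"
    by (simp add: g_def)
  have g: "g \<noteq> 0" "ipoly g y = 0" "degree g = n" "content g = 1"
    using h hg ipoly_smult[of "content h" g y] by (auto simp: g_def)
  show ?thesis
  proof (rule that)
    fix f assume f: "ipoly f y = 0"
    obtain a q where aq: "a \<noteq> 0" "smult a f = g * q + pseudo_mod f g"
      and deg: "pseudo_mod f g = 0 \<or> degree (pseudo_mod f g) < degree g"
      using pseudo_mod[of g f] g(1) by blast
    have "ipoly (pseudo_mod f g) y = 0"
      using arg_cong[OF aq(2), of "\<lambda>p. ipoly p y"] f g(2) by simp
    then have "pseudo_mod f g = 0"
      using min deg g(3) by blast
    then have eq: "smult a f = g * q"
      using aq by simp
    \<comment> \<open>Pseudo-division only divides a multiple of \<open>f\<close>. By Gauss's lemma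
      the factor \<open>a\<close> is absorbed by the content of \<open>q\<close>, as
      \<open>g\<close> is primitive, and can be cancelled.\<close>
    then have "content (smult a f) = content q"
      using g(4) by (simp only: content_mult mult_1)
    then have "a dvd content q"
      by (metis content_smult dvd_triv_left dvd_normalize_iff mult_dvd_mono normalize_dvd_iff)
    then have "[:a:] dvd q"
      by (simp add: const_poly_dvd_iff_dvd_content)
    then obtain q' where "q = smult a q'"
      by (auto elim!: dvdE)
    then have "smult a f = smult a (g * q')"
      using eq by simp
    then have "smult a (f - g * q') = 0"
      by (simp add: smult_diff_right)
    then show "g dvd f"
      using aq(1) by simp
  qed (use g in auto)
qed

text \<open>
  \<open>g\<close> below plays the role of the minimal polynomial of \<open>y\<close>: its leading and constant coefficients
  are units, so its complex roots have product of absolute value 1.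
\<close>

lemma unit_not_in_disc:
  fixes y :: real
  assumes p: "ipoly p y = 0" "\<bar>lead_coeff p\<bar> = 1" "\<bar>coeff p 0\<bar> = 1"
    and f: "ipoly f y = 0" "\<And>z::complex. ipoly f z = 0 \<Longrightarrow> cmod z \<le> 1"
    and y: "\<bar>y\<bar> < 1"
  shows False
proof -
  have "p \<noteq> 0" using p(2) by auto
  then obtain g where g: "g \<noteq> 0" "ipoly g y = 0" and min: "\<And>f. ipoly f y = 0 \<Longrightarrow> g dvd f"
    using minimal_int_poly[of p y] p(1) by blast
  obtain h where h: "p = g * h"
    using min[OF p(1)] by (auto elim: dvdE)
  have unit: "\<bar>a\<bar> = 1" if "\<bar>a * b\<bar> = 1" for a b :: int
    using that by (metis abs_zmult_eq_1)
  have lc: "\<bar>lead_coeff g\<bar> = 1" and c0: "\<bar>coeff g 0\<bar> = 1"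
    using p(2,3) unfolding h by (auto simp: lead_coeff_mult coeff_mult_0 intro: unit)
  define G :: "complex poly" where "G = map_poly of_int g"
  have G: "ipoly g z = poly G z" for z
    by (simp add: ipoly_def G_def)
  have lcG: "lead_coeff G = of_int (lead_coeff g)"
    by (simp add: G_def lead_coeff_map_poly_nz degree_map_poly coeff_map_poly)
  have "G \<noteq> 0"
    using lcG g(1) by auto
  then have fin: "finite {z. poly G z = 0}"
    by (rule poly_roots_finite)
  have le: "cmod z \<le> 1" if "poly G z = 0" for z
  proof -
    have "ipoly f z = 0"
      using min[OF f(1)] that by (auto simp: G[symmetric] elim: dvdE)
    then show ?thesis by (rule f(2))
  qed
  have root: "poly G (of_real y) = 0"
    using g(2) by (simp add: G[symmetric] ipoly_of_real)
  have "poly G 0 = of_int (coeff g 0)"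
    by (simp add: G_def poly_0_coeff_0 coeff_map_poly)
  then have "1 = cmod (poly G 0)"
    using c0 by (simp flip: of_int_abs)
  also have "poly G 0 = lead_coeff G * (\<Prod>z | poly G z = 0. (- z) ^ order z G)"
    by (subst complex_poly_decompose[of G, symmetric]) (simp add: poly_prod)
  also have "cmod \<dots> = (\<Prod>z | poly G z = 0. cmod z ^ order z G)"
    using lc by (simp add: lcG norm_mult prod_norm[symmetric] norm_power flip: of_int_abs)
  \<comment> \<open>The root \<open>y\<close> has positive order and modulus below 1, and no other
    root contributes a factor above 1.\<close>
  also have "\<dots> = \<bar>y\<bar> ^ order (of_real y) G * (\<Prod>z \<in> {z. poly G z = 0} - {of_real y}. cmod z ^ order z G)"
    using fin root by (subst prod.remove[of _ "of_real y"]) auto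
  also have "\<dots> \<le> \<bar>y\<bar> ^ order (of_real y) G * 1"
    using le by (intro mult_left_mono prod_le_1) (auto simp: power_le_one)
  also have "\<dots> < 1"
    using y root \<open>G \<noteq> 0\<close> by (auto simp: order_root power_less_one_iff)
  finally show False by simp
qed

text \<open>Multiplying level \<open>k + 1\<close> by \<open>w + 1 / w\<close> yields the sum of
  levels \<open>k + 2\<close> and \<open>k\<close>. These are rescaled Chebyshev polynomials;
  integer coefficients let the equation \<open>w ^ n = 1\<close> be imposed on all conjugates at
  once.\<close>

lemma chebyshev_int_poly:
  "\<exists>p. \<forall>w::complex. w \<noteq> 0 \<longrightarrow> ipoly p (w + 1 / w) = w ^ n + 1 / w ^ n"
proof (induction n rule: less_induct)
  case (less n)
  consider "n = 0" | "n = 1" | k where "n = Suc (Suc k)"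
    by (metis One_nat_def old.nat.exhaust)
  then show ?case
  proof cases
    case 1
    then show ?thesis by (intro exI[of _ "[:2:]"]) simp
  next
    case 2
    then show ?thesis by (intro exI[of _ "[:0, 1:]"]) simp
  next
    case 3
    obtain p q where
      "\<And>w::complex. w \<noteq> 0 \<Longrightarrow> ipoly p (w + 1 / w) = w ^ k + 1 / w ^ k"
      "\<And>w::complex. w \<noteq> 0 \<Longrightarrow> ipoly q (w + 1 / w) = w ^ Suc k + 1 / w ^ Suc k"
      using less.IH[of k] less.IH[of "Suc k"] 3 by auto
    then show ?thesis
      using 3 by (intro exI[of _ "[:0, 1:] * q - p"]) (simp add: field_simps)
  qed
qed

text \<open>Such \<open>w\<close> are the roots of \<open>w\<^sup>2 - c * w + 1\<close>. This puts
  an arbitrary conjugate into the form to which the previous polynomials apply.\<close>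

lemma ex_plus_inverse: "\<exists>w::complex. w \<noteq> 0 \<and> w + 1 / w = c"
proof -
  define w where "w = (c + csqrt (c\<^sup>2 - 4)) / 2"
  have "w * (w - c) = (csqrt (c\<^sup>2 - 4) + c) * (csqrt (c\<^sup>2 - 4) - c) / 4"
    by (simp add: w_def field_simps)
  also have "\<dots> = ((csqrt (c\<^sup>2 - 4))\<^sup>2 - c\<^sup>2) / 4"
    by (simp add: power2_eq_square algebra_simps)
  finally have eq: "w * (w - c) = -1"
    by simp
  then have "w \<noteq> 0" by auto
  moreover have "w + 1 / w = c"
  proof -
    have "w * (c - w) = 1"
      using eq by (simp add: algebra_simps)
    then have "c - w = 1 / w"
      using \<open>w \<noteq> 0\<close> by (metis nonzero_mult_div_cancel_left)
    then show ?thesis by (metis add.commute diff_add_cancel)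
  qed
  ultimately show ?thesis by blast
qed

text \<open>
  If \<open>u\<close> were a root of unity, then so were all algebraic conjugates of \<open>u\<^sup>2\<close>. As
  \<open>4 * y ^ m = u\<^sup>2 + 2 + 1 / u\<^sup>2\<close>, all conjugates of the unit \<open>y\<close> would lie in the closed unit disc.
\<close>

lemma not_root_of_unity:
  fixes y :: real and u :: complex
  assumes y: "0 < y" "y < 1" and p: "ipoly p y = 0" "\<bar>lead_coeff p\<bar> = 1" "\<bar>coeff p 0\<bar> = 1"
    and u: "cmod u = 1" "(Re u)\<^sup>2 = y ^ m" and m: "m \<ge> 1" and n: "n \<ge> 1"
  shows "u ^ n \<noteq> 1"
proof
  assume un: "u ^ n = 1"
  obtain q where q: "\<And>w::complex. w \<noteq> 0 \<Longrightarrow> ipoly q (w + 1 / w) = w ^ n + 1 / w ^ n"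
    using chebyshev_int_poly by blast
  \<comment> \<open>A zero \<open>z\<close> of \<open>f\<close> is a number for which
    \<open>4 * z ^ m - 2 = w + 1 / w\<close> with \<open>w ^ n + 1 / w ^ n = 2\<close>, that is,
    with \<open>w ^ n = 1\<close>.\<close>
  define f where "f = q \<circ>\<^sub>p (monom 4 m - [:2:]) - [:2:]"
  have f: "ipoly f z = ipoly q (4 * z ^ m - 2) - 2" for z :: complex
    by (simp add: f_def)
  have "u \<noteq> 0" using u by auto
  have "1 / u = cnj u"
    using u(1) complex_norm_square[of u] \<open>u \<noteq> 0\<close> by (simp add: field_simps)
  then have "u\<^sup>2 + 1 / u\<^sup>2 = u\<^sup>2 + (cnj u)\<^sup>2"
    by (metis power_one_over)
  also have "\<dots> = of_real (4 * (Re u)\<^sup>2 - 2 * (cmod u)\<^sup>2)"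
    by (simp add: complex_eq_iff cmod_power2, simp add: power2_eq_square)
  finally have "u\<^sup>2 + 1 / u\<^sup>2 = 4 * of_real y ^ m - 2"
    using u by simp
  then have "ipoly f (of_real y :: complex) = (u\<^sup>2) ^ n + 1 / (u\<^sup>2) ^ n - 2"
    using q[of "u\<^sup>2"] \<open>u \<noteq> 0\<close> by (simp add: f)
  also have "(u\<^sup>2) ^ n = 1"
    using un by (metis mult.commute power_mult power_one)
  finally have fy: "ipoly f y = 0"
    by (simp add: ipoly_of_real)
  show False
  proof (rule unit_not_in_disc[OF p fy])
    show "\<bar>y\<bar> < 1" using y by simp
  next
    fix z :: complex
    assume fz: "ipoly f z = 0"
    obtain w where w: "w \<noteq> 0" "w + 1 / w = 4 * z ^ m - 2"
      using ex_plus_inverse by blast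
    have "w ^ n + 1 / w ^ n = 2"
      using fz q[OF w(1)] by (simp add: f w(2))
    then have "(w ^ n - 1)\<^sup>2 = 0"
      using w(1) by (simp add: field_simps power2_eq_square)
    then have "w ^ n = 1" by simp
    then have "cmod w = 1"
      using n by (metis norm_ge_zero norm_one norm_power power_eq_1_iff not_one_le_zero)
    have "4 * cmod z ^ m = cmod ((w + 1 / w) + 2)"
      by (simp add: w(2) norm_mult norm_power)
    also have "\<dots> \<le> cmod w + cmod (1 / w) + cmod 2"
      by (meson add_right_mono norm_triangle_ineq order_trans)
    finally have "cmod z ^ m \<le> 1"
      using \<open>cmod w = 1\<close> by (simp add: norm_divide)
    then show "cmod z \<le> 1"
      using m by (metis not_le one_less_power less_le_trans zero_less_one)
  qed
qed

section \<open>Poses and substitutions on poses\<close>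

text \<open>
  \<open>Pose i f u t\<close> encodes the copy of the \<open>i\<close>-th prototile with rotation \<open>u = cis \<alpha>\<close> and translation
  \<open>t\<close>. In \<open>pcomp p c\<close> only the motion of \<open>p\<close> matters, not its type.
\<close>

datatype pose = Pose (ptype: nat) (pflip: bool) (prot: complex) (pshift: complex)

definition pmap :: "pose \<Rightarrow> complex \<Rightarrow> complex" where
  "pmap p z = prot p * (if pflip p then cnj z else z) + pshift p"

definition base :: "nat \<Rightarrow> pose" where
  "base i = Pose i False 1 0"

definition pcomp :: "pose \<Rightarrow> pose \<Rightarrow> pose" where
  "pcomp p c = Pose (ptype c) (pflip p \<noteq> pflip c)
     (prot p * (if pflip p then cnj (prot c) else prot c)) (pmap p (pshift c))"

text \<open>Substituting scales positions but not tile sizes: the patch replacing a prototile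
  already fills the dilated prototile, so only the translation grows. As a motion this is
  \<open>p\<close> conjugated by the dilation.\<close>

definition pscale :: "real \<Rightarrow> pose \<Rightarrow> pose" where
  "pscale l p = Pose (ptype p) (pflip p) (prot p) (of_real l * pshift p)"

lemma pose_sel_simps [simp]:
  "ptype (base i) = i" "\<not> pflip (base i)" "prot (base i) = 1" "pshift (base i) = 0"
  "ptype (pcomp p c) = ptype c" "pflip (pcomp p c) \<longleftrightarrow> pflip p \<noteq> pflip c"
  "prot (pcomp p c) = prot p * (if pflip p then cnj (prot c) else prot c)"
  "pshift (pcomp p c) = pmap p (pshift c)"
  "ptype (pscale l p) = ptype p" "pflip (pscale l p) = pflip p" "prot (pscale l p) = prot p"
  "pshift (pscale l p) = of_real l * pshift p"
  by (simp_all add: base_def pcomp_def pscale_def)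

lemma pmap_base [simp]: "pmap (base i) = (\<lambda>z. z)"
  by (simp add: fun_eq_iff pmap_def)

lemma pmap_pcomp: "pmap (pcomp p c) z = pmap p (pmap c z)"
  by (simp add: pmap_def algebra_simps)

lemma pcomp_assoc: "pcomp (pcomp p q) c = pcomp p (pcomp q c)"
  by (simp add: pcomp_def pmap_def algebra_simps)

lemma pscale_pcomp: "pscale l (pcomp p c) = pcomp (pscale l p) (pscale l c)"
  by (simp add: pscale_def pcomp_def pmap_def algebra_simps)

lemma pscale_pscale: "pscale l (pscale l' p) = pscale (l * l') p"
  by (simp add: pscale_def mult_ac)

lemma pscale_1 [simp]: "pscale 1 p = p"
  by (simp add: pscale_def)

lemma pcomp_base [simp]: "pcomp p (base (ptype p)) = p"
  by (cases p) (simp add: pcomp_def pmap_def base_def)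

lemma pcomp_base_left [simp]: "pcomp (base i) p = p"
  by (cases p) (simp add: pcomp_def pmap_def base_def)

lemma pscale_base [simp]: "pscale l (base i) = base i"
  by (simp add: pscale_def base_def)

lemma pmap_pscale: "pmap (pscale l p) (of_real l * z) = of_real l * pmap p z"
  by (simp add: pmap_def algebra_simps)

lemma dist_pmap [simp]: "cmod (prot p) = 1 \<Longrightarrow> dist (pmap p x) (pmap p y) = dist x y"
proof -
  assume "cmod (prot p) = 1"
  have "pmap p x - pmap p y = prot p * (if pflip p then cnj (x - y) else x - y)"
    by (simp add: pmap_def algebra_simps)
  then show ?thesis
    using \<open>cmod (prot p) = 1\<close> by (simp add: dist_norm norm_mult del: complex_cnj_diff)
qed

lemma inj_pmap: "cmod (prot p) = 1 \<Longrightarrow> inj (pmap p)"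
  by (rule injI) (metis dist_pmap dist_eq_0_iff)

lemma surj_pmap: "cmod (prot p) = 1 \<Longrightarrow> surj (pmap p)"
proof -
  assume "cmod (prot p) = 1"
  then have "prot p \<noteq> 0" by auto
  then have "pmap p (if pflip p then cnj ((z - pshift p) / prot p) else (z - pshift p) / prot p) = z" for z
    by (simp add: pmap_def del: complex_cnj_diff complex_cnj_divide)
  then show ?thesis by (rule surjI)
qed

lemma continuous_on_pmap: "continuous_on A (pmap p)"
  unfolding pmap_def by (cases "pflip p") (auto intro!: continuous_intros)

lemma pcomp_inj: "cmod (prot p) = 1 \<Longrightarrow> inj (pcomp p)"
proof (rule injI)
  fix c d assume "cmod (prot p) = 1" and eq: "pcomp p c = pcomp p d"
  then have "prot p \<noteq> 0" by auto
  moreover have "pshift c = pshift d"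
    using eq inj_pmap[OF \<open>cmod (prot p) = 1\<close>] by (auto simp: pcomp_def dest: injD)
  ultimately show "c = d"
    using eq by (cases c; cases d) (auto simp: pcomp_def split: if_splits)
qed

lemma interior_pmap: "cmod (prot p) = 1 \<Longrightarrow> interior (pmap p ` A) = pmap p ` interior A"
proof -
  assume p: "cmod (prot p) = 1"
  then have "prot p \<noteq> 0" by auto
  define L where "L z = prot p * (if pflip p then cnj z else z)" for z
  have "linear L"
    unfolding L_def by (cases "pflip p") (auto intro!: linearI simp: algebra_simps scaleR_conv_of_real)
  moreover have "inj L"
    using \<open>prot p \<noteq> 0\<close> by (auto simp: L_def inj_on_def)
  ultimately have L: "interior (L ` A) = L ` interior A"
    by (rule interior_injective_linear_image)
  have "pmap p ` B = (\<lambda>z. pshift p + z) ` L ` B" for B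
    by (auto simp: pmap_def L_def image_image add.commute)
  then show ?thesis
    by (simp only: interior_translation L)
qed

lemma interior_dilation:
  fixes A :: "complex set"
  assumes "l \<noteq> 0"
  shows "interior ((*) (of_real l) ` A) = (*) (of_real l) ` interior A"
  using assms
  by (intro interior_injective_linear_image linearI)
     (auto simp: algebra_simps scaleR_conv_of_real inj_on_def)

definition sub :: "real \<Rightarrow> (nat \<Rightarrow> pose set) \<Rightarrow> pose set \<Rightarrow> pose set" where
  "sub l s P = (\<Union>p\<in>P. pcomp (pscale l p) ` s (ptype p))"

definition iter :: "real \<Rightarrow> (nat \<Rightarrow> pose set) \<Rightarrow> nat \<Rightarrow> nat \<Rightarrow> pose set" where
  "iter l s n i = (sub l s ^^ n) {base i}"

lemma sub_pcomp: "sub l s (pcomp p ` P) = pcomp (pscale l p) ` sub l s P"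
  by (auto simp: sub_def pscale_pcomp pcomp_assoc image_image intro!: image_eqI)

lemma sub_Union: "sub l s (\<Union>p\<in>P. f p) = (\<Union>p\<in>P. sub l s (f p))"
  by (auto simp: sub_def)

lemma sub_mono: "P \<subseteq> Q \<Longrightarrow> sub l s P \<subseteq> sub l s Q"
  by (auto simp: sub_def)

lemma iter_0 [simp]: "iter l s 0 i = {base i}"
  by (simp add: iter_def)

lemma iter_Suc: "iter l s (Suc n) i = sub l s (iter l s n i)"
  by (simp add: iter_def)

lemma iter_1 [simp]: "iter l s (Suc 0) i = s i"
  by (simp add: iter_Suc sub_def)

text \<open>Substitution commutes with motions up to scaling. The \<open>n\<close>-th power is
  therefore again a substitution, with supertiles of level \<open>n\<close> as its values, and facts
  about one step pass to supertiles.\<close>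

lemma funpow_sub: "(sub l s ^^ n) P = sub (l ^ n) (iter l s n) P"
proof (induction n)
  case 0
  show ?case by (simp add: sub_def)
next
  case (Suc n)
  have "(sub l s ^^ Suc n) P = sub l s (\<Union>p\<in>P. pcomp (pscale (l ^ n) p) ` iter l s n (ptype p))"
    using Suc.IH by (simp add: sub_def[of "l ^ n"])
  also have "\<dots> = (\<Union>p\<in>P. pcomp (pscale (l ^ Suc n) p) ` iter l s (Suc n) (ptype p))"
    by (simp add: sub_Union sub_pcomp pscale_pscale iter_Suc)
  finally show ?case
    unfolding sub_def[of "l ^ Suc n"] .
qed

text \<open>This groups a supertile of level \<open>n + k\<close> into supertiles of level
  \<open>n\<close>, placed at the tiles of a supertile of level \<open>k\<close>.\<close>

lemma iter_add: "iter l s (n + k) i = sub (l ^ n) (iter l s n) (iter l s k i)"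
  by (simp add: iter_def[of _ _ "n + k"] iter_def[of _ _ k] funpow_add funpow_sub[of n])

text \<open>\<open>pose_unique\<close> is what scalene triangles of different sizes provide: it
  recovers type, chirality, rotation and position from a bare set. Convexity makes a tile the
  closure of its interior.\<close>

locale prototiles =
  fixes N :: nat and T :: "nat \<Rightarrow> complex set"
  assumes compact_T: "i \<in> {1..N} \<Longrightarrow> compact (T i)"
    and convex_T: "i \<in> {1..N} \<Longrightarrow> convex (T i)"
    and interior_T: "i \<in> {1..N} \<Longrightarrow> interior (T i) \<noteq> {}"
    and pose_unique: "\<lbrakk>ptype p \<in> {1..N}; ptype q \<in> {1..N}; cmod (prot p) = 1; cmod (prot q) = 1;
      pmap p ` T (ptype p) = pmap q ` T (ptype q)\<rbrakk> \<Longrightarrow> p = q"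
begin

definition tile :: "pose \<Rightarrow> complex set" where
  "tile p = pmap p ` T (ptype p)"

definition valid :: "pose \<Rightarrow> bool" where
  "valid p \<longleftrightarrow> ptype p \<in> {1..N} \<and> cmod (prot p) = 1"

definition packing :: "pose set \<Rightarrow> bool" where
  "packing P \<longleftrightarrow> (\<forall>p\<in>P. valid p) \<and>
     (\<forall>p\<in>P. \<forall>q\<in>P. p \<noteq> q \<longrightarrow> interior (tile p) \<inter> interior (tile q) = {})"

text \<open>Packing and containment only; that nothing is missing is expressed numerically later, by
  weights forming an eigenvector.\<close>

definition dissects :: "real \<Rightarrow> (nat \<Rightarrow> pose set) \<Rightarrow> bool" where
  "dissects l s \<longleftrightarrow> l > 0 \<and> (\<forall>i\<in>{1..N}. finite (s i) \<and> packing (s i) \<and>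
     (\<forall>c\<in>s i. tile c \<subseteq> (*) (of_real l) ` T i))"

lemma valid_norm: "valid p \<Longrightarrow> cmod (prot p) = 1"
  and valid_type: "valid p \<Longrightarrow> ptype p \<in> {1..N}"
  by (simp_all add: valid_def)

lemma valid_base: "i \<in> {1..N} \<Longrightarrow> valid (base i)"
  by (simp add: valid_def)

lemma valid_pcomp: "cmod (prot p) = 1 \<Longrightarrow> valid c \<Longrightarrow> valid (pcomp p c)"
  by (simp add: valid_def norm_mult)

lemma tile_inj: "valid p \<Longrightarrow> valid q \<Longrightarrow> tile p = tile q \<Longrightarrow> p = q"
  using pose_unique by (simp add: valid_def tile_def)

lemma tile_base [simp]: "tile (base i) = T i"
  by (simp add: tile_def)

lemma tile_pcomp: "tile (pcomp p c) = pmap p ` tile c"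
  by (simp add: tile_def image_image pmap_pcomp)

lemma tile_dilation: "(*) (of_real l) ` tile p = pmap (pscale l p) ` ((*) (of_real l) ` T (ptype p))"
  by (simp add: tile_def image_image pmap_pscale)

lemma interior_tile: "valid p \<Longrightarrow> interior (tile p) \<noteq> {}"
  unfolding tile_def using interior_T by (simp add: valid_def interior_pmap)

text \<open>Allows a tile to be identified from a point on its boundary: an open set meeting the
  tile meets its interior.\<close>

lemma tile_subset_closure_interior: "valid p \<Longrightarrow> tile p \<subseteq> closure (interior (tile p))"
proof -
  assume p: "valid p"
  have "convex (T (ptype p))" "interior (T (ptype p)) \<noteq> {}" "closed (T (ptype p))"
    using p by (auto simp: valid_def compact_imp_closed compact_T convex_T interior_T)
  then have "T (ptype p) = closure (interior (T (ptype p)))"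
    by (simp add: convex_closure_interior)
  moreover have "pmap p ` closure (interior (T (ptype p))) \<subseteq> closure (pmap p ` interior (T (ptype p)))"
    by (intro image_closure_subset continuous_on_pmap closure_subset) auto
  ultimately show ?thesis
    using p by (simp add: tile_def interior_pmap valid_norm)
qed

lemma packing_singleton_iff: "packing {p} \<longleftrightarrow> valid p"
  by (simp add: packing_def)

lemma packing_pcomp:
  assumes "packing P" "cmod (prot p) = 1"
  shows "packing (pcomp p ` P)"
proof -
  have "interior (tile (pcomp p c)) \<inter> interior (tile (pcomp p d)) = {}"
    if "c \<in> P" "d \<in> P" "pcomp p c \<noteq> pcomp p d" for c d
  proof -
    have "interior (tile c) \<inter> interior (tile d) = {}"
      using that assms(1) unfolding packing_def by metis
    then show ?thesis
      using assms(2) by (simp add: tile_pcomp interior_pmap inj_pmap flip: image_Int)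
  qed
  then show ?thesis
    using assms by (auto simp: packing_def valid_pcomp)
qed

lemma packing_Un:
  assumes "packing P" "packing Q"
    and "\<And>p q. p \<in> P \<Longrightarrow> q \<in> Q \<Longrightarrow> interior (tile p) \<inter> interior (tile q) = {}"
  shows "packing (P \<union> Q)"
  unfolding packing_def
proof (intro conjI ballI impI)
  fix p q assume "p \<in> P \<union> Q" "q \<in> P \<union> Q" "p \<noteq> q"
  then show "interior (tile p) \<inter> interior (tile q) = {}"
    using assms(1,2) assms(3)[of p q] assms(3)[of q p] unfolding packing_def by blast
qed (use assms in \<open>auto simp: packing_def\<close>)

context
  fixes l s
  assumes dis: "dissects l s"
begin

lemma dissects_pos: "l > 0"
  using dis by (simp add: dissects_def)

lemma child_subset:
  assumes "valid p" "c \<in> s (ptype p)"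
  shows "tile (pcomp (pscale l p) c) \<subseteq> (*) (of_real l) ` tile p"
proof -
  have "tile c \<subseteq> (*) (of_real l) ` T (ptype p)"
    using assms dis by (auto simp: dissects_def valid_def)
  then show ?thesis
    unfolding tile_pcomp tile_dilation by (rule image_mono)
qed

lemma sub_subset:
  assumes "\<forall>p\<in>P. valid p" "\<forall>p\<in>P. tile p \<subseteq> R" "q \<in> sub l s P"
  shows "tile q \<subseteq> (*) (of_real l) ` R"
proof -
  obtain p c where p: "p \<in> P" "c \<in> s (ptype p)" "q = pcomp (pscale l p) c"
    using assms(3) by (auto simp: sub_def)
  have "tile q \<subseteq> (*) (of_real l) ` tile p"
    unfolding p(3) using assms(1) p by (intro child_subset) auto
  also have "\<dots> \<subseteq> (*) (of_real l) ` R"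
    using assms(2) p by (intro image_mono) auto
  finally show ?thesis .
qed

lemma finite_sub: "finite P \<Longrightarrow> packing P \<Longrightarrow> finite (sub l s P)"
  using dis by (auto simp: sub_def dissects_def packing_def valid_def)

lemma packing_child:
  assumes "valid p"
  shows "packing (pcomp (pscale l p) ` s (ptype p))"
  using assms dis by (intro packing_pcomp) (auto simp: dissects_def valid_def)

lemma children_disjoint:
  assumes "packing P" "p \<in> P" "q \<in> P" "p \<noteq> q"
    and "c \<in> pcomp (pscale l p) ` s (ptype p)" "d \<in> pcomp (pscale l q) ` s (ptype q)"
  shows "interior (tile c) \<inter> interior (tile d) = {}"
proof -
  have "valid p" "valid q" using assms by (auto simp: packing_def)
  have "tile c \<subseteq> (*) (of_real l) ` tile p" "tile d \<subseteq> (*) (of_real l) ` tile q"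
    using assms(5,6) child_subset \<open>valid p\<close> \<open>valid q\<close> by blast+
  then have "interior (tile c) \<inter> interior (tile d) \<subseteq>
      interior ((*) (of_real l) ` tile p) \<inter> interior ((*) (of_real l) ` tile q)"
    by (intro Int_mono interior_mono)
  also have "\<dots> = (*) (of_real l) ` (interior (tile p) \<inter> interior (tile q))"
    using dissects_pos by (auto simp: interior_dilation)
  also have "\<dots> = {}"
    using assms by (auto simp: packing_def)
  finally show ?thesis by blast
qed

lemma packing_sub:
  assumes "packing P"
  shows "packing (sub l s P)"
proof -
  have child: "packing (pcomp (pscale l p) ` s (ptype p))" if "p \<in> P" for p
    using that assms by (intro packing_child) (auto simp: packing_def)
  show ?thesis
    unfolding packing_def
  proof (intro conjI ballI impI)
    fix c assume "c \<in> sub l s P"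
    then show "valid c"
      using child by (auto simp: sub_def packing_def)
  next
    fix c d assume c: "c \<in> sub l s P" and d: "d \<in> sub l s P" and "c \<noteq> d"
    obtain p where p: "p \<in> P" "c \<in> pcomp (pscale l p) ` s (ptype p)"
      using c unfolding sub_def by blast
    obtain q where q: "q \<in> P" "d \<in> pcomp (pscale l q) ` s (ptype q)"
      using d unfolding sub_def by blast
    show "interior (tile c) \<inter> interior (tile d) = {}"
    proof (cases "p = q")
      case True
      then show ?thesis
        using child[OF p(1)] p q \<open>c \<noteq> d\<close> unfolding packing_def by blast
    next
      case False
      then show ?thesis
        using children_disjoint[OF assms p(1) q(1)] p q by blast
    qed
  qed
qed

text \<open>A common child would have an interior disjoint from itself, hence empty. So sums over
  \<open>sub\<close> split by parents, although \<open>sub\<close> is a set without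
  multiplicities.\<close>

lemma children_family_disjoint:
  assumes "packing P" "p \<in> P" "q \<in> P" "p \<noteq> q"
  shows "pcomp (pscale l p) ` s (ptype p) \<inter> pcomp (pscale l q) ` s (ptype q) = {}"
proof (rule ccontr)
  assume "\<not> ?thesis"
  then obtain c where c: "c \<in> pcomp (pscale l p) ` s (ptype p)" "c \<in> pcomp (pscale l q) ` s (ptype q)"
    by blast
  then have "interior (tile c) = {}"
    using children_disjoint[OF assms] by blast
  moreover have "valid c"
    using c(1) packing_child[of p] assms by (auto simp: packing_def)
  ultimately show False using interior_tile by blast
qed

lemma sum_sub:
  assumes "finite P" "packing P"
  shows "(\<Sum>q\<in>sub l s P. h q) = (\<Sum>p\<in>P. \<Sum>c\<in>s (ptype p). h (pcomp (pscale l p) c))"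
proof -
  have "(\<Sum>q\<in>sub l s P. h q) = (\<Sum>p\<in>P. \<Sum>q\<in>pcomp (pscale l p) ` s (ptype p). h q)"
    unfolding sub_def
    using assms dis children_family_disjoint[OF assms(2)]
    by (intro sum.UNION_disjoint) (auto simp: dissects_def packing_def valid_def)
  also have "\<dots> = (\<Sum>p\<in>P. \<Sum>c\<in>s (ptype p). h (pcomp (pscale l p) c))"
  proof (rule sum.cong[OF refl])
    fix p assume "p \<in> P"
    then have "inj (pcomp (pscale l p))"
      using assms by (intro pcomp_inj) (auto simp: packing_def valid_def)
    then show "(\<Sum>q\<in>pcomp (pscale l p) ` s (ptype p). h q) = (\<Sum>c\<in>s (ptype p). h (pcomp (pscale l p) c))"
      by (subst sum.reindex) (auto intro: inj_on_subset)
  qed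
  finally show ?thesis .
qed

lemma dissects_iter: "dissects (l ^ n) (iter l s n)"
proof (induction n)
  case 0
  show ?case by (auto simp: dissects_def packing_singleton_iff valid_base)
next
  case (Suc n)
  show ?case unfolding dissects_def
  proof (intro conjI ballI)
    show "l ^ Suc n > 0" using dissects_pos by simp
    fix i assume i: "i \<in> {1..N}"
    have IH: "finite (iter l s n i)" "packing (iter l s n i)"
        "\<forall>c\<in>iter l s n i. tile c \<subseteq> (*) (of_real (l ^ n)) ` T i"
      using Suc.IH i by (auto simp: dissects_def)
    show "finite (iter l s (Suc n) i)" "packing (iter l s (Suc n) i)"
      using IH by (auto simp: iter_Suc finite_sub packing_sub)
    fix c assume "c \<in> iter l s (Suc n) i"
    then have "tile c \<subseteq> (*) (of_real l) ` (*) (of_real (l ^ n)) ` T i"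
      using IH by (intro sub_subset[of "iter l s n i"]) (auto simp: iter_Suc packing_def)
    also have "\<dots> = (*) (of_real (l ^ Suc n)) ` T i"
      unfolding image_image by (rule image_cong) (simp_all add: mult.assoc)
    finally show "tile c \<subseteq> (*) (of_real (l ^ Suc n)) ` T i" .
  qed
qed

end

lemma copy_at_tile_iff:
  assumes "valid p" "i \<in> {1..N}"
  shows "copy_at (T i) f \<alpha> t (tile p) \<longleftrightarrow> 0 \<le> \<alpha> \<and> \<alpha> < 2 * pi \<and> p = Pose i f (cis \<alpha>) t"
proof -
  have "motion f \<alpha> t ` T i = tile (Pose i f (cis \<alpha>) t)"
    by (simp add: tile_def motion_def[abs_def] pmap_def[abs_def])
  moreover have "tile p = tile (Pose i f (cis \<alpha>) t) \<longleftrightarrow> p = Pose i f (cis \<alpha>) t"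
    using assms tile_inj[of p "Pose i f (cis \<alpha>) t"] by (auto simp: valid_def)
  ultimately show ?thesis
    by (simp add: copy_at_def)
qed

lemma valid_angle:
  assumes "valid p"
  obtains \<alpha> where "0 \<le> \<alpha>" "\<alpha> < 2 * pi" "p = Pose (ptype p) (pflip p) (cis \<alpha>) (pshift p)"
proof
  show "0 \<le> Arg2pi (prot p)" "Arg2pi (prot p) < 2 * pi"
    by (auto simp: Arg2pi_ge_0 Arg2pi_lt_2pi)
  have "prot p = cis (Arg2pi (prot p))"
    using Arg2pi_eq[of "prot p"] assms by (simp add: valid_def cis_conv_exp)
  then show "p = Pose (ptype p) (pflip p) (cis (Arg2pi (prot p))) (pshift p)"
    by (cases p) simp
qed

lemma is_copy_iff: "is_copy N T S \<longleftrightarrow> (\<exists>p. valid p \<and> S = tile p)"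
proof
  assume "is_copy N T S"
  then obtain i f \<alpha> t where "i \<in> {1..N}" "S = motion f \<alpha> t ` T i"
    unfolding is_copy_def copy_at_def by blast
  then show "\<exists>p. valid p \<and> S = tile p"
    by (intro exI[of _ "Pose i f (cis \<alpha>) t"]) (simp add: valid_def tile_def motion_def[abs_def] pmap_def[abs_def])
next
  assume "\<exists>p. valid p \<and> S = tile p"
  then obtain p where p: "valid p" "S = tile p" by blast
  then obtain \<alpha> where "0 \<le> \<alpha>" "\<alpha> < 2 * pi" "p = Pose (ptype p) (pflip p) (cis \<alpha>) (pshift p)"
    using valid_angle by blast
  then show "is_copy N T S"
    using p copy_at_tile_iff[OF p(1)] unfolding is_copy_def by (metis valid_type)
qed

lemma
  assumes "valid p"
  shows tile_angle_range: "0 \<le> tile_angle N T (tile p) \<and> tile_angle N T (tile p) < 2 * pi"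
    and cis_tile_angle: "cis (tile_angle N T (tile p)) = prot p"
proof -
  obtain \<alpha> where \<alpha>: "0 \<le> \<alpha>" "\<alpha> < 2 * pi" "p = Pose (ptype p) (pflip p) (cis \<alpha>) (pshift p)"
    using valid_angle assms by blast
  have "tile_angle N T (tile p) = \<alpha>"
    unfolding tile_angle_def
  proof (rule the_equality)
    show "\<exists>i\<in>{1..N}. \<exists>flip t. copy_at (T i) flip \<alpha> t (tile p)"
      using \<alpha> assms copy_at_tile_iff by (metis valid_type)
  next
    fix \<beta> assume "\<exists>i\<in>{1..N}. \<exists>flip t. copy_at (T i) flip \<beta> t (tile p)"
    then obtain i f t where "0 \<le> \<beta>" "\<beta> < 2 * pi" "p = Pose i f (cis \<beta>) t"
      using copy_at_tile_iff assms by metis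
    then show "\<beta> = \<alpha>"
      using \<alpha> by (metis Arg2pi_unique pose.sel(3) cis_conv_exp mult_1 of_real_1 zero_less_one)
  qed
  then show "0 \<le> tile_angle N T (tile p) \<and> tile_angle N T (tile p) < 2 * pi"
      "cis (tile_angle N T (tile p)) = prot p"
    using \<alpha> by (auto, metis pose.sel(3))
qed

text \<open>The existential presentation of a tile in \<open>subst_ext\<close> has only one
  solution, its pose. From here on substitutions are studied on poses.\<close>

lemma subst_ext_tile:
  assumes "\<forall>p\<in>P. valid p" "\<And>i. i \<in> {1..N} \<Longrightarrow> sT i = tile ` s i"
  shows "subst_ext N T l sT (tile ` P) = tile ` sub l s P"
proof -
  have eq: "motion f \<alpha> (of_real l * t) ` tile c = tile (pcomp (pscale l (Pose i f (cis \<alpha>) t)) c)" for f \<alpha> t c i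
    by (simp add: tile_pcomp motion_def[abs_def] pmap_def[abs_def])
  show ?thesis
  proof (intro equalityI subsetI)
    fix X assume "X \<in> subst_ext N T l sT (tile ` P)"
    then obtain f \<alpha> t c i p where *: "X = motion f \<alpha> (of_real l * t) ` tile c" "p \<in> P" "i \<in> {1..N}"
        "copy_at (T i) f \<alpha> t (tile p)" "c \<in> s i"
      unfolding subst_ext_def using assms(2) by auto
    then have "p = Pose i f (cis \<alpha>) t"
      using assms(1) copy_at_tile_iff by blast
    then have "X = tile (pcomp (pscale l p) c)" "c \<in> s (ptype p)"
      using * eq by auto
    then show "X \<in> tile ` sub l s P"
      using \<open>p \<in> P\<close> by (auto simp: sub_def)
  next
    fix X assume "X \<in> tile ` sub l s P"
    then obtain p c where *: "p \<in> P" "c \<in> s (ptype p)" "X = tile (pcomp (pscale l p) c)"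
      by (auto simp: sub_def)
    then obtain \<alpha> where \<alpha>: "0 \<le> \<alpha>" "\<alpha> < 2 * pi" "p = Pose (ptype p) (pflip p) (cis \<alpha>) (pshift p)"
      using valid_angle assms(1) by blast
    have "copy_at (T (ptype p)) (pflip p) \<alpha> (pshift p) (tile p)"
      using \<alpha> * assms(1) copy_at_tile_iff valid_type by blast
    moreover have "X = motion (pflip p) \<alpha> (of_real l * pshift p) ` tile c"
      unfolding *(3) by (subst (1) \<alpha>(3)) (rule eq[symmetric])
    moreover have "ptype p \<in> {1..N}" using * assms(1) valid_type by blast
    moreover have "tile c \<in> sT (ptype p)" using assms(2)[OF \<open>ptype p \<in> {1..N}\<close>] *(2) by simp
    ultimately show "X \<in> subst_ext N T l sT (tile ` P)"
      unfolding subst_ext_def using *(1) imageI[OF *(1), of tile] by blast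
  qed
qed

lemma funpow_subst_ext_tile:
  assumes "dissects l s" "i \<in> {1..N}" "\<And>i. i \<in> {1..N} \<Longrightarrow> sT i = tile ` s i"
  shows "(subst_ext N T l sT ^^ n) {T i} = tile ` iter l s n i"
proof (induction n)
  case (Suc n)
  have "\<forall>p\<in>iter l s n i. valid p"
    using dissects_iter[OF assms(1), of n] assms(2) by (auto simp: dissects_def packing_def)
  then have "subst_ext N T l sT (tile ` iter l s n i) = tile ` sub l s (iter l s n i)"
    using assms(3) by (rule subst_ext_tile)
  then show ?case
    by (simp add: Suc iter_Suc)
qed simp

end

section \<open>Counting tiles\<close>

text \<open>The inscribed discs are disjoint and of equal area, so no area of a tile has to be
  computed.\<close>

lemma card_times_ball_le:
  fixes X :: "complex set set"
  assumes "finite X" and r: "r > 0"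
    and ball: "\<And>S. S \<in> X \<Longrightarrow> \<exists>c. ball c r \<subseteq> interior S"
    and disj: "\<And>S S'. S \<in> X \<Longrightarrow> S' \<in> X \<Longrightarrow> S \<noteq> S' \<Longrightarrow> interior S \<inter> interior S' = {}"
    and A: "\<Union>X \<subseteq> A" "A \<in> fmeasurable lborel"
  shows "real (card X) * (pi * r\<^sup>2) \<le> measure lborel A"
proof -
  obtain c where c: "\<And>S. S \<in> X \<Longrightarrow> ball (c S) r \<subseteq> interior S"
    using ball by metis
  have "real (card X) * (pi * r\<^sup>2) = (\<Sum>S\<in>X. measure lborel (ball (c S) r))"
    using r by (simp add: content_ball unit_ball_vol_2)
  also have "\<dots> = measure lborel (\<Union>S\<in>X. ball (c S) r)"
  proof (rule measure_finite_Union[symmetric])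
    show "disjoint_family_on (\<lambda>S. ball (c S) r) X"
      unfolding disjoint_family_on_def using c disj by blast
    show "emeasure lborel (ball (c S) r) \<noteq> \<infinity>" for S
      using emeasure_lborel_ball_finite[of "c S" r] by simp
  qed (use \<open>finite X\<close> in auto)
  also have "\<dots> \<le> measure lborel A"
  proof (rule measure_mono_fmeasurable)
    show "(\<Union>S\<in>X. ball (c S) r) \<subseteq> A"
      using c A(1) interior_subset by blast
  qed (use A in \<open>auto intro!: borel_open open_UN\<close>)
  finally show ?thesis .
qed

lemma cball_fmeasurable: "cball c b \<in> fmeasurable lborel"
  using emeasure_lborel_cball_finite[of c b] by (intro fmeasurableI) auto

lemma content_annulus:
  fixes c :: complex
  assumes "0 \<le> a" "a \<le> b"
  shows "cball c b - ball c a \<in> fmeasurable lborel"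
    and "measure lborel (cball c b - ball c a) = pi * (b\<^sup>2 - a\<^sup>2)"
proof -
  show "cball c b - ball c a \<in> fmeasurable lborel"
    by (intro fmeasurable_Diff cball_fmeasurable) auto
  have "measure lborel (cball c b - ball c a) = measure lborel (cball c b) - measure lborel (ball c a)"
    using assms fmeasurableD2[OF cball_fmeasurable[of c b]] by (intro measure_Diff) auto
  then show "measure lborel (cball c b - ball c a) = pi * (b\<^sup>2 - a\<^sup>2)"
    using assms by (simp add: content_ball unit_ball_vol_2 content_cball algebra_simps)
qed

locale bounded_tiling =
  fixes \<T> :: "complex set set" and D r0 :: real
  assumes tiling: "tiling \<T>"
    and r0: "r0 > 0"
    and diam: "\<lbrakk>S \<in> \<T>; x \<in> S; y \<in> S\<rbrakk> \<Longrightarrow> dist x y \<le> D"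
    and inner_ball: "S \<in> \<T> \<Longrightarrow> \<exists>c. ball c r0 \<subseteq> interior S"
begin

lemma compact_tiles: "S \<in> \<T> \<Longrightarrow> compact S"
  and interiors_disjoint: "\<lbrakk>S \<in> \<T>; S' \<in> \<T>; S \<noteq> S'\<rbrakk> \<Longrightarrow> interior S \<inter> interior S' = {}"
  and covers: "\<exists>S\<in>\<T>. x \<in> S"
  using tiling by (auto simp: tiling_def)

lemma nonempty_tiles: "S \<in> \<T> \<Longrightarrow> S \<noteq> {}"
  using tiling by (auto simp: tiling_def)

lemma nearest_point:
  assumes "S \<in> \<T>"
  obtains x where "x \<in> S" "infdist 0 S = norm x"
  using infdist_attains_inf[of S "0 :: complex"] compact_imp_closed[OF compact_tiles[OF assms]]
    nonempty_tiles[OF assms] by auto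

lemma D_nonneg: "D \<ge> 0"
  using covers[of 0] diam[of _ 0 0] by auto

lemma near_subset: "S \<in> \<T> \<Longrightarrow> infdist 0 S \<le> r \<Longrightarrow> S \<subseteq> cball 0 (r + D)"
proof
  fix y assume S: "S \<in> \<T>" "infdist 0 S \<le> r" and y: "y \<in> S"
  obtain x where "x \<in> S" "infdist 0 S = norm x"
    using nearest_point S by blast
  then show "y \<in> cball 0 (r + D)"
    using diam[OF S(1) \<open>x \<in> S\<close> y] S(2) norm_triangle_sub[of y x] by (simp add: dist_norm norm_minus_commute)
qed

text \<open>A tile at distance between \<open>a\<close> and \<open>r\<close> avoids the open disc of
  radius \<open>a\<close> and stays within radius \<open>r + D\<close>. Its inscribed disc takes its
  share of the area of that annulus.\<close>

lemma card_annulus_le: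
  assumes "0 \<le> a" "a \<le> r + D"
  defines "X \<equiv> {S \<in> \<T>. a \<le> infdist 0 S \<and> infdist 0 S \<le> r}"
  shows "finite X \<and> real (card X) * r0\<^sup>2 \<le> (r + D)\<^sup>2 - a\<^sup>2"
proof -
  \<comment> \<open>The bound is first shown for finite subsets, uniformly; this is what makes
    \<open>X\<close> itself finite.\<close>
  have bound: "real (card Y) * r0\<^sup>2 \<le> (r + D)\<^sup>2 - a\<^sup>2" if Y: "Y \<subseteq> X" "finite Y" for Y
  proof -
    have "\<Union>Y \<subseteq> cball 0 (r + D) - ball 0 a"
    proof
      fix x assume "x \<in> \<Union>Y"
      then obtain S where S: "S \<in> X" "x \<in> S"
        using Y(1) by blast
      then have "infdist 0 S \<le> norm x"
        using infdist_le[of x S 0] by simp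
      then show "x \<in> cball 0 (r + D) - ball 0 a"
        using S near_subset[of S r] by (auto simp: X_def)
    qed
    then have "real (card Y) * (pi * r0\<^sup>2) \<le> measure lborel (cball (0::complex) (r + D) - ball 0 a)"
      using Y assms(1,2) inner_ball r0
      by (intro card_times_ball_le content_annulus interiors_disjoint) (auto simp: X_def)
    also have "\<dots> = pi * ((r + D)\<^sup>2 - a\<^sup>2)"
      using assms by (intro content_annulus)
    finally show ?thesis
      using pi_gt_zero by (simp add: mult.left_commute)
  qed
  have "finite X \<and> card X \<le> nat \<lceil>((r + D)\<^sup>2 - a\<^sup>2) / r0\<^sup>2\<rceil>"
  proof (rule finite_if_finite_subsets_card_bdd)
    fix Y assume "Y \<subseteq> X" "finite Y"
    then have "real (card Y) \<le> ((r + D)\<^sup>2 - a\<^sup>2) / r0\<^sup>2"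
      using bound r0 by (simp add: le_divide_eq)
    then show "card Y \<le> nat \<lceil>((r + D)\<^sup>2 - a\<^sup>2) / r0\<^sup>2\<rceil>"
      by linarith
  qed
  then show ?thesis using bound by blast
qed

lemma finite_near: "finite {S \<in> \<T>. infdist 0 S \<le> r}"
proof (cases "r \<ge> 0")
  case True
  then have "finite {S \<in> \<T>. 0 \<le> infdist 0 S \<and> infdist 0 S \<le> r}"
    using card_annulus_le[of 0 r] D_nonneg by simp
  then show ?thesis by (simp add: infdist_nonneg)
next
  case False
  then have "{S \<in> \<T>. infdist 0 S \<le> r} = {}"
    using infdist_nonneg[of "0 :: complex"] by (auto intro: order_trans)
  then show ?thesis by (simp only: finite.emptyI)
qed

lemma infinite_tiles: "infinite \<T>"
proof
  assume "finite \<T>"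
  then have "compact (\<Union>\<T>)"
    by (intro compact_Union) (auto simp: compact_tiles)
  moreover have "\<Union>\<T> = UNIV"
    using covers by blast
  ultimately show False
    using not_bounded_UNIV compact_imp_bounded by metis
qed

lemma ex_distance_enumeration: "\<exists>S. distance_enumeration \<T> S"
proof -
  have ex_min: "\<exists>S. S \<in> \<T> - F \<and> (\<forall>S'\<in>\<T> - F. infdist 0 S \<le> infdist 0 S')" if "finite F" for F
  proof -
    have "\<T> - F \<noteq> {}"
      using infinite_tiles that by (metis Diff_infinite_finite finite.emptyI)
    then obtain S0 where S0: "S0 \<in> \<T> - F" by blast
    let ?Y = "{S \<in> \<T> - F. infdist 0 S \<le> infdist 0 S0}"
    have fin: "finite ?Y"
      by (rule finite_subset[OF _ finite_near[of "infdist 0 S0"]]) auto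
    moreover have "?Y \<noteq> {}" using S0 by auto
    ultimately obtain S where S: "S \<in> ?Y" "\<And>S'. S' \<in> ?Y \<Longrightarrow> infdist 0 S \<le> infdist 0 S'"
      using ex_is_arg_min_if_finite[of ?Y "infdist 0"] by (auto simp: is_arg_min_linorder)
    then have "\<forall>S'\<in>\<T> - F. infdist 0 S \<le> infdist 0 S'"
      by force
    then show ?thesis using S by blast
  qed
  define next_tile where "next_tile F = (SOME S. S \<in> \<T> - F \<and> (\<forall>S'\<in>\<T> - F. infdist 0 S \<le> infdist 0 S'))" for F
  define used where "used n = ((\<lambda>F. insert (next_tile F) F) ^^ n) {}" for n
  have used_Suc: "used (Suc n) = insert (next_tile (used n)) (used n)" for n
    by (simp add: used_def)
  have fin: "finite (used n)" for n
    by (induction n) (simp_all add: used_Suc, simp add: used_def)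
  define S where "S n = next_tile (used n)" for n
  have S: "S n \<in> \<T> - used n" "\<And>S'. S' \<in> \<T> - used n \<Longrightarrow> infdist 0 (S n) \<le> infdist 0 S'" for n
    using someI_ex[OF ex_min[OF fin[of n]]] unfolding S_def next_tile_def by blast+
  have used: "used n = S ` {..<n}" for n
    by (induction n) (simp_all add: used_Suc lessThan_Suc S_def, simp add: used_def)
  have "S i \<noteq> S k" if "i < k" for i k
    using S(1)[of k] that unfolding used by auto
  then have inj: "inj S"
    by (metis injI linorder_neqE_nat)
  have mono: "infdist 0 (S n) \<le> infdist 0 (S (Suc n))" for n
    using S(2)[of "S (Suc n)" n] S(1)[of "Suc n"] unfolding used_Suc by blast
  \<comment> \<open>A tile never chosen would bound the distance of all chosen ones, but only
    finitely many tiles are that close.\<close>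
  have surj: "S' \<in> range S" if "S' \<in> \<T>" for S'
  proof (rule ccontr)
    assume "S' \<notin> range S"
    then have "range S \<subseteq> {X \<in> \<T>. infdist 0 X \<le> infdist 0 S'}"
      using S that unfolding used by blast
    then have "finite (range S)"
      using finite_near finite_subset by blast
    then show False
      using inj finite_imageD infinite_UNIV_nat by blast
  qed
  have "bij_betw (\<lambda>k. S (k - 1)) {1..} \<T>"
  proof (rule bij_betwI')
    fix x y :: nat assume "x \<in> {1..}" "y \<in> {1..}"
    then show "S (x - 1) = S (y - 1) \<longleftrightarrow> x = y"
      using inj by (auto simp: inj_eq)
  next
    fix y assume "y \<in> \<T>"
    then obtain n where "y = S n" using surj by blast
    then show "\<exists>x\<in>{1..}. y = S (x - 1)"
      by (intro bexI[of _ "Suc n"]) auto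
  qed (use S in auto)
  moreover have "infdist 0 (S (k - 1)) \<le> infdist 0 (S (Suc k - 1))" if "k \<ge> 1" for k
    using mono[of "k - 1"] that by simp
  ultimately show ?thesis
    unfolding distance_enumeration_def by blast
qed

context
  fixes S :: "nat \<Rightarrow> complex set"
  assumes enum: "distance_enumeration \<T> S"
begin

lemma enum_tile: "k \<ge> 1 \<Longrightarrow> S k \<in> \<T>"
  using enum by (auto simp: distance_enumeration_def bij_betw_def)

lemma enum_surj: "X \<in> \<T> \<Longrightarrow> \<exists>k\<ge>1. X = S k"
  using enum by (auto simp: distance_enumeration_def bij_betw_def)

lemma enum_inj: "inj_on S {1..n}"
  using enum by (auto simp: distance_enumeration_def bij_betw_def intro: inj_on_subset)

lemma enum_mono:
  assumes "1 \<le> k" "k \<le> n"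
  shows "infdist 0 (S k) \<le> infdist 0 (S n)"
  using assms(2)
proof (induction n rule: dec_induct)
  case (step n)
  then have "infdist 0 (S n) \<le> infdist 0 (S (Suc n))"
    using enum assms(1) by (simp add: distance_enumeration_def)
  then show ?case using step.IH by linarith
qed simp

lemma enum_closer: "k \<ge> 1 \<Longrightarrow> infdist 0 (S k) < infdist 0 (S n) \<Longrightarrow> n \<ge> 1 \<Longrightarrow> k < n"
  using enum_mono[of n k] by (cases "k < n") auto

lemma count_le:
  assumes "n \<ge> 1"
  shows "real n * r0\<^sup>2 \<le> (infdist 0 (S n) + D)\<^sup>2"
proof -
  define r where "r = infdist 0 (S n)"
  let ?X = "{X \<in> \<T>. 0 \<le> infdist 0 X \<and> infdist 0 X \<le> r}"
  have "finite ?X \<and> real (card ?X) * r0\<^sup>2 \<le> (r + D)\<^sup>2 - 0\<^sup>2"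
    by (intro card_annulus_le) (auto simp: r_def D_nonneg infdist_nonneg)
  moreover have "S ` {1..n} \<subseteq> ?X"
    using enum_tile enum_mono by (auto simp: r_def infdist_nonneg)
  ultimately have "card (S ` {1..n}) \<le> card ?X" "real (card ?X) * r0\<^sup>2 \<le> (r + D)\<^sup>2"
    by (auto intro: card_mono)
  moreover have "card (S ` {1..n}) = n"
    using card_image[OF enum_inj] by simp
  ultimately show ?thesis
    unfolding r_def by (smt (verit) mult_right_mono of_nat_mono zero_le_power2)
qed

text \<open>Every tile closer than \<open>S n\<close> has a smaller index, so the first
  \<open>n\<close> tiles cover the open disc up to \<open>S n\<close>. Its radius is thus at most of
  order \<open>sqrt n\<close>.\<close>

lemma count_ge:
  assumes "n \<ge> 1"
  shows "(infdist 0 (S n))\<^sup>2 \<le> real n * D\<^sup>2"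
proof -
  define r where "r = infdist 0 (S n)"
  have "r \<ge> 0" by (simp add: r_def infdist_nonneg)
  have "\<forall>k. \<exists>y. k \<ge> 1 \<longrightarrow> y \<in> S k"
    using nonempty_tiles enum_tile by blast
  then obtain x where x: "\<And>k. k \<ge> 1 \<Longrightarrow> x k \<in> S k"
    by metis
  have "ball 0 r \<subseteq> (\<Union>k\<in>{1..n}. cball (x k) D)"
  proof
    fix z :: complex assume z: "z \<in> ball 0 r"
    obtain X where "X \<in> \<T>" "z \<in> X" using covers by blast
    then obtain k where k: "k \<ge> 1" "z \<in> S k" using enum_surj by blast
    have "infdist 0 (S k) < r"
      using infdist_le[OF k(2), of 0] z by simp
    then have "k < n"
      using enum_closer k assms by (simp add: r_def)
    moreover have "dist (x k) z \<le> D"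
      using diam[OF enum_tile[OF k(1)] x[OF k(1)] k(2)] .
    ultimately show "z \<in> (\<Union>k\<in>{1..n}. cball (x k) D)"
      using k(1) by auto
  qed
  then have "measure lborel (ball (0::complex) r) \<le> measure lborel (\<Union>k\<in>{1..n}. cball (x k) D)"
    by (intro measure_mono_fmeasurable fmeasurable.finite_UN) (auto simp: cball_fmeasurable)
  also have "\<dots> \<le> (\<Sum>k\<in>{1..n}. measure lborel (cball (x k) D))"
    by (intro measure_UNION_le) auto
  also have "\<dots> = real n * (pi * D\<^sup>2)"
    using D_nonneg by (simp add: content_cball unit_ball_vol_2)
  finally have "pi * r\<^sup>2 \<le> pi * (real n * D\<^sup>2)"
    using \<open>r \<ge> 0\<close> by (simp add: content_ball unit_ball_vol_2 mult_ac)
  then show ?thesis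
    using pi_gt_zero unfolding r_def by (simp add: mult_le_cancel_left_pos)
qed

text \<open>The tiles counted lie in an annulus of bounded width, whose area is linear in the
  radius. By \<open>count_ge\<close> they number at most of order \<open>sqrt n\<close> among
  \<open>n\<close>.\<close>

lemma boundary_negligible:
  assumes "\<Delta> \<ge> 0"
  shows "(\<lambda>n. real (card {k \<in> {1..n}. infdist 0 (S n) - \<Delta> \<le> infdist 0 (S k)}) / real n) \<longlonglongrightarrow> 0"
proof (rule tendsto_sandwich[OF _ _ tendsto_const])
  define C where "C = (D + \<Delta>) / r0\<^sup>2"
  have "(\<lambda>n. C * (2 * D * sqrt (1 / real n) + D * (1 / real n))) \<longlonglongrightarrow> C * (2 * D * sqrt 0 + D * 0)"
    by (intro tendsto_intros lim_1_over_n)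
  then show "(\<lambda>n. C * (2 * D * sqrt (1 / real n) + D * (1 / real n))) \<longlonglongrightarrow> 0"
    by simp
  show "\<forall>\<^sub>F n in sequentially. real (card {k \<in> {1..n}. infdist 0 (S n) - \<Delta> \<le> infdist 0 (S k)}) / real n
      \<le> C * (2 * D * sqrt (1 / real n) + D * (1 / real n))"
  proof (rule eventually_sequentiallyI)
    fix n :: nat
    assume n: "n \<ge> max 1 (nat \<lceil>(\<Delta> + D)\<^sup>2 / r0\<^sup>2\<rceil>)"
    then have "n \<ge> 1" by simp
    define r where "r = infdist 0 (S n)"
    have "r \<ge> 0" by (simp add: r_def infdist_nonneg)
    \<comment> \<open>The threshold for \<open>n\<close> is chosen so that \<open>count_le\<close>
      forces \<Delta> \<le> r, which keeps the inner radius of the annulus non-negative.\<close>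
    have "(\<Delta> + D)\<^sup>2 / r0\<^sup>2 \<le> real n"
      using n by linarith
    then have "(\<Delta> + D)\<^sup>2 \<le> real n * r0\<^sup>2"
      using r0 by (simp add: divide_le_eq)
    also have "\<dots> \<le> (r + D)\<^sup>2"
      unfolding r_def by (rule count_le) fact
    finally have "\<Delta> + D \<le> r + D"
      by (rule power2_le_imp_le) (use \<open>r \<ge> 0\<close> D_nonneg in simp)
    then have "\<Delta> \<le> r" by simp
    let ?X = "{X \<in> \<T>. r - \<Delta> \<le> infdist 0 X \<and> infdist 0 X \<le> r}"
    let ?K = "{k \<in> {1..n}. r - \<Delta> \<le> infdist 0 (S k)}"
    have X: "finite ?X \<and> real (card ?X) * r0\<^sup>2 \<le> (r + D)\<^sup>2 - (r - \<Delta>)\<^sup>2"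
      using \<open>\<Delta> \<le> r\<close> assms D_nonneg by (intro card_annulus_le) auto
    have "S ` ?K \<subseteq> ?X"
      using enum_tile enum_mono by (auto simp: r_def)
    then have "card (S ` ?K) \<le> card ?X"
      using X by (intro card_mono) auto
    moreover have "card (S ` ?K) = card ?K"
      by (intro card_image inj_on_subset[OF enum_inj[of n]]) auto
    ultimately have "real (card ?K) * r0\<^sup>2 \<le> (r + D)\<^sup>2 - (r - \<Delta>)\<^sup>2"
      using X by (smt (verit) mult_right_mono of_nat_mono zero_le_power2)
    also have "\<dots> = (D + \<Delta>) * (2 * r + D - \<Delta>)"
      by (simp add: power2_eq_square algebra_simps)
    also have "\<dots> \<le> (D + \<Delta>) * (2 * (D * sqrt (real n)) + D)"
    proof (intro mult_left_mono)
      have "r \<le> sqrt (real n * D\<^sup>2)"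
        unfolding r_def using count_ge[OF \<open>n \<ge> 1\<close>] by (rule real_le_rsqrt)
      also have "\<dots> = D * sqrt (real n)"
        using D_nonneg by (simp add: real_sqrt_mult)
      finally show "2 * r + D - \<Delta> \<le> 2 * (D * sqrt (real n)) + D"
        using assms by linarith
    qed (use D_nonneg assms in auto)
    finally have "real (card ?K) \<le> C * (2 * (D * sqrt (real n)) + D)"
      using r0 by (simp add: C_def le_divide_eq)
    then have "real (card ?K) / real n \<le> C * (2 * (D * sqrt (real n)) + D) / real n"
      by (rule divide_right_mono) simp
    also have "\<dots> = C * (2 * D * (sqrt (real n) / real n) + D * (1 / real n))"
      by (simp add: algebra_simps add_divide_distrib)
    also have "sqrt (real n) / real n = sqrt (1 / real n)"
      using \<open>n \<ge> 1\<close> by (simp add: real_sqrt_divide frac_eq_eq)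
    finally show "real (card {k \<in> {1..n}. infdist 0 (S n) - \<Delta> \<le> infdist 0 (S k)}) / real n
      \<le> C * (2 * D * sqrt (1 / real n) + D * (1 / real n))"
      by (simp add: r_def)
  qed
qed auto

end

end

section \<open>Averaging over supertiles\<close>

text \<open>A motion multiplies the sum by a number of modulus 1, after conjugating it if it
  reflects. Congruent patches thus have angle sums of equal modulus.\<close>

lemma norm_sum_pcomp:
  assumes "cmod (prot p) = 1"
  shows "cmod (\<Sum>k\<in>I. prot (pcomp p (f k)) ^ e) = cmod (\<Sum>k\<in>I. prot (f k) ^ e)"
proof -
  have "(\<Sum>k\<in>I. prot (pcomp p (f k)) ^ e) =
      prot p ^ e * (if pflip p then cnj (\<Sum>k\<in>I. prot (f k) ^ e) else (\<Sum>k\<in>I. prot (f k) ^ e))"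
    by (simp add: power_mult_distrib sum_distrib_left)
  then show ?thesis
    using assms by (simp add: norm_mult norm_power del: cnj_sum)
qed

section \<open>From averages over supertiles to averages over the tiling\<close>

context prototiles
begin

lemma prototile_bounds:
  obtains r0 D where "r0 > 0"
    "\<And>i x y. \<lbrakk>i \<in> {1..N}; x \<in> T i; y \<in> T i\<rbrakk> \<Longrightarrow> dist x y \<le> D"
    "\<And>i. i \<in> {1..N} \<Longrightarrow> \<exists>c. ball c r0 \<subseteq> interior (T i)"
proof -
  have "\<forall>i\<in>{1..N}. \<exists>d. \<forall>x\<in>T i. \<forall>y\<in>T i. dist x y \<le> d"
    using compact_T compact_imp_bounded bounded_two_points by blast
  then obtain d where d: "\<And>i x y. \<lbrakk>i \<in> {1..N}; x \<in> T i; y \<in> T i\<rbrakk> \<Longrightarrow> dist x y \<le> d i"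
    by (metis (no_types, lifting) bchoice)
  have "\<forall>i\<in>{1..N}. \<exists>r. r > 0 \<and> (\<exists>c. ball c r \<subseteq> interior (T i))"
  proof
    fix i assume "i \<in> {1..N}"
    then obtain c where "c \<in> interior (T i)"
      using interior_T by blast
    then show "\<exists>r. r > 0 \<and> (\<exists>c. ball c r \<subseteq> interior (T i))"
      using open_interior open_contains_ball by blast
  qed
  then obtain r where r: "\<And>i. i \<in> {1..N} \<Longrightarrow> r i > 0 \<and> (\<exists>c. ball c (r i) \<subseteq> interior (T i))"
    by (metis (no_types, lifting) bchoice)
  show ?thesis
  proof
    \<comment> \<open>The added elements 1 and 0 keep \<open>Min\<close> and \<open>Max\<close>
      meaningful if there are no prototiles.\<close>
    show "Min (insert 1 (r ` {1..N})) > 0"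
      using r by simp
    show "dist x y \<le> Max (insert 0 (d ` {1..N}))" if "i \<in> {1..N}" "x \<in> T i" "y \<in> T i" for i x y
      using d[OF that] that by (intro Max.coboundedI[THEN order_trans[rotated]]) auto
    show "\<exists>c. ball c (Min (insert 1 (r ` {1..N}))) \<subseteq> interior (T i)" if i: "i \<in> {1..N}" for i
    proof -
      have "Min (insert 1 (r ` {1..N})) \<le> r i"
        using i by (intro Min.coboundedI) auto
      then show ?thesis
        using r[OF i] subset_ball by (meson order_trans)
    qed
  qed
qed

lemma bounded_tiling_copies:
  assumes "tiling \<T>" "\<forall>S\<in>\<T>. is_copy N T S"
    and r0: "r0 > 0"
    and D: "\<And>i x y. \<lbrakk>i \<in> {1..N}; x \<in> T i; y \<in> T i\<rbrakk> \<Longrightarrow> dist x y \<le> D"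
    and ball: "\<And>i. i \<in> {1..N} \<Longrightarrow> \<exists>c. ball c r0 \<subseteq> interior (T i)"
  shows "bounded_tiling \<T> D r0"
proof
  fix S x y assume S: "S \<in> \<T>" "x \<in> S" "y \<in> S"
  then obtain p where p: "valid p" "S = tile p"
    using assms(2) is_copy_iff by blast
  then obtain x' y' where "x = pmap p x'" "y = pmap p y'" "x' \<in> T (ptype p)" "y' \<in> T (ptype p)"
    using S(2,3) unfolding tile_def by blast
  then show "dist x y \<le> D"
    using D[OF valid_type[OF p(1)]] valid_norm[OF p(1)] by simp
next
  fix S assume "S \<in> \<T>"
  then obtain p where p: "valid p" "S = tile p"
    using assms(2) is_copy_iff by blast
  then obtain c where c: "ball c r0 \<subseteq> interior (T (ptype p))"
    using ball valid_type by blast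
  have norm: "cmod (prot p) = 1" using p(1) by (simp add: valid_def)
  have "ball (pmap p c) r0 \<subseteq> pmap p ` ball c r0"
  proof
    fix z assume z: "z \<in> ball (pmap p c) r0"
    obtain z' where z': "z = pmap p z'"
      using surj_pmap[OF norm] by (rule surjE)
    then have "z' \<in> ball c r0"
      using z dist_pmap[OF norm, of c z'] by simp
    then show "z \<in> pmap p ` ball c r0" using z' by blast
  qed
  also have "\<dots> \<subseteq> interior S"
    using c norm by (auto simp: p(2) tile_def interior_pmap)
  finally show "\<exists>c. ball c r0 \<subseteq> interior S" by blast
qed (use assms(1) r0 in auto)

text \<open>
  The patch \<open>S ` {1..n}\<close> is embedded by \<open>g\<close> into the tiling of a supertile of level \<open>M\<close>, which is
  grouped into supertiles of level \<open>L\<close>. One of these either is contained in the embedded patch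
  or has all its tiles in the patch close to the boundary of the disc covered by the patch.
\<close>

lemma patch_sum_le:
  assumes dis: "dissects l s" and "bounded_tiling \<T> D0 r0" and enum: "distance_enumeration \<T> S"
    and D: "\<And>i x y. \<lbrakk>i \<in> {1..N}; x \<in> T i; y \<in> T i\<rbrakk> \<Longrightarrow> dist x y \<le> D"
    and ps: "\<And>k. k \<ge> 1 \<Longrightarrow> valid (ps k) \<and> S k = tile (ps k)"
    and i0: "i0 \<in> {1..N}" and g: "cmod (prot g) = 1"
    and emb: "\<And>k. k \<in> {1..n} \<Longrightarrow> pmap g ` S k \<in> tile ` iter l s M i0"
    and L: "L \<le> M" "\<And>i. i \<in> {1..N} \<Longrightarrow> cmod (\<Sum>c\<in>iter l s L i. prot c ^ e) \<le> \<epsilon> * real (card (iter l s L i))"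
    and \<epsilon>: "\<epsilon> \<ge> 0"
  shows "cmod (\<Sum>k=1..n. prot (ps k) ^ e) \<le>
     \<epsilon> * real n + real (card {k \<in> {1..n}. infdist 0 (S n) - l ^ L * D \<le> infdist 0 (S k)})"
proof -
  interpret bounded_tiling \<T> D0 r0 by fact
  define q where "q k = pcomp g (ps k)" for k
  define Big where "Big = iter l s (M - L) i0"
  define F where "F p = pcomp (pscale (l ^ L) p) ` iter l s L (ptype p)" for p
  define Bad where "Bad = {k \<in> {1..n}. infdist 0 (S n) - l ^ L * D \<le> infdist 0 (S k)}"
  have disL: "dissects (l ^ L) (iter l s L)" and disM: "dissects (l ^ M) (iter l s M)"
    and disB: "dissects (l ^ (M - L)) (iter l s (M - L))"
    using dissects_iter[OF dis] by blast+
  have iterM: "iter l s M i0 = sub (l ^ L) (iter l s L) Big"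
    using iter_add[of l s L "M - L" i0] L(1) by (simp add: Big_def)
  also have "\<dots> = (\<Union>p\<in>Big. F p)"
    by (simp add: sub_def F_def)
  finally have iterM': "iter l s M i0 = (\<Union>p\<in>Big. F p)" .
  have Big: "finite Big" "packing Big"
    using disB i0 by (auto simp: dissects_def Big_def)
  have packM: "packing (iter l s M i0)"
    using disM i0 by (auto simp: dissects_def)
  have q: "valid (q k)" "tile (q k) = pmap g ` S k" if "k \<ge> 1" for k
    using ps[OF that] g by (auto simp: q_def valid_pcomp tile_pcomp)
  have q_iter: "q k \<in> iter l s M i0" if k: "k \<in> {1..n}" for k
  proof -
    obtain c where c: "c \<in> iter l s M i0" "tile (q k) = tile c"
      using emb[OF k] q(2)[of k] k by auto
    then have "q k = c"
      using q(1)[of k] k packM by (intro tile_inj) (auto simp: packing_def)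
    then show ?thesis using c by simp
  qed
  have inj_q: "inj_on q {1..n}"
  proof (rule inj_onI)
    fix k k' assume k: "k \<in> {1..n}" "k' \<in> {1..n}" "q k = q k'"
    then have "pmap g ` S k = pmap g ` S k'"
      using q(2)[of k] q(2)[of k'] by simp
    then have "S k = S k'"
      using inj_pmap[OF g] by (simp add: inj_image_eq_iff)
    then show "k = k'"
      using enum_inj[OF enum, of n] k by (auto dest: inj_onD)
  qed
  \<comment> \<open>All points of the supertile are within \<open>l ^ L * D\<close> of a point of
    the tile \<open>k0\<close> that lies deep inside the disc. An interior point of any tile
    \<open>x\<close> of the supertile therefore pulls back into a tile of the patch, and this tile
    must be \<open>x\<close>.\<close>
  have full: "F p \<subseteq> q ` {1..n}"
    if p: "p \<in> Big" and k0: "k0 \<in> {1..n}" "q k0 \<in> F p" "k0 \<notin> Bad" for p k0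
  proof
    fix x assume x: "x \<in> F p"
    have xM: "x \<in> iter l s M i0" using x p iterM' by blast
    then have "valid x" using packM by (simp add: packing_def)
    have "valid p" using p Big(2) by (simp add: packing_def)
    have sub: "tile y \<subseteq> (*) (of_real (l ^ L)) ` tile p" if y: "y \<in> F p" for y
    proof -
      obtain c where "c \<in> iter l s L (ptype p)" "y = pcomp (pscale (l ^ L) p) c"
        using y by (auto simp: F_def)
      then show ?thesis
        using child_subset[OF disL \<open>valid p\<close>] by blast
    qed
    obtain z where z: "z \<in> S k0" "infdist 0 (S k0) = norm z"
      using nearest_point enum_tile[OF enum] k0(1) by (metis atLeastAtMost_iff)
    have "norm z < infdist 0 (S n) - l ^ L * D"
      using k0(1,3) z(2) by (auto simp: Bad_def)
    have "pmap g z \<in> tile (q k0)"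
      using q(2)[of k0] k0(1) z(1) by auto
    then obtain z1 where z1: "z1 \<in> T (ptype p)" "pmap g z = of_real (l ^ L) * pmap p z1"
      using sub[OF k0(2)] by (auto simp: tile_def)
    obtain y where y: "y \<in> interior (tile x)"
      using interior_tile[OF \<open>valid x\<close>] by blast
    then obtain y1 where y1: "y1 \<in> T (ptype p)" "y = of_real (l ^ L) * pmap p y1"
      using sub[OF x] interior_subset by (fastforce simp: tile_def)
    obtain y' where y': "y = pmap g y'"
      using surj_pmap[OF g] by (rule surjE)
    have "dist y' z = dist y (pmap g z)"
      using g by (simp add: y')
    also have "\<dots> = l ^ L * dist (pmap p y1) (pmap p z1)"
      using dissects_pos[OF dis] unfolding y1(2) z1(2) dist_norm
      by (simp flip: right_diff_distrib add: norm_mult norm_power)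
    also have "\<dots> \<le> l ^ L * D"
      using D[OF _ y1(1) z1(1)] \<open>valid p\<close> dissects_pos[OF dis] by (simp add: valid_def)
    finally have "norm y' < infdist 0 (S n)"
      using \<open>norm z < _\<close> norm_triangle_sub[of y' z] by (simp add: dist_norm)
    obtain k where k: "k \<ge> 1" "y' \<in> S k"
      using covers enum_surj[OF enum] by metis
    have "infdist 0 (S k) \<le> norm y'"
      using infdist_le[OF k(2), of 0] by simp
    then have "k < n"
      using enum_closer[OF enum k(1)] \<open>norm y' < _\<close> k0(1) by simp
    then have kn: "k \<in> {1..n}" using k(1) by simp
    have "y \<in> tile (q k)"
      using q(2)[OF k(1)] k(2) y' by simp
    \<comment> \<open>\<open>y\<close> is interior to \<open>x\<close>, but may lie on the boundary
      of \<open>q k\<close>.\<close>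
    then have "interior (tile x) \<inter> closure (interior (tile (q k))) \<noteq> {}"
      using y tile_subset_closure_interior[OF q(1)[OF k(1)]] by blast
    then have "interior (tile x) \<inter> interior (tile (q k)) \<noteq> {}"
      by (simp add: open_Int_closure_eq_empty)
    then have "x = q k"
      using packM xM q_iter[OF kn] unfolding packing_def by blast
    then show "x \<in> q ` {1..n}" using kn by blast
  qed
  define I where "I p = {k \<in> {1..n}. q k \<in> F p}" for p
  \<comment> \<open>Either all tiles of the patch in this supertile are near the boundary and are
    counted one by one, or the supertile is complete and its mean is small by assumption.\<close>
  have local: "cmod (\<Sum>k\<in>I p. prot (q k) ^ e) \<le> \<epsilon> * real (card (I p)) + real (card (I p \<inter> Bad))" if p: "p \<in> Big" for p
  proof (cases "I p \<subseteq> Bad")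
    case True
    have "valid (q k)" if "k \<in> I p" for k
      using that q(1) by (simp add: I_def)
    then have "cmod (\<Sum>k\<in>I p. prot (q k) ^ e) \<le> (\<Sum>k\<in>I p. 1)"
      by (intro sum_norm_le) (simp add: norm_power valid_def)
    also have "\<dots> = real (card (I p \<inter> Bad))"
      using True by (simp add: Int_absorb2)
    finally show ?thesis
      using mult_nonneg_nonneg[OF \<epsilon> of_nat_0_le_iff[of "card (I p)"]] by linarith
  next
    case False
    then have "F p \<subseteq> q ` {1..n}"
      using full[OF p] by (auto simp: I_def)
    then have img: "q ` I p = F p"
      by (auto simp: I_def)
    have inj: "inj_on q (I p)"
      by (rule inj_on_subset[OF inj_q]) (auto simp: I_def)
    have "valid p" using p Big(2) by (simp add: packing_def)
    then have np: "cmod (prot (pscale (l ^ L) p)) = 1" by (simp add: valid_def)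
    have inj': "inj_on (pcomp (pscale (l ^ L) p)) (iter l s L (ptype p))"
      using pcomp_inj[OF np] by (rule inj_on_subset) simp
    have "card (I p) = card (F p)"
      using card_image[OF inj] img by simp
    also have "\<dots> = card (iter l s L (ptype p))"
      unfolding F_def by (rule card_image[OF inj'])
    finally have card: "card (I p) = card (iter l s L (ptype p))" .
    have "(\<Sum>k\<in>I p. prot (q k) ^ e) = (\<Sum>x\<in>F p. prot x ^ e)"
      unfolding img[symmetric] by (simp add: sum.reindex[OF inj])
    also have "\<dots> = (\<Sum>c\<in>iter l s L (ptype p). prot (pcomp (pscale (l ^ L) p) c) ^ e)"
      unfolding F_def by (simp only: sum.reindex[OF inj'] o_def)
    also have "cmod \<dots> = cmod (\<Sum>c\<in>iter l s L (ptype p). prot c ^ e)"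
      by (rule norm_sum_pcomp[OF np])
    also have "\<dots> \<le> \<epsilon> * real (card (I p))"
      unfolding card using \<open>valid p\<close> by (intro L(2)) (simp add: valid_def)
    finally show ?thesis by simp
  qed
  have F_disj: "F p \<inter> F p' = {}" if "p \<in> Big" "p' \<in> Big" "p \<noteq> p'" for p p'
    unfolding F_def using children_family_disjoint[OF disL Big(2) that] .
  have I_un: "{1..n} = (\<Union>p\<in>Big. I p)"
    using q_iter iterM' by (auto simp: I_def)
  have I_disj: "\<forall>p\<in>Big. \<forall>p'\<in>Big. p \<noteq> p' \<longrightarrow> I p \<inter> I p' = {}"
    using F_disj unfolding I_def by blast
  have fin: "finite (I p)" for p by (simp add: I_def)
  have "cmod (\<Sum>k=1..n. prot (ps k) ^ e) = cmod (\<Sum>k=1..n. prot (q k) ^ e)"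
    unfolding q_def by (rule norm_sum_pcomp[OF g, symmetric])
  also have "(\<Sum>k=1..n. prot (q k) ^ e) = (\<Sum>p\<in>Big. \<Sum>k\<in>I p. prot (q k) ^ e)"
    unfolding I_un using Big(1) fin I_disj by (intro sum.UNION_disjoint) auto
  also have "cmod \<dots> \<le> (\<Sum>p\<in>Big. \<epsilon> * real (card (I p)) + real (card (I p \<inter> Bad)))"
    by (intro sum_norm_le local)
  also have "\<dots> = \<epsilon> * real (\<Sum>p\<in>Big. card (I p)) + real (\<Sum>p\<in>Big. card (I p \<inter> Bad))"
    by (simp add: sum.distrib sum_distrib_left)
  also have "(\<Sum>p\<in>Big. card (I p)) = card (\<Union>p\<in>Big. I p)"
    using Big(1) fin I_disj by (intro card_UN_disjoint[symmetric]) auto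
  also have "\<dots> = n"
    unfolding I_un[symmetric] by simp
  also have "(\<Sum>p\<in>Big. card (I p \<inter> Bad)) = card (\<Union>p\<in>Big. I p \<inter> Bad)"
    using Big(1) fin I_disj by (intro card_UN_disjoint[symmetric]) auto
  also have "(\<Union>p\<in>Big. I p \<inter> Bad) = Bad"
    using I_un by (auto simp: Bad_def)
  finally show ?thesis by (simp add: Bad_def)
qed

theorem statistical_circular_symmetry_criterion:
  assumes dis: "dissects l s" and sT: "\<And>i. i \<in> {1..N} \<Longrightarrow> sT i = tile ` s i"
    and means: "\<And>e \<epsilon>. e \<ge> 1 \<Longrightarrow> \<epsilon> > 0 \<Longrightarrow>
      \<exists>L. \<forall>i\<in>{1..N}. cmod (\<Sum>c\<in>iter l s L i. prot c ^ e) \<le> \<epsilon> * real (card (iter l s L i))"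
    and \<T>: "substitution_tiling N T l sT \<T>"
  shows "statistical_circular_symmetry N T \<T>"
proof -
  obtain r0 D where D: "r0 > 0" "\<And>i x y. \<lbrakk>i \<in> {1..N}; x \<in> T i; y \<in> T i\<rbrakk> \<Longrightarrow> dist x y \<le> D"
    "\<And>i. i \<in> {1..N} \<Longrightarrow> \<exists>c. ball c r0 \<subseteq> interior (T i)"
    by (fact prototile_bounds)
  have "tiling \<T>" and copies: "\<forall>S\<in>\<T>. is_copy N T S"
    using \<T> by (auto simp: substitution_tiling_def)
  have bt: "bounded_tiling \<T> D r0"
    by (rule bounded_tiling_copies) fact+
  interpret bounded_tiling \<T> D r0 by (fact bt)
  have "(\<lambda>n. 1 / real n * (\<Sum>k=1..n. indicator {x..y} (tile_angle N T (S k)))) \<longlonglongrightarrow> (y - x) / (2 * pi)"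
    if enum: "distance_enumeration \<T> S" and xy: "0 \<le> x" "x < y" "y < 2 * pi" for S x y
  proof (rule equidistributed_angles[OF _ _ xy])
    have "\<forall>k. \<exists>p. k \<ge> 1 \<longrightarrow> valid p \<and> S k = tile p"
      using enum_tile[OF enum] copies is_copy_iff by blast
    then obtain ps where ps: "\<And>k. k \<ge> 1 \<Longrightarrow> valid (ps k) \<and> S k = tile (ps k)"
      by metis
    show "0 \<le> tile_angle N T (S k) \<and> tile_angle N T (S k) < 2 * pi" if "k \<ge> 1" for k
      using ps[OF that] tile_angle_range by simp
    have cis: "cis (tile_angle N T (S k)) = prot (ps k)" if "k \<ge> 1" for k
      using ps[OF that] cis_tile_angle by simp
    fix e :: nat assume e: "e \<ge> 1"
    have "(\<lambda>n. (\<Sum>k=1..n. prot (ps k) ^ e) / of_nat n) \<longlonglongrightarrow> 0"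
    proof (rule LIMSEQ_I)
      fix r :: real assume "r > 0"
      then obtain L where L: "\<And>i. i \<in> {1..N} \<Longrightarrow>
          cmod (\<Sum>c\<in>iter l s L i. prot c ^ e) \<le> r / 3 * real (card (iter l s L i))"
        using means[OF e, of "r / 3"] by (metis divide_pos_pos zero_less_numeral)
      define \<Delta> where "\<Delta> = l ^ L * D"
      have "\<Delta> \<ge> 0"
        using dissects_pos[OF dis] D_nonneg by (simp add: \<Delta>_def)
      define K where "K n = real (card {k \<in> {1..n}. infdist 0 (S n) - \<Delta> \<le> infdist 0 (S k)})" for n
      have "(\<lambda>n. K n / real n) \<longlonglongrightarrow> 0"
        unfolding K_def by (rule boundary_negligible[OF enum \<open>\<Delta> \<ge> 0\<close>])
      then have "\<forall>\<^sub>F n in sequentially. K n / real n < r / 3"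
        using \<open>r > 0\<close> by (intro order_tendstoD(2)[of _ 0]) auto
      then obtain n0 where n0: "\<And>n. n \<ge> n0 \<Longrightarrow> K n / real n < r / 3"
        by (auto simp: eventually_sequentially)
      \<comment> \<open>More tiles than any supertile of level below \<open>L\<close> has, so a
        patch of \<open>n1\<close> tiles only fits into level \<open>L\<close> or higher.\<close>
      define n1 where "n1 = Suc (\<Sum>M<L. \<Sum>i\<in>{1..N}. card (iter l s M i))"
      show "\<exists>n0. \<forall>n\<ge>n0. cmod ((\<Sum>k=1..n. prot (ps k) ^ e) / of_nat n - 0) < r"
      proof (intro exI allI impI)
        fix n assume n: "n \<ge> max n0 n1"
        then have "n \<ge> n1" "n \<ge> 1" by (auto simp: n1_def)
        let ?P = "S ` {1..n}"
        have "finite ?P" "?P \<subseteq> \<T>"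
          using enum_tile[OF enum] by auto
        then obtain M i0 Q where Q: "i0 \<in> {1..N}" "Q \<subseteq> (subst_ext N T l sT ^^ M) {T i0}"
            "congruent_patches ?P Q"
          using \<T> unfolding substitution_tiling_def by blast
        have iterM: "(subst_ext N T l sT ^^ M) {T i0} = tile ` iter l s M i0"
          using funpow_subst_ext_tile[OF dis Q(1)] sT by blast
        obtain f \<alpha> t where fat: "Q = (\<lambda>X. motion f \<alpha> t ` X) ` ?P"
          using Q(3) by (auto simp: congruent_patches_def)
        define g where "g = Pose 1 f (cis \<alpha>) t"
        have g: "cmod (prot g) = 1" by (simp add: g_def)
        have motion: "motion f \<alpha> t = pmap g"
          by (simp add: fun_eq_iff motion_def pmap_def g_def)
        have emb: "pmap g ` S k \<in> tile ` iter l s M i0" if "k \<in> {1..n}" for k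
          using Q(2) that unfolding iterM fat motion by blast
        have "L \<le> M"
        proof (rule ccontr)
          assume "\<not> L \<le> M"
          have fin: "finite (iter l s M i0)"
            using dissects_iter[OF dis, of M] Q(1) by (auto simp: dissects_def)
          have inj: "inj_on (\<lambda>k. pmap g ` S k) {1..n}"
          proof (rule inj_onI)
            fix k k' assume k: "k \<in> {1..n}" "k' \<in> {1..n}" "pmap g ` S k = pmap g ` S k'"
            then have "S k = S k'"
              by (simp add: inj_image_eq_iff[OF inj_pmap[OF g]])
            then show "k = k'"
              using inj_onD[OF enum_inj[OF enum]] k(1,2) by blast
          qed
          have "n = card ((\<lambda>k. pmap g ` S k) ` {1..n})"
            using card_image[OF inj] by simp
          also have "\<dots> \<le> card (tile ` iter l s M i0)"
            using emb fin by (intro card_mono) auto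
          also have "\<dots> \<le> card (iter l s M i0)"
            using fin by (rule card_image_le)
          also have "\<dots> \<le> (\<Sum>i\<in>{1..N}. card (iter l s M i))"
            using Q(1) by (intro member_le_sum) auto
          also have "\<dots> \<le> (\<Sum>M<L. \<Sum>i\<in>{1..N}. card (iter l s M i))"
            using \<open>\<not> L \<le> M\<close> by (intro member_le_sum) auto
          finally show False
            using \<open>n \<ge> n1\<close> by (simp add: n1_def)
        qed
        have "cmod (\<Sum>k=1..n. prot (ps k) ^ e) \<le> r / 3 * real n + K n"
          unfolding K_def \<Delta>_def
          by (rule patch_sum_le[OF dis bt enum D(2) ps Q(1) g emb \<open>L \<le> M\<close> L])
             (use \<open>r > 0\<close> in auto)
        moreover have "K n < r / 3 * real n"
          using n0[of n] n \<open>n \<ge> 1\<close> by (simp add: divide_less_eq)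
        moreover have "0 < r * real n"
          using \<open>r > 0\<close> \<open>n \<ge> 1\<close> by simp
        ultimately have "cmod (\<Sum>k=1..n. prot (ps k) ^ e) < r * real n"
          by simp
        then show "cmod ((\<Sum>k=1..n. prot (ps k) ^ e) / of_nat n - 0) < r"
          using \<open>n \<ge> 1\<close> by (simp add: norm_divide divide_less_eq)
      qed
    qed
    then show "(\<lambda>n. (\<Sum>k=1..n. cis (tile_angle N T (S k)) ^ e) / of_nat n) \<longlonglongrightarrow> 0"
      using cis by simp
  qed
  then show ?thesis
    unfolding statistical_circular_symmetry_def using ex_distance_enumeration by blast
qed

end

text \<open>Equality in the triangle inequality would make two distinct unit vectors
  parallel.\<close>

lemma norm_sum_unit_less:
  fixes f :: "'a \<Rightarrow> complex"
  assumes "finite K" "a \<in> K" "b \<in> K" "f a \<noteq> f b" and unit: "\<And>x. x \<in> K \<Longrightarrow> cmod (f x) = 1"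
  shows "cmod (sum f K) < card K"
proof -
  have "cmod (f a) = 1" "cmod (f b) = 1" using assms by auto
  have "cmod (f a + f b) \<noteq> cmod (f a) + cmod (f b)"
    using assms(4) \<open>cmod (f a) = 1\<close> \<open>cmod (f b) = 1\<close> by (subst norm_triangle_eq) simp
  then have ab: "cmod (f a + f b) < 2"
    using norm_triangle_ineq[of "f a" "f b"] \<open>cmod (f a) = 1\<close> \<open>cmod (f b) = 1\<close> by linarith
  have "a \<noteq> b" using assms(4) by auto
  have "sum f K = f a + f b + sum f (K - {a, b})"
    using assms(1-3) \<open>a \<noteq> b\<close> sum.subset_diff[of "{a, b}" K f] by (simp add: add.commute)
  moreover have "cmod (sum f (K - {a, b})) \<le> (\<Sum>x\<in>K - {a, b}. 1)"
    using unit by (intro sum_norm_le) auto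
  ultimately have "cmod (sum f K) < 2 + real (card (K - {a, b}))"
    using ab norm_triangle_ineq[of "f a + f b" "sum f (K - {a, b})"] by simp
  moreover have "card (K - {a, b}) + 2 = card K"
  proof -
    have "card {a, b} = 2" using \<open>a \<noteq> b\<close> by simp
    moreover have "card {a, b} \<le> card K" using assms(1-3) by (intro card_mono) auto
    ultimately show ?thesis
      using assms(1-3) by (simp add: card_Diff_subset)
  qed
  ultimately show ?thesis by simp
qed

section \<open>Geometric decay of weighted angle sums\<close>

context prototiles
begin

context
  fixes l s and v :: "nat \<Rightarrow> real" and \<Lambda> :: real
  assumes dis: "dissects l s"
    and v: "\<And>i. i \<in> {1..N} \<Longrightarrow> v i > 0"
    and weight: "\<And>i. i \<in> {1..N} \<Longrightarrow> (\<Sum>c\<in>s i. v (ptype c)) = \<Lambda> * v i"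
begin

lemma iter_finite: "i \<in> {1..N} \<Longrightarrow> finite (iter l s n i)"
  and iter_packing: "i \<in> {1..N} \<Longrightarrow> packing (iter l s n i)"
  using dissects_iter[OF dis] by (auto simp: dissects_def)

lemma iter_valid: "i \<in> {1..N} \<Longrightarrow> c \<in> iter l s n i \<Longrightarrow> valid c"
  using iter_packing by (auto simp: packing_def)

lemma weight_iter:
  assumes i: "i \<in> {1..N}"
  shows "(\<Sum>c\<in>iter l s n i. v (ptype c)) = \<Lambda> ^ n * v i"
proof (induction n)
  case (Suc n)
  have "(\<Sum>c\<in>iter l s (Suc n) i. v (ptype c)) = (\<Sum>p\<in>iter l s n i. \<Lambda> * v (ptype p))"
    unfolding iter_Suc using iter_valid[OF i, THEN valid_type]
    by (simp add: sum_sub[OF dis iter_finite[OF i] iter_packing[OF i]] weight)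
  then show ?case
    by (simp add: Suc sum_distrib_left[symmetric])
qed simp

context
  fixes e k :: nat
  assumes differ: "\<And>i. i \<in> {1..N} \<Longrightarrow> \<exists>p\<in>iter l s k i. \<exists>q\<in>iter l s k i.
    ptype p = ptype q \<and> pflip p = pflip q \<and> prot p ^ e \<noteq> prot q ^ e"
begin

definition angle_sum :: "nat \<Rightarrow> nat \<Rightarrow> complex" where
  "angle_sum n i = (\<Sum>c\<in>iter l s n i. prot c ^ e)"

definition kind :: "pose \<Rightarrow> nat \<times> bool" where
  "kind p = (ptype p, pflip p)"

text \<open>All tiles of one kind multiply the same angle sum of a lower supertile, so their
  rotations may be added before moduli are taken. Across kinds, only moduli are added.\<close>

definition kind_bound :: "nat \<Rightarrow> real" where
  "kind_bound i = (\<Sum>\<kappa>\<in>kind ` iter l s k i. v (fst \<kappa>) * cmod (\<Sum>p | p \<in> iter l s k i \<and> kind p = \<kappa>. prot p ^ e))"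

text \<open>Without cancellation the bound would be the total weight,
  \<open>\<Lambda> ^ k * v i\<close>. The two tiles from \<open>differ\<close> lie in one kind and
  force a strict loss there.\<close>

lemma kind_bound_less:
  assumes i: "i \<in> {1..N}"
  shows "kind_bound i < \<Lambda> ^ k * v i"
proof -
  let ?P = "iter l s k i"
  let ?K = "\<lambda>\<kappa>. {p \<in> ?P. kind p = \<kappa>}"
  have fin: "finite ?P" by (rule iter_finite[OF i])
  have vpos: "v (fst \<kappa>) > 0" if "\<kappa> \<in> kind ` ?P" for \<kappa>
    using that v iter_valid[OF i, THEN valid_type] by (auto simp: kind_def)
  have unit: "cmod (prot p ^ e) = 1" if "p \<in> ?P" for p
    using iter_valid[OF i that] by (simp add: norm_power valid_def)
  obtain p q where pq: "p \<in> ?P" "q \<in> ?P" "kind p = kind q" "prot p ^ e \<noteq> prot q ^ e"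
    using differ[OF i] by (auto simp: kind_def)
  have "kind_bound i < (\<Sum>\<kappa>\<in>kind ` ?P. v (fst \<kappa>) * card (?K \<kappa>))"
    unfolding kind_bound_def
  proof (rule sum_strict_mono_ex1)
    show "finite (kind ` ?P)" using fin by simp
    show "\<forall>\<kappa>\<in>kind ` ?P. v (fst \<kappa>) * cmod (\<Sum>p\<in>?K \<kappa>. prot p ^ e) \<le> v (fst \<kappa>) * real (card (?K \<kappa>))"
    proof
      fix \<kappa> assume "\<kappa> \<in> kind ` ?P"
      have "cmod (\<Sum>p\<in>?K \<kappa>. prot p ^ e) \<le> (\<Sum>p\<in>?K \<kappa>. 1)"
        using unit by (intro sum_norm_le) auto
      then show "v (fst \<kappa>) * cmod (\<Sum>p\<in>?K \<kappa>. prot p ^ e) \<le> v (fst \<kappa>) * real (card (?K \<kappa>))"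
        using vpos[OF \<open>\<kappa> \<in> kind ` ?P\<close>] by (intro mult_left_mono) auto
    qed
    have "cmod (\<Sum>p\<in>?K (kind p). prot p ^ e) < card (?K (kind p))"
      using fin pq unit by (intro norm_sum_unit_less[of _ p q]) auto
    then show "\<exists>\<kappa>\<in>kind ` ?P. v (fst \<kappa>) * cmod (\<Sum>p\<in>?K \<kappa>. prot p ^ e) < v (fst \<kappa>) * real (card (?K \<kappa>))"
      using pq(1) vpos by (intro bexI[of _ "kind p"] mult_strict_left_mono) auto
  qed
  also have "\<dots> = (\<Sum>\<kappa>\<in>kind ` ?P. \<Sum>p\<in>?K \<kappa>. v (ptype p))"
  proof (rule sum.cong[OF refl])
    fix \<kappa>
    have "(\<Sum>p\<in>?K \<kappa>. v (ptype p)) = (\<Sum>p\<in>?K \<kappa>. v (fst \<kappa>))"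
      by (rule sum.cong) (auto simp: kind_def)
    then show "v (fst \<kappa>) * real (card (?K \<kappa>)) = (\<Sum>p\<in>?K \<kappa>. v (ptype p))"
      by simp
  qed
  also have "\<dots> = (\<Sum>p\<in>?P. v (ptype p))"
    by (rule sum.image_gen[OF fin, symmetric])
  also have "\<dots> = \<Lambda> ^ k * v i"
    by (rule weight_iter[OF i])
  finally show ?thesis .
qed

lemma angle_sum_add_le:
  assumes i: "i \<in> {1..N}" and M: "\<And>i. i \<in> {1..N} \<Longrightarrow> cmod (angle_sum n i) \<le> M * v i"
  shows "cmod (angle_sum (n + k) i) \<le> M * kind_bound i"
proof -
  let ?P = "iter l s k i"
  let ?K = "\<lambda>\<kappa>. {p \<in> ?P. kind p = \<kappa>}"
  have fin: "finite ?P" by (rule iter_finite[OF i])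
  \<comment> \<open>A reflected tile carries the mirror image of the supertile, whose angle sum is
    the conjugate.\<close>
  define Z where "Z \<kappa> = (if snd \<kappa> then cnj (angle_sum n (fst \<kappa>)) else angle_sum n (fst \<kappa>))" for \<kappa>
  have Z: "cmod (Z \<kappa>) \<le> M * v (fst \<kappa>)" if "\<kappa> \<in> kind ` ?P" for \<kappa>
    using that M iter_valid[OF i, THEN valid_type] by (auto simp: Z_def kind_def)
  have "angle_sum (n + k) i = (\<Sum>p\<in>?P. \<Sum>c\<in>iter l s n (ptype p). prot (pcomp (pscale (l ^ n) p) c) ^ e)"
    unfolding angle_sum_def iter_add
    by (rule sum_sub[OF dissects_iter[OF dis] iter_finite[OF i] iter_packing[OF i]])
  also have "\<dots> = (\<Sum>p\<in>?P. Z (kind p) * prot p ^ e)"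
    by (intro sum.cong refl)
       (simp add: Z_def kind_def angle_sum_def power_mult_distrib sum_distrib_left mult.commute)
  also have "\<dots> = (\<Sum>\<kappa>\<in>kind ` ?P. \<Sum>p\<in>?K \<kappa>. Z (kind p) * prot p ^ e)"
    by (rule sum.image_gen[OF fin])
  also have "\<dots> = (\<Sum>\<kappa>\<in>kind ` ?P. Z \<kappa> * (\<Sum>p\<in>?K \<kappa>. prot p ^ e))"
    by (intro sum.cong refl) (simp add: sum_distrib_left)
  also have "cmod \<dots> \<le> (\<Sum>\<kappa>\<in>kind ` ?P. M * (v (fst \<kappa>) * cmod (\<Sum>p\<in>?K \<kappa>. prot p ^ e)))"
    using Z by (intro sum_norm_le) (auto simp: norm_mult mult.assoc[symmetric] intro!: mult_right_mono)
  also have "\<dots> = M * kind_bound i"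
    by (simp add: kind_bound_def sum_distrib_left)
  finally show ?thesis .
qed

lemma angle_sum_negligible:
  assumes \<epsilon>: "\<epsilon> > 0"
  shows "\<exists>L. \<forall>i\<in>{1..N}. cmod (\<Sum>c\<in>iter l s L i. prot c ^ e) \<le> \<epsilon> * real (card (iter l s L i))"
proof (cases "N = 0")
  case False
  then have "1 \<in> {1..N}" by simp
  have "0 \<le> kind_bound 1"
    unfolding kind_bound_def using v iter_valid[OF \<open>1 \<in> {1..N}\<close>, THEN valid_type]
    by (intro sum_nonneg mult_nonneg_nonneg) (auto simp: kind_def less_imp_le)
  then have \<Lambda>k: "\<Lambda> ^ k > 0"
    using kind_bound_less[OF \<open>1 \<in> {1..N}\<close>] v[OF \<open>1 \<in> {1..N}\<close>] by (smt (verit) zero_less_mult_pos2)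
  \<comment> \<open>The worst contraction ratio over the finitely many types.\<close>
  define q where "q = Max (insert 0 ((\<lambda>i. kind_bound i / (\<Lambda> ^ k * v i)) ` {1..N}))"
  have q: "0 \<le> q" "q < 1"
    using kind_bound_less v \<Lambda>k by (auto simp: q_def divide_less_eq)
  have kb: "kind_bound i \<le> q * \<Lambda> ^ k * v i" if i: "i \<in> {1..N}" for i
  proof -
    have "kind_bound i / (\<Lambda> ^ k * v i) \<le> q"
      unfolding q_def using i by (intro Max_ge) auto
    then show ?thesis
      using \<Lambda>k v[OF i] by (simp add: divide_le_eq mult.assoc)
  qed
  \<comment> \<open>\<open>C\<close> starts the induction, since the angle sum at level 0 is 1.
    \<open>V\<close> below turns total weight into a lower bound for the number of tiles.\<close>
  define C where "C = Max ((\<lambda>i. 1 / v i) ` {1..N})"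
  have C: "1 \<le> C * v i" if i: "i \<in> {1..N}" for i
  proof -
    have "1 / v i \<le> C"
      unfolding C_def using i by (intro Max_ge) auto
    then show ?thesis using v[OF i] by (simp add: divide_le_eq)
  qed
  have "C > 0"
    using C[OF \<open>1 \<in> {1..N}\<close>] v[OF \<open>1 \<in> {1..N}\<close>] by (smt (verit) zero_less_mult_pos2)
  define V where "V = Max (v ` {1..N})"
  have V: "v i \<le> V" if "i \<in> {1..N}" for i
    unfolding V_def using that by (intro Max_ge) auto
  have "V > 0"
    using V[OF \<open>1 \<in> {1..N}\<close>] v[OF \<open>1 \<in> {1..N}\<close>] by linarith
  have bound: "cmod (angle_sum (k * r) i) \<le> C * (q * \<Lambda> ^ k) ^ r * v i" if "i \<in> {1..N}" for r i
    using that
  proof (induction r arbitrary: i)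
    case 0
    then show ?case using C by (simp add: angle_sum_def)
  next
    case (Suc r)
    have "cmod (angle_sum (k * r + k) i) \<le> C * (q * \<Lambda> ^ k) ^ r * kind_bound i"
      using Suc by (intro angle_sum_add_le) auto
    also have "\<dots> \<le> C * (q * \<Lambda> ^ k) ^ r * (q * \<Lambda> ^ k * v i)"
      using kb[OF Suc.prems] \<open>C > 0\<close> q \<Lambda>k by (intro mult_left_mono) auto
    finally show ?case by (simp add: mult_ac add.commute)
  qed
  have "(\<lambda>r. C * V * q ^ r) \<longlonglongrightarrow> C * V * 0"
    using q by (intro tendsto_intros LIMSEQ_power_zero) auto
  then have "\<forall>\<^sub>F r in sequentially. C * V * q ^ r < \<epsilon>"
    using \<epsilon> by (intro order_tendstoD(2)) auto
  then obtain r where r: "C * V * q ^ r < \<epsilon>"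
    by (auto simp: eventually_sequentially)
  show ?thesis
  proof (intro exI ballI)
    fix i assume i: "i \<in> {1..N}"
    have "\<Lambda> ^ (k * r) * v i = (\<Sum>c\<in>iter l s (k * r) i. v (ptype c))"
      by (rule weight_iter[OF i, symmetric])
    also have "\<dots> \<le> (\<Sum>c\<in>iter l s (k * r) i. V)"
      by (intro sum_mono V valid_type iter_valid[OF i])
    finally have card: "\<Lambda> ^ (k * r) * v i \<le> V * card (iter l s (k * r) i)"
      by (simp add: mult.commute)
    have "cmod (\<Sum>c\<in>iter l s (k * r) i. prot c ^ e) \<le> C * q ^ r * (\<Lambda> ^ (k * r) * v i)"
      using bound[OF i, of r] by (simp add: angle_sum_def power_mult_distrib mult_ac power_mult)
    also have "\<dots> \<le> C * q ^ r * (V * card (iter l s (k * r) i))"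
      using card \<open>C > 0\<close> q by (intro mult_left_mono) auto
    also have "\<dots> = C * V * q ^ r * card (iter l s (k * r) i)"
      by simp
    also have "\<dots> \<le> \<epsilon> * card (iter l s (k * r) i)"
      using r by (intro mult_right_mono) auto
    finally show "cmod (\<Sum>c\<in>iter l s (k * r) i. prot c ^ e) \<le> \<epsilon> * real (card (iter l s (k * r) i))" .
  qed
qed auto

end

end

end

section \<open>The Pythagoras substitution\<close>

lemma convex_hull_pmap: "pmap p ` (convex hull S) = convex hull (pmap p ` S)"
proof -
  define L where "L z = prot p * (if pflip p then cnj z else z)" for z
  have "linear L"
    unfolding L_def by (cases "pflip p") (auto intro!: linearI simp: algebra_simps scaleR_conv_of_real)
  then have L: "L ` (convex hull S) = convex hull (L ` S)"
    by (rule convex_hull_linear_image)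
  have "pmap p ` B = (\<lambda>z. pshift p + z) ` L ` B" for B
    by (auto simp: pmap_def L_def image_image add.commute)
  then show ?thesis
    by (simp only: L convex_hull_translation)
qed

lemma convex_hull_dilation:
  fixes S :: "complex set"
  shows "(*) (of_real r) ` (convex hull S) = convex hull ((*) (of_real r) ` S)"
  by (intro convex_hull_linear_image linearI) (auto simp: algebra_simps scaleR_conv_of_real)

lemma hull3_subset_le:
  fixes n :: "'a :: euclidean_space"
  assumes "n \<bullet> x \<le> c" "n \<bullet> y \<le> c" "n \<bullet> z \<le> c"
  shows "convex hull {x, y, z} \<subseteq> {w. n \<bullet> w \<le> c}"
  using assms by (intro hull_minimal convex_halfspace_le) auto

lemma hull3_subset_ge:
  fixes n :: "'a :: euclidean_space"
  assumes "n \<bullet> x \<ge> c" "n \<bullet> y \<ge> c" "n \<bullet> z \<ge> c"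
  shows "convex hull {x, y, z} \<subseteq> {w. n \<bullet> w \<ge> c}"
  using assms by (intro hull_minimal convex_halfspace_ge) auto

lemma separated_interiors:
  fixes n :: "'a :: euclidean_space"
  assumes "X \<subseteq> {w. n \<bullet> w \<le> c}" "Y \<subseteq> {w. n \<bullet> w \<ge> c}" "n \<noteq> 0"
  shows "interior X \<inter> interior Y = {}"
proof -
  have "interior X \<subseteq> {w. n \<bullet> w < c}" "interior Y \<subseteq> {w. n \<bullet> w > c}"
    using interior_mono[OF assms(1)] interior_mono[OF assms(2)] assms(3) by auto
  then show ?thesis by fastforce
qed

lemma right_triangle_not_collinear:
  fixes A B C :: "'a :: euclidean_space"
  assumes "(A - C) \<bullet> (B - C) = 0" "A \<noteq> C" "B \<noteq> C"
  shows "\<not> collinear {A, C, B}"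
proof
  assume "collinear {A, C, B}"
  then have "collinear {0, A - C, B - C}"
    by (simp add: collinear_3)
  then obtain c where "B - C = c *\<^sub>R (A - C)"
    using assms(2,3) by (auto simp: collinear_lemma)
  then show False
    using assms by auto
qed

text \<open>Vertices are the extreme points of the hull, so the vertex sets agree. As the sides of
  each triangle are strictly ordered, only the matching that respects their order is
  possible.\<close>

lemma scalene_right_triangle_eq:
  fixes A B C A' B' C' :: "'a :: euclidean_space"
  assumes eq: "convex hull {A, C, B} = convex hull {A', C', B'}"
    and ab: "0 < a" "a < b" "a\<^sup>2 + b\<^sup>2 = 1" and s: "s > 0" "s' > 0"
    and d: "dist A C = a * s" "dist C B = b * s" "dist A B = s"
    and d': "dist A' C' = a * s'" "dist C' B' = b * s'" "dist A' B' = s'"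
  shows "s = s' \<and> A = A' \<and> C = C' \<and> B = B'"
proof -
  have ind: "\<not> affine_dependent {P, R, Q}"
    if "dist P R = a * r" "dist R Q = b * r" "dist P Q = r" "r > 0" for P Q R :: 'a and r
  proof -
    have "(P - R) \<bullet> (Q - R) = ((norm (P - R))\<^sup>2 + (norm (Q - R))\<^sup>2 - (norm (P - Q))\<^sup>2) / 2"
      using dot_norm_neg[of "P - R" "Q - R"] by simp
    also have "\<dots> = ((a * r)\<^sup>2 + (b * r)\<^sup>2 - r\<^sup>2) / 2"
      using that by (simp add: dist_norm norm_minus_commute)
    also have "\<dots> = (a\<^sup>2 + b\<^sup>2 - 1) * r\<^sup>2 / 2"
      by (simp add: algebra_simps)
    finally have "(P - R) \<bullet> (Q - R) = 0"
      by (simp only: ab(3)) simp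
    moreover have "P \<noteq> R" "Q \<noteq> R"
      using that ab(1,2) by auto
    ultimately have "\<not> collinear {P, R, Q}"
      by (rule right_triangle_not_collinear)
    then show ?thesis
      by (simp only: collinear_3_eq_affine_dependent) blast
  qed
  have "x \<in> {A, C, B} \<longleftrightarrow> x \<in> {A', C', B'}" for x
    using extreme_point_of_convex_hull_affine_independent[OF ind[OF d s(1)], of x]
      extreme_point_of_convex_hull_affine_independent[OF ind[OF d' s(2)], of x] eq by simp
  then have sets: "{A, C, B} = {A', C', B'}" by blast
  have "b < 1"
  proof (rule power2_less_imp_less)
    have "0 < a\<^sup>2" using ab by simp
    then show "b\<^sup>2 < 1\<^sup>2" using ab(3) by (simp only: one_power2)
  qed simp
  have bs: "0 < a * s" "a * s < b * s" "b * s < s" "0 < a * s'" "a * s' < b * s'" "b * s' < s'"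
    using ab s \<open>b < 1\<close> by auto
  have *: "A = A' \<or> A = C' \<or> A = B'" "C = A' \<or> C = C' \<or> C = B'" "B = A' \<or> B = C' \<or> B = B'"
    using sets by auto
  have "dist C' A' = a * s'" "dist B' C' = b * s'" "dist B' A' = s'"
    using d' by (simp_all only: dist_commute)
  moreover have "dist A' A' = 0" "dist B' B' = 0" "dist C' C' = 0"
    by simp_all
  ultimately show ?thesis
    using * d d' bs by (smt (verit))
qed

locale pythagoras_parameters =
  fixes m j :: nat
  assumes j: "1 \<le> j" "j < m"
begin

text \<open>
  \<open>\<mu>\<close> is the paper's \<open>\<lambda>\<close>, which is reserved syntax. The first prototile has legs \<open>a < b\<close> and
  hypotenuse 1, and \<open>\<omega> = cis \<theta>\<close> for its angle \<open>\<theta>\<close> between short leg and hypotenuse.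
\<close>

abbreviation \<eta> where "\<eta> \<equiv> eta m j"
abbreviation \<mu> where "\<mu> \<equiv> lam m j"

definition a :: real where "a = 1 / \<mu> ^ m"
definition b :: real where "b = \<mu> ^ j / \<mu> ^ m"
definition \<omega> :: complex where "\<omega> = Complex a b"

lemma eta_root: "\<eta> > 0" "\<eta> ^ m = \<eta> ^ j + 1"
proof -
  have "0 < \<eta> \<and> \<eta> ^ m - \<eta> ^ j - 1 = 0"
    unfolding eta_def by (rule theI'[OF eta_unique[OF j]])
  then show "\<eta> > 0" "\<eta> ^ m = \<eta> ^ j + 1" by auto
qed

lemma eta_gt_1: "\<eta> > 1"
proof (rule ccontr)
  assume "\<not> \<eta> > 1"
  then have "\<eta> ^ m \<le> 1"
    using eta_root(1) by (intro power_le_one) auto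
  moreover have "\<eta> ^ j > 0"
    using eta_root(1) by simp
  ultimately show False using eta_root(2) by linarith
qed

lemma lam_sq: "\<mu>\<^sup>2 = \<eta>"
  using eta_root by (simp add: lam_def)

lemma lam_gt_1: "\<mu> > 1"
  using eta_gt_1 by (simp add: lam_def)

lemma lam_even_power: "\<mu> ^ (2 * n) = \<eta> ^ n"
  by (simp add: power_mult lam_sq)

lemma a_pos: "a > 0" and a_less_b: "a < b"
  using lam_gt_1 j by (auto simp: a_def b_def divide_strict_right_mono one_less_power)

lemma b_pos: "b > 0"
  using a_pos a_less_b by linarith

lemma a_sq_b_sq: "a\<^sup>2 + b\<^sup>2 = 1"
proof -
  have "\<mu> ^ (2 * m) = \<mu> ^ (2 * j) + 1"
    using eta_root by (simp add: lam_even_power)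
  then have "(\<mu> ^ m)\<^sup>2 = (\<mu> ^ j)\<^sup>2 + 1"
    by (simp only: power_mult[symmetric] mult.commute)
  moreover have "a\<^sup>2 + b\<^sup>2 = ((\<mu> ^ j)\<^sup>2 + 1) / (\<mu> ^ m)\<^sup>2"
    by (simp add: a_def b_def power_divide add_divide_distrib)
  moreover have "\<mu> ^ m > 0" using lam_gt_1 by simp
  ultimately show ?thesis
    by (metis divide_self_if order_less_irrefl power_eq_0_iff)
qed

lemma b_sq: "b * b = 1 - a * a"
  using a_sq_b_sq by (simp add: power2_eq_square)

lemma lam_m: "\<mu> ^ m = 1 / a" and lam_j: "\<mu> ^ j = b / a"
  using lam_gt_1 by (auto simp: a_def b_def)

lemma lam_2m: "\<mu> ^ (2 * m) = 1 / (a * a)" and lam_2j: "\<mu> ^ (2 * j) = b * b / (a * a)"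
  by (simp_all add: mult.commute[of 2] power_mult lam_m lam_j power2_eq_square)

lemma norm_omega: "cmod \<omega> = 1"
  using a_sq_b_sq by (simp add: \<omega>_def cmod_def)

lemma omega_sel [simp]: "Re \<omega> = a" "Im \<omega> = b"
  by (simp_all add: \<omega>_def)

lemma vertices: "vA = 0" "vC m j = Complex (- a) 0" "vB m j = Complex (- a) b"
proof -
  have "1 - a\<^sup>2 = b\<^sup>2" using a_sq_b_sq by linarith
  then have "sqrt (1 - a\<^sup>2) = b" using b_pos by simp
  then show "vB m j = Complex (- a) b"
    using b_pos by (simp add: vB_def a_def)
qed (simp_all add: vA_def vC_def a_def)

definition hyp :: "nat \<Rightarrow> real" where "hyp i = \<mu> ^ (i - 1)"

lemma hyp_pos: "hyp i > 0"
  using lam_gt_1 by (simp add: hyp_def)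

lemma hyp_inj: "i \<ge> 1 \<Longrightarrow> k \<ge> 1 \<Longrightarrow> hyp i = hyp k \<Longrightarrow> i = k"
  using lam_gt_1 by (auto simp: hyp_def dest: power_inject_exp[THEN iffD1, rotated])

lemma prototile_hull:
  "prototile m j i = convex hull {0, Complex (- (a * hyp i)) 0, Complex (- (a * hyp i)) (b * hyp i)}"
proof -
  have "prototile m j i = (*) (of_real (hyp i)) ` (convex hull {0, Complex (- a) 0, Complex (- a) b})"
    by (simp add: prototile_def vertices hyp_def)
  also have "\<dots> = convex hull ((*) (of_real (hyp i)) ` {0, Complex (- a) 0, Complex (- a) b})"
    by (rule convex_hull_dilation)
  also have "(*) (of_real (hyp i)) ` {0, Complex (- a) 0, Complex (- a) b} =
      {0, Complex (- (a * hyp i)) 0, Complex (- (a * hyp i)) (b * hyp i)}"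
  proof -
    have "of_real (hyp i) * Complex x y = Complex (x * hyp i) (y * hyp i)" for x y
      by (simp add: complex_eq_iff)
    then show ?thesis by simp
  qed
  finally show ?thesis .
qed

lemma scaled_prototile: "(*) (of_real (\<mu> ^ n)) ` prototile m j 1 = prototile m j (Suc n)"
  by (simp add: prototile_def image_image)

lemma dist_vertices:
  assumes "s > 0"
  shows "dist 0 (Complex (- (a * s)) 0) = a * s"
    and "dist (Complex (- (a * s)) 0) (Complex (- (a * s)) (b * s)) = b * s"
    and "dist 0 (Complex (- (a * s)) (b * s)) = s"
proof -
  have "(a * s)\<^sup>2 + (b * s)\<^sup>2 = (a\<^sup>2 + b\<^sup>2) * s\<^sup>2"
    by (simp add: algebra_simps)
  then show "dist 0 (Complex (- (a * s)) (b * s)) = s"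
    using assms by (simp add: dist_norm cmod_def a_sq_b_sq)
qed (use assms a_pos b_pos in \<open>simp_all add: dist_norm cmod_def\<close>)

text \<open>The pose is read off vertex by vertex: the vertex at the origin gives the translation,
  the right-angle vertex is real and so gives the rotation regardless of reflection, and the last
  vertex gives the chirality.\<close>

sublocale prototiles m "prototile m j"
proof
  fix i
  show "compact (prototile m j i)" "convex (prototile m j i)"
    unfolding prototile_hull by (auto intro!: finite_imp_compact_convex_hull)
  let ?A = "0 :: complex" and ?C = "Complex (- (a * hyp i)) 0"
    and ?B = "Complex (- (a * hyp i)) (b * hyp i)"
  have "\<not> collinear {?A, ?C, ?B}"
    using a_pos b_pos hyp_pos[of i]
    by (intro right_triangle_not_collinear) (auto simp: inner_complex_def complex_eq_iff)
  then have "interior (prototile m j i) =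
      {v. \<exists>x y z. 0 < x \<and> 0 < y \<and> 0 < z \<and> x + y + z = 1 \<and> x *\<^sub>R ?A + y *\<^sub>R ?C + z *\<^sub>R ?B = v}"
    unfolding prototile_hull by (intro interior_convex_hull_3_minimal) auto
  then have "(1/3) *\<^sub>R ?A + (1/3) *\<^sub>R ?C + (1/3) *\<^sub>R ?B \<in> interior (prototile m j i)"
    by (simp only: mem_Collect_eq) (intro exI[of _ "1/3"], simp)
  then show "interior (prototile m j i) \<noteq> {}" by blast
next
  fix p q assume *: "ptype p \<in> {1..m}" "ptype q \<in> {1..m}" "cmod (prot p) = 1" "cmod (prot q) = 1"
    "pmap p ` prototile m j (ptype p) = pmap q ` prototile m j (ptype q)"
  let ?s = "hyp (ptype p)" and ?s' = "hyp (ptype q)"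
  let ?C = "\<lambda>s. Complex (- (a * s)) 0" and ?B = "\<lambda>s. Complex (- (a * s)) (b * s)"
  have "?s = ?s' \<and> pmap p 0 = pmap q 0 \<and> pmap p (?C ?s) = pmap q (?C ?s') \<and> pmap p (?B ?s) = pmap q (?B ?s')"
  proof (rule scalene_right_triangle_eq[OF _ a_pos a_less_b a_sq_b_sq hyp_pos hyp_pos])
    show "convex hull {pmap p 0, pmap p (?C ?s), pmap p (?B ?s)} =
        convex hull {pmap q 0, pmap q (?C ?s'), pmap q (?B ?s')}"
      using *(5) by (simp add: prototile_hull convex_hull_pmap)
  qed (use *(3,4) dist_vertices hyp_pos in simp_all)
  then have s: "?s = ?s'" and A: "pmap p 0 = pmap q 0" and C: "pmap p (?C ?s) = pmap q (?C ?s)"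
    and B: "pmap p (?B ?s) = pmap q (?B ?s)" by auto
  have type: "ptype p = ptype q"
    using s *(1,2) by (intro hyp_inj) auto
  have shift: "pshift p = pshift q"
    using A by (cases "pflip p"; cases "pflip q") (simp_all add: pmap_def)
  have real: "cnj (?C r) = ?C r" "?C r = of_real (- (a * r))" for r
    by (simp_all add: complex_eq_iff)
  have rot: "prot p = prot q"
    using C a_pos hyp_pos[of "ptype p"] unfolding pmap_def real
    by (cases "pflip p"; cases "pflip q") (simp_all add: shift)
  have "prot q \<noteq> 0" using *(4) by auto
  then have "(if pflip p then cnj (?B ?s) else ?B ?s) = (if pflip q then cnj (?B ?s) else ?B ?s)"
    using B by (simp add: pmap_def shift rot)
  then have "pflip p = pflip q"
    using b_pos hyp_pos[of "ptype p"] by (auto simp: complex_eq_iff split: if_splits)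
  then show "p = q"
    using type shift rot by (cases p; cases q) simp
qed

lemma tile_hull:
  "tile p = convex hull {pmap p 0, pmap p (Complex (- (a * hyp (ptype p))) 0),
     pmap p (Complex (- (a * hyp (ptype p))) (b * hyp (ptype p)))}"
  by (simp add: tile_def prototile_hull convex_hull_pmap)

lemma tile_triangleI:
  assumes "pmap p 0 = A" "pmap p (Complex (- (a * hyp (ptype p))) 0) = C"
    "pmap p (Complex (- (a * hyp (ptype p))) (b * hyp (ptype p))) = B"
  shows "tile p = triangle A C B"
  using assms by (simp add: tile_hull)

end

section \<open>Supertiles of the Pythagoras substitution\<close>

context pythagoras_parameters
begin

lemma b_sq_left: "b * (b * x) = x - a * (a * x)"
  unfolding mult.assoc[symmetric] b_sq by (simp add: algebra_simps)

text \<open>The altitude cuts off triangles similar to the whole with reversed orientation, hence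
  both flags. The two rotations differ by a right angle.\<close>

definition childA :: pose where "childA = Pose 1 True (cnj \<omega>) 0"
definition childB :: pose where "childB = Pose (Suc j) True (- \<i> * cnj \<omega>) (-1)"

definition pyth_poses :: "nat \<Rightarrow> pose set" where
  "pyth_poses i = (if i < m then {base (Suc i)} else {childA, childB})"

abbreviation pyth_ext :: "pose set \<Rightarrow> pose set" where "pyth_ext \<equiv> sub \<mu> pyth_poses"
abbreviation pyth_iter :: "nat \<Rightarrow> nat \<Rightarrow> pose set" where "pyth_iter \<equiv> iter \<mu> pyth_poses"

lemma hyp_1 [simp]: "hyp 1 = 1" "hyp (Suc 0) = 1" and hyp_Suc_j [simp]: "hyp (Suc j) = b / a"
  by (simp_all add: hyp_def lam_j)

lemma norm_child_rotations [simp]: "cmod (cnj \<omega>) = 1" "cmod (- \<i> * cnj \<omega>) = 1" "cmod (\<i> * cnj \<omega>) = 1"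
  by (simp_all add: norm_omega norm_mult)

lemma valid_children [simp]: "valid childA" "valid childB"
  using j by (auto simp: valid_def childA_def childB_def norm_omega norm_mult)

text \<open>
  The vertices of the triangle \<open>\<mu> ^ m\<close> times the first prototile are \<open>0\<close>, \<open>-1\<close> and \<open>-cnj \<omega> / a\<close>,
  and the foot of its altitude is \<open>-a cnj \<omega>\<close>.
\<close>

lemma tile_childA: "tile childA = triangle 0 (Complex (- (a * a)) (a * b)) (-1)"
  using b_sq by (intro tile_triangleI) (simp_all add: childA_def pmap_def complex_eq_iff algebra_simps)

lemma tile_childB: "tile childB = triangle (-1) (Complex (- (a * a)) (a * b)) (Complex (-1) (b / a))"
  using a_pos b_pos
  by (intro tile_triangleI) (simp_all add: childB_def pmap_def complex_eq_iff field_simps b_sq b_sq_left)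

lemma pythagoras_eq_tile:
  assumes "i \<in> {1..m}"
  shows "pythagoras m j i = tile ` pyth_poses i"
proof (cases "i < m")
  case True
  then show ?thesis by (simp add: pythagoras_def pyth_poses_def)
next
  case False
  have "foot (-1) 0 (Complex (-1) (b / a)) = (a * a) *\<^sub>R Complex (-1) (b / a)"
  proof -
    have "(cmod (Complex (-1) (b / a)))\<^sup>2 = 1 / (a * a)"
      using a_pos by (simp add: cmod_power2, simp add: power2_eq_square field_simps b_sq)
    then show ?thesis
      by (simp add: foot_def inner_complex_def)
  qed
  then have "foot (-1) 0 (Complex (-1) (b / a)) = Complex (- (a * a)) (a * b)"
    using a_pos by (simp add: complex_eq_iff)
  moreover have "of_real (\<mu> ^ m) * vB m j = Complex (-1) (b / a)" "of_real (\<mu> ^ m) * vC m j = -1"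
    using a_pos by (simp_all add: vertices lam_m complex_eq_iff)
  ultimately show ?thesis
    using False by (simp add: pythagoras_def pyth_poses_def tile_childA tile_childB vertices(1) Let_def del: of_real_power)
qed

lemma lam_tile_m: "(*) (of_real \<mu>) ` prototile m j m = triangle 0 (-1) (Complex (-1) (b / a))"
proof -
  obtain k where k: "m = Suc k" using j by (cases m) auto
  have "(*) (of_real \<mu>) ` prototile m j m = (*) (of_real (\<mu> ^ m)) ` prototile m j 1"
    unfolding k prototile_def image_image by (rule image_cong) (simp_all add: mult.assoc)
  also have "\<dots> = convex hull ((*) (of_real (1 / a)) ` {0, Complex (- a) 0, Complex (- a) b})"
    unfolding prototile_hull hyp_1 mult_1_right lam_m convex_hull_dilation ..
  also have "(*) (of_real (1 / a)) ` {0, Complex (- a) 0, Complex (- a) b} = {0, -1, Complex (-1) (b / a)}"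
  proof -
    have "of_real (1 / a) * Complex x y = Complex (x / a) (y / a)" for x y
      by (simp add: complex_eq_iff)
    moreover have "Complex (-1) 0 = -1" by (simp add: complex_eq_iff)
    ultimately show ?thesis using a_pos by simp
  qed
  finally show ?thesis .
qed

lemma in_segment_hull:
  fixes z :: complex
  assumes "z = x + t *\<^sub>R (y - x)" "0 \<le> t" "t \<le> 1" "x \<in> convex hull S" "y \<in> convex hull S"
  shows "z \<in> convex hull S"
proof -
  have "z = (1 - t) *\<^sub>R x + t *\<^sub>R y"
    using assms(1) by (simp add: algebra_simps)
  then show ?thesis
    using convexD[OF convex_convex_hull assms(4,5), of "1 - t" t] assms(2,3) by simp
qed

lemma hull3_subset_hull:
  assumes "x \<in> convex hull S" "y \<in> convex hull S" "z \<in> convex hull S"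
  shows "convex hull {x, y, z} \<subseteq> convex hull S"
  using assms by (intro hull_minimal) auto

lemma ab_le_1: "a \<le> 1" "a * a \<le> 1" "b \<le> 1"
proof -
  have "0 \<le> b * b" "0 \<le> a * a" by simp_all
  then show "a * a \<le> 1" using b_sq by linarith
  have "a\<^sup>2 \<le> 1\<^sup>2" "b\<^sup>2 \<le> 1\<^sup>2"
    using a_sq_b_sq zero_le_power2[of a] zero_le_power2[of b] unfolding one_power2 by linarith+
  then show "a \<le> 1" "b \<le> 1"
    by (auto intro: power2_le_imp_le)
qed

lemma dissects_pyth: "dissects \<mu> pyth_poses"
  unfolding dissects_def
proof (intro conjI ballI)
  show "\<mu> > 0" using lam_gt_1 by simp
  fix i assume i: "i \<in> {1..m}"
  show "finite (pyth_poses i)" by (simp add: pyth_poses_def)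
  have children_disj: "interior (tile childA) \<inter> interior (tile childB) = {}"
  proof -
    \<comment> \<open>\<open>Complex a (- b)\<close> is parallel to the hypotenuse, so the two
      half-planes meet in the line of the altitude, where the inner product is
      \<open>- a\<close>.\<close>
    have "tile childA \<subseteq> {w. Complex a (- b) \<bullet> w \<ge> - a}"
      unfolding tile_childA using a_pos b_pos
      by (intro hull3_subset_ge) (simp_all add: inner_complex_def algebra_simps b_sq b_sq_left)
    moreover have "tile childB \<subseteq> {w. Complex a (- b) \<bullet> w \<le> - a}"
      unfolding tile_childB using a_pos b_pos ab_le_1
      by (intro hull3_subset_le) (simp_all add: inner_complex_def field_simps b_sq b_sq_left)
    moreover have "Complex a (- b) \<noteq> 0"
      using a_pos by (simp add: complex_eq_iff)
    ultimately have "interior (tile childB) \<inter> interior (tile childA) = {}"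
      by (intro separated_interiors)
    then show ?thesis by (simp add: Int_commute)
  qed
  show "packing (pyth_poses i)"
    using i children_disj by (auto simp: pyth_poses_def packing_def valid_base Int_commute)
  fix c assume c: "c \<in> pyth_poses i"
  show "tile c \<subseteq> (*) (of_real \<mu>) ` prototile m j i"
  proof (cases "i < m")
    case True
    obtain k where k: "i = Suc k" using i by (cases i) auto
    have "(*) (of_real \<mu>) ` prototile m j i = prototile m j (Suc i)"
      unfolding prototile_def k image_image by (rule image_cong) (simp_all add: mult.assoc)
    then show ?thesis
      using c True by (simp add: pyth_poses_def)
  next
    case False
    then have "i = m" using i by simp
    let ?R = "triangle 0 (-1) (Complex (-1) (b / a))"
    have "0 \<in> ?R" "-1 \<in> ?R" "Complex (-1) (b / a) \<in> ?R"
      by (auto intro: hull_inc)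
    moreover have "Complex (- (a * a)) (a * b) \<in> ?R"
    proof (rule in_segment_hull)
      show "Complex (- (a * a)) (a * b) = 0 + (a * a) *\<^sub>R (Complex (-1) (b / a) - 0)"
        using a_pos by (simp add: complex_eq_iff)
    qed (use ab_le_1 in \<open>auto intro: hull_inc\<close>)
    ultimately have "tile childA \<subseteq> ?R" "tile childB \<subseteq> ?R"
      unfolding tile_childA tile_childB by (intro hull3_subset_hull; simp)+
    then show ?thesis
      using c False by (auto simp: \<open>i = m\<close> lam_tile_m pyth_poses_def)
  qed
qed

lemma pyth_iter_small: "n < m \<Longrightarrow> pyth_iter n 1 = {base (Suc n)}"
proof (induction n)
  case (Suc n)
  then have "pyth_iter (Suc n) 1 = pyth_ext {base (Suc n)}"
    by (simp only: iter_Suc)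
  also have "\<dots> = {base (Suc (Suc n))}"
    using Suc.prems by (simp add: sub_def pyth_poses_def)
  finally show ?case .
qed (simp add: One_nat_def)

lemma pyth_iter_m: "pyth_iter m 1 = {childA, childB}"
proof -
  obtain k where k: "m = Suc k" using j by (cases m) auto
  then have "pyth_iter m 1 = pyth_ext {base m}"
    using pyth_iter_small[of k] by (simp only: iter_Suc)
  then show ?thesis by (simp add: sub_def pyth_poses_def)
qed

lemma pyth_iter_add: "pyth_iter (n + k) 1 = (pyth_ext ^^ n) (pyth_iter k 1)"
  by (simp add: iter_def funpow_add)

text \<open>Each prototile is an early iterate of the first one, so every supertile can be described
  by a level above type 1.\<close>

lemma pyth_iter_shift: "k < m \<Longrightarrow> pyth_iter n (Suc k) = pyth_iter (n + k) 1"
  unfolding pyth_iter_add[of n k] pyth_iter_small by (simp only: iter_def)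

lemma funpow_pyth_ext_pcomp: "(pyth_ext ^^ n) (pcomp p ` P) = pcomp (pscale (\<mu> ^ n) p) ` (pyth_ext ^^ n) P"
proof (induction n)
  case (Suc n)
  then show ?case by (simp add: sub_pcomp pscale_pscale)
qed simp

text \<open>The first dissection happens at level \<open>m\<close>. Its part at \<open>A\<close> has
  type 1 and keeps \<open>n\<close> levels; its part at \<open>B\<close> has type
  \<open>j + 1\<close> and counts as level \<open>n + j\<close>.\<close>

lemma pyth_iter_split:
  "pyth_iter (n + m) 1 = pcomp (pscale (\<mu> ^ n) childA) ` pyth_iter n 1 \<union> pcomp (pscale (\<mu> ^ n) childB) ` pyth_iter (n + j) 1"
proof -
  have "pyth_iter (n + m) 1 = sub (\<mu> ^ n) (pyth_iter n) {childA, childB}"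
    unfolding pyth_iter_add[of n m] pyth_iter_m by (rule funpow_sub)
  also have "\<dots> = pcomp (pscale (\<mu> ^ n) childA) ` pyth_iter n (ptype childA) \<union> pcomp (pscale (\<mu> ^ n) childB) ` pyth_iter n (ptype childB)"
    by (simp add: sub_def)
  also have "pyth_iter n (ptype childB) = pyth_iter (n + j) 1"
    using pyth_iter_shift[OF j(2), of n] by (simp only: childB_def pose.sel)
  finally show ?thesis by (simp add: childA_def)
qed

text \<open>
  \<open>pH\<close>, \<open>pC\<close>, \<open>pP\<close>, \<open>pQ\<close> are the points \<open>H\<close>, \<open>C\<close>, \<open>P\<close>, \<open>Q\<close> of the construction in the triangle
  \<open>\<mu> ^ (2 * m)\<close> times the first prototile.
\<close>

definition pH :: complex where "pH = Complex (- a) b"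
definition pC :: complex where "pC = Complex (- 1 / a) 0"
definition pP :: complex where "pP = Complex (- a) 0"
definition pQ :: complex where "pQ = Complex (- 1 / a) b"
definition pB :: complex where "pB = Complex (- 1 / a) (b / (a * a))"

definition tileCHP :: pose where "tileCHP = Pose (Suc j) False \<i> pH"
definition tileCHQ :: pose where "tileCHQ = Pose (Suc j) False (- \<i>) pC"
definition tileCPQ :: pose where "tileCPQ = Pose (Suc j) True \<i> pQ"
definition tileHPQ :: pose where "tileHPQ = Pose (Suc j) True (- \<i>) pP"
text \<open>Two reversals and two opposite turns cancel, which makes \<open>HQB\<close> a mere
  translate of a dilated prototile.\<close>

definition moveHQB :: pose where "moveHQB = Pose 1 False 1 pH"

definition patchHQB :: "pose set" where "patchHQB = pcomp moveHQB ` pyth_iter (2 * j) 1"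

text \<open>The altitude is drawn in the whole triangle and then in both parts. The part at
  \<open>A\<close> yields the corner tile and \<open>CHP\<close>, the part at \<open>B\<close>
  yields \<open>CHQ\<close> and the supertile \<open>HQB\<close> of level
  \<open>2 * j\<close>.\<close>

lemma pyth_iter_2m: "pyth_iter (2 * m) 1 = {base 1, tileCHP, tileCHQ} \<union> patchHQB"
proof -
  have om: "\<omega> * cnj \<omega> = 1" "cnj \<omega> * \<omega> = 1"
    using norm_omega complex_norm_square[of \<omega>] by (simp_all add: mult.commute)
  have 1: "pcomp (pscale (\<mu> ^ m) childA) childA = base 1"
    by (simp add: childA_def pcomp_def base_def pmap_def om)
  have "cnj \<omega> * (\<i> * \<omega>) = \<i>" using om(2) by (simp add: mult.left_commute)
  then have 2: "pcomp (pscale (\<mu> ^ m) childA) childB = tileCHP"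
    by (simp add: childA_def childB_def pcomp_def pmap_def tileCHP_def pH_def complex_eq_iff)
  have "- (\<i> * cnj \<omega> * \<omega>) = - \<i>" using om(2) by (simp add: mult.assoc)
  then have 3: "pcomp (pscale (\<mu> ^ m) childB) (pcomp (pscale (\<mu> ^ j) childA) (base (Suc j))) = tileCHQ"
    by (simp add: childA_def childB_def pcomp_def pmap_def tileCHQ_def pC_def base_def lam_m pscale_def)
       (simp add: complex_eq_iff)
  have 4: "pcomp (pscale (\<mu> ^ m) childB) (pcomp (pscale (\<mu> ^ j) childB) x) = pcomp moveHQB x" for x
  proof -
    have "- (\<i> * cnj \<omega>) * cnj (- (\<i> * cnj \<omega>)) = 1"
      using om by (simp add: algebra_simps)
    moreover have "- (\<i> * cnj \<omega>) * cnj (of_real (\<mu> ^ j) * (- 1)) + of_real (\<mu> ^ m) * (- 1) = pH"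
      using a_pos b_sq by (simp add: lam_j lam_m pH_def complex_eq_iff field_simps del: of_real_power)
    ultimately have "pcomp (pscale (\<mu> ^ m) childB) (pscale (\<mu> ^ j) childB) = Pose (Suc j) False 1 pH"
      by (simp add: childB_def pcomp_def pscale_def pmap_def del: of_real_power)
    then have "pcomp (pscale (\<mu> ^ m) childB) (pcomp (pscale (\<mu> ^ j) childB) x) = pcomp (Pose (Suc j) False 1 pH) x"
      by (simp only: pcomp_assoc[symmetric])
    then show ?thesis
      by (simp add: pcomp_def moveHQB_def pmap_def)
  qed
  have "pyth_iter (2 * m) 1 = pyth_iter (m + m) 1" by (simp add: mult_2)
  also have "\<dots> = pcomp (pscale (\<mu> ^ m) childA) ` {childA, childB} \<union> pcomp (pscale (\<mu> ^ m) childB) ` pyth_iter (j + m) 1"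
    unfolding pyth_iter_split[of m] pyth_iter_m by (simp add: add.commute)
  also have "\<dots> = {base 1, tileCHP} \<union> pcomp (pscale (\<mu> ^ m) childB) `
      (pcomp (pscale (\<mu> ^ j) childA) ` {base (Suc j)} \<union> pcomp (pscale (\<mu> ^ j) childB) ` pyth_iter (2 * j) 1)"
    unfolding pyth_iter_split[of j] pyth_iter_small[OF j(2)] mult_2 by (simp only: image_insert image_empty 1 2)
  also have "\<dots> = {base 1, tileCHP} \<union> ({tileCHQ} \<union> patchHQB)"
    unfolding image_Un image_image patchHQB_def 4 by (simp add: 3)
  finally show ?thesis by blast
qed

end

section \<open>The Pythia substitution\<close>

context pythagoras_parameters
begin

lemmas points_def = pH_def pC_def pP_def pQ_def pB_def

definition pythia_poses_1 :: "pose set" where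
  "pythia_poses_1 = {base 1, tileCPQ, tileHPQ} \<union> patchHQB"

definition pythia_poses :: "nat \<Rightarrow> pose set" where
  "pythia_poses i = (pyth_ext ^^ (i - 1)) pythia_poses_1"

lemma tile_CHP: "tile tileCHP = triangle pC pH pP"
proof -
  have "tile tileCHP = triangle pH pP pC"
    using a_pos b_pos
    by (intro tile_triangleI) (simp_all add: tileCHP_def points_def pmap_def complex_eq_iff field_simps b_sq b_sq_left)
  then show ?thesis by (simp only: insert_commute)
qed

lemma tile_CHQ: "tile tileCHQ = triangle pC pH pQ"
proof -
  have "tile tileCHQ = triangle pC pQ pH"
    using a_pos b_pos
    by (intro tile_triangleI) (simp_all add: tileCHQ_def points_def pmap_def complex_eq_iff field_simps b_sq b_sq_left)
  then show ?thesis by (simp only: insert_commute)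
qed

lemma tile_CPQ: "tile tileCPQ = triangle pC pP pQ"
proof -
  have "tile tileCPQ = triangle pQ pC pP"
    using a_pos b_pos
    by (intro tile_triangleI) (simp_all add: tileCPQ_def points_def pmap_def complex_eq_iff field_simps b_sq b_sq_left)
  then show ?thesis by (simp only: insert_commute)
qed

lemma tile_HPQ: "tile tileHPQ = triangle pH pP pQ"
proof -
  have "tile tileHPQ = triangle pP pH pQ"
    using a_pos b_pos
    by (intro tile_triangleI) (simp_all add: tileHPQ_def points_def pmap_def complex_eq_iff field_simps b_sq b_sq_left)
  then show ?thesis by (simp only: insert_commute)
qed

lemma tile_base_1: "tile (base 1) = triangle 0 pP pH"
  by (simp add: prototile_hull points_def)

lemma valid_flips [simp]: "valid tileCHP" "valid tileCHQ" "valid tileCPQ" "valid tileHPQ"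
  using j by (auto simp: valid_def tileCHP_def tileCHQ_def tileCPQ_def tileHPQ_def)

lemma of_real_mult_Complex: "of_real r * Complex x y = Complex (r * x) (r * y)"
  by (simp add: complex_eq_iff)

lemma scaled_first: "(*) (of_real (\<mu> ^ (2 * m))) ` prototile m j 1 = triangle 0 pC pB"
proof -
  have "(*) (of_real (\<mu> ^ (2 * m))) ` prototile m j 1 =
      convex hull ((*) (of_real (1 / (a * a))) ` {0, Complex (- a) 0, Complex (- a) b})"
    unfolding prototile_hull hyp_1 mult_1_right lam_2m convex_hull_dilation ..
  also have "(*) (of_real (1 / (a * a))) ` {0, Complex (- a) 0, Complex (- a) b} = {0, pC, pB}"
    using a_pos by (simp add: of_real_mult_Complex points_def del: of_real_divide of_real_mult)
  finally show ?thesis .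
qed

lemma patchHQB:
  assumes "x \<in> patchHQB"
  shows "valid x" and "tile x \<subseteq> triangle pH pQ pB"
proof -
  obtain y where y: "y \<in> pyth_iter (2 * j) 1" "x = pcomp moveHQB y"
    using assms by (auto simp: patchHQB_def)
  have "1 \<in> {1..m}" using j by simp
  then have pyth_iter: "packing (pyth_iter (2 * j) 1)"
    "\<forall>c\<in>pyth_iter (2 * j) 1. tile c \<subseteq> (*) (of_real (\<mu> ^ (2 * j))) ` prototile m j 1"
    using dissects_iter[OF dissects_pyth, of "2 * j"] unfolding dissects_def by blast+
  have "valid y" using pyth_iter(1) y(1) by (simp add: packing_def)
  then show "valid x"
    unfolding y(2) by (intro valid_pcomp) (auto simp: moveHQB_def)
  have "tile x \<subseteq> pmap moveHQB ` ((*) (of_real (\<mu> ^ (2 * j))) ` prototile m j 1)"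
    unfolding y(2) tile_pcomp using pyth_iter(2) y(1) by (intro image_mono) blast
  also have "(*) (of_real (\<mu> ^ (2 * j))) ` prototile m j 1 =
      convex hull ((*) (of_real (b * b / (a * a))) ` {0, Complex (- a) 0, Complex (- a) b})"
    unfolding prototile_hull hyp_1 mult_1_right lam_2j convex_hull_dilation ..
  also have "pmap moveHQB ` \<dots> =
     convex hull (pmap moveHQB ` ((*) (of_real (b * b / (a * a))) ` {0, Complex (- a) 0, Complex (- a) b}))"
    by (rule convex_hull_pmap)
  also have "pmap moveHQB ` ((*) (of_real (b * b / (a * a))) ` {0, Complex (- a) 0, Complex (- a) b}) = {pH, pQ, pB}"
  proof -
    have "pmap moveHQB 0 = pH"
      "pmap moveHQB (of_real (b * b / (a * a)) * Complex (- a) 0) = pQ"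
      "pmap moveHQB (of_real (b * b / (a * a)) * Complex (- a) b) = pB"
      unfolding of_real_mult_Complex using a_pos
      by (simp_all add: pmap_def moveHQB_def points_def complex_eq_iff field_simps b_sq b_sq_left)
    then show ?thesis by simp
  qed
  finally show "tile x \<subseteq> triangle pH pQ pB" .
qed

lemma finite_patchHQB: "finite patchHQB" and packing_patchHQB: "packing patchHQB"
proof -
  have "1 \<in> {1..m}" using j by simp
  then have "finite (pyth_iter (2 * j) 1)" "packing (pyth_iter (2 * j) 1)"
    using dissects_iter[OF dissects_pyth, of "2 * j"] unfolding dissects_def by blast+
  then show "finite patchHQB" "packing patchHQB"
    unfolding patchHQB_def by (auto intro!: packing_pcomp simp: moveHQB_def)
qed

lemma patchHQB_above:
  assumes "x \<in> patchHQB"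
  shows "tile x \<subseteq> {w. \<i> \<bullet> w \<ge> b}"
proof -
  have "b \<le> b / (a * a)"
    using ab_le_1(2) a_pos b_pos by (simp add: le_divide_eq)
  then have "triangle pH pQ pB \<subseteq> {w. \<i> \<bullet> w \<ge> b}"
    by (intro hull3_subset_ge) (simp_all add: points_def inner_complex_def)
  then show ?thesis using patchHQB(2)[OF assms] by blast
qed

lemma a_le_inv: "a \<le> 1 / a"
  using ab_le_1(2) a_pos by (simp add: le_divide_eq)

lemma patchHQB_left:
  assumes "x \<in> patchHQB"
  shows "tile x \<subseteq> {w. 1 \<bullet> w \<le> - a}"
proof -
  have "triangle pH pQ pB \<subseteq> {w. 1 \<bullet> w \<le> - a}"
    using a_le_inv by (intro hull3_subset_le) (simp_all add: points_def inner_complex_def)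
  then show ?thesis using patchHQB(2)[OF assms] by blast
qed

text \<open>\<open>HQB\<close> lies at height \<open>b\<close> or above, whereas each tile outside
  it has a vertex on the real axis.\<close>

lemma not_in_patchHQB:
  assumes "w \<in> tile p" "Im w = 0"
  shows "p \<notin> patchHQB"
proof
  assume "p \<in> patchHQB"
  then have "\<i> \<bullet> w \<ge> b"
    using patchHQB_above assms(1) by blast
  then show False
    using assms(2) b_pos by (simp add: inner_complex_def)
qed

lemma notin_patch [simp]: "base 1 \<notin> patchHQB" "tileCHP \<notin> patchHQB" "tileCHQ \<notin> patchHQB"
  "tileCPQ \<notin> patchHQB" "tileHPQ \<notin> patchHQB"
proof -
  show "base 1 \<notin> patchHQB"
    by (rule not_in_patchHQB[of 0]) (auto simp only: tile_base_1 intro: hull_inc, simp)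
  show "tileCHP \<notin> patchHQB" "tileCHQ \<notin> patchHQB" "tileCPQ \<notin> patchHQB"
    by (rule not_in_patchHQB[of pC]; auto simp: tile_CHP tile_CHQ tile_CPQ pC_def intro: hull_inc)+
  show "tileHPQ \<notin> patchHQB"
    by (rule not_in_patchHQB[of pP]) (auto simp: tile_HPQ pP_def intro: hull_inc)
qed

lemma flips_distinct: "base 1 \<noteq> tileCHP" "base 1 \<noteq> tileCHQ" "base 1 \<noteq> tileCPQ" "base 1 \<noteq> tileHPQ"
  "tileCPQ \<noteq> tileHPQ" "tileCHP \<noteq> tileCHQ"
  using j by (auto simp: base_def tileCHP_def tileCHQ_def tileCPQ_def tileHPQ_def complex_eq_iff)

text \<open>Three lines separate the tiles: the vertical through \<open>H\<close> and
  \<open>P\<close>, the horizontal through \<open>H\<close> and \<open>Q\<close>, and the diagonal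
  \<open>PQ\<close>, which has normal \<open>Complex a b\<close> and value
  \<open>- (a * a)\<close>.\<close>

lemma packing_pythia_poses_1: "packing pythia_poses_1"
proof -
  have T: "tile (base 1) \<subseteq> {w. 1 \<bullet> w \<ge> - a}"
    unfolding tile_base_1 using a_pos
    by (intro hull3_subset_ge) (simp_all add: points_def inner_complex_def)
  have left: "tile tileCPQ \<subseteq> {w. 1 \<bullet> w \<le> - a}" "tile tileHPQ \<subseteq> {w. 1 \<bullet> w \<le> - a}"
    unfolding tile_CPQ tile_HPQ using a_le_inv
    by (intro hull3_subset_le; simp add: points_def inner_complex_def)+
  have below: "tile tileCPQ \<subseteq> {w. \<i> \<bullet> w \<le> b}" "tile tileHPQ \<subseteq> {w. \<i> \<bullet> w \<le> b}"
    unfolding tile_CPQ tile_HPQ using b_pos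
    by (intro hull3_subset_le; simp add: points_def inner_complex_def)+
  have CPQ: "tile tileCPQ \<subseteq> {w. Complex a b \<bullet> w \<le> - (a * a)}"
    unfolding tile_CPQ using a_pos b_pos ab_le_1
    by (intro hull3_subset_le) (simp_all add: points_def inner_complex_def b_sq)
  have HPQ: "tile tileHPQ \<subseteq> {w. Complex a b \<bullet> w \<ge> - (a * a)}"
    unfolding tile_HPQ using a_pos b_pos ab_le_1
    by (intro hull3_subset_ge) (simp_all add: points_def inner_complex_def b_sq)
  have ne: "(1::complex) \<noteq> 0" "\<i> \<noteq> 0" "Complex a b \<noteq> 0"
    using a_pos by (auto simp: complex_eq_iff)
  have three: "packing {base 1, tileCPQ, tileHPQ}"
    using separated_interiors[OF left(1) T ne(1)] separated_interiors[OF left(2) T ne(1)]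
      separated_interiors[OF CPQ HPQ ne(3)] j
    by (auto simp add: packing_def valid_base Int_commute simp del: tile_base)
  show ?thesis
    unfolding pythia_poses_1_def
  proof (rule packing_Un[OF three packing_patchHQB])
    fix p q assume p: "p \<in> {base 1, tileCPQ, tileHPQ}" and q: "q \<in> patchHQB"
    then consider "p = base 1" | "p = tileCPQ \<or> p = tileHPQ" by blast
    then show "interior (tile p) \<inter> interior (tile q) = {}"
    proof cases
      case 1
      then show ?thesis
        using separated_interiors[OF patchHQB_left[OF q] T ne(1)] by (simp add: Int_commute)
    next
      case 2
      then have "tile p \<subseteq> {w. \<i> \<bullet> w \<le> b}" using below by blast
      then show ?thesis
        using separated_interiors[OF _ patchHQB_above[OF q] ne(2)] by blast
    qed
  qed
qed

lemma pythia_poses_1_subset: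
  assumes "p \<in> pythia_poses_1"
  shows "tile p \<subseteq> (*) (of_real (\<mu> ^ (2 * m))) ` prototile m j 1"
proof -
  let ?R = "triangle 0 pC pB"
  have v: "0 \<in> ?R" "pC \<in> ?R" "pB \<in> ?R"
    by (auto intro: hull_inc)
  \<comment> \<open>\<open>a * a\<close> is the ratio in which \<open>H\<close> divides the
    hypotenuse from \<open>A\<close>; by parallels, \<open>P\<close> and \<open>Q\<close> divide the
    legs in the same ratio.\<close>
  have P: "pP \<in> ?R"
    by (rule in_segment_hull[of _ 0 "a * a" pC, OF _ _ _ v(1,2)])
       (use a_pos ab_le_1 in \<open>auto simp: points_def complex_eq_iff\<close>)
  have H: "pH \<in> ?R"
    by (rule in_segment_hull[of _ 0 "a * a" pB, OF _ _ _ v(1,3)])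
       (use a_pos ab_le_1 in \<open>auto simp: points_def complex_eq_iff\<close>)
  have Q: "pQ \<in> ?R"
    by (rule in_segment_hull[of _ pC "a * a" pB, OF _ _ _ v(2,3)])
       (use a_pos ab_le_1 in \<open>auto simp: points_def complex_eq_iff\<close>)
  have "triangle pH pQ pB \<subseteq> ?R"
    by (intro hull3_subset_hull H Q v)
  then have "tile x \<subseteq> ?R" if "x \<in> patchHQB" for x
    using patchHQB(2)[OF that] by (rule order_trans[rotated])
  moreover have "tile (base 1) \<subseteq> ?R"
    unfolding tile_base_1 by (intro hull3_subset_hull H P v)
  moreover have "tile tileCPQ \<subseteq> ?R"
    unfolding tile_CPQ by (intro hull3_subset_hull Q P v)
  moreover have "tile tileHPQ \<subseteq> ?R"
    unfolding tile_HPQ by (intro hull3_subset_hull Q P H v)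
  ultimately show ?thesis
    using assms unfolding pythia_poses_1_def scaled_first by blast
qed

lemma pythia_first_eq_tile: "pythia_first m j = tile ` pythia_poses_1"
proof -
  have "1 \<in> {1..m}" using j by simp
  have "(pythagoras_ext m j ^^ (2 * m)) {prototile m j 1} = tile ` pyth_iter (2 * m) 1"
    using dissects_pyth \<open>1 \<in> {1..m}\<close> pythagoras_eq_tile by (rule funpow_subst_ext_tile)
  \<comment> \<open>Removing tiles as sets agrees with removing poses because \<open>tile\<close> is
    injective on a packing.\<close>
  also have "\<dots> - {tile tileCHP, tile tileCHQ} = tile ` (pyth_iter (2 * m) 1 - {tileCHP, tileCHQ})"
  proof -
    have "inj_on tile (pyth_iter (2 * m) 1)"
      using dissects_iter[OF dissects_pyth, of "2 * m"] \<open>1 \<in> {1..m}\<close>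
      by (intro inj_onI tile_inj) (auto simp: dissects_def packing_def)
    moreover have "{tileCHP, tileCHQ} \<subseteq> pyth_iter (2 * m) 1"
      unfolding pyth_iter_2m by blast
    ultimately show ?thesis
      using inj_on_image_set_diff[of tile "pyth_iter (2 * m) 1" "pyth_iter (2 * m) 1" "{tileCHP, tileCHQ}"] by simp
  qed
  also have "pyth_iter (2 * m) 1 - {tileCHP, tileCHQ} = {base 1} \<union> patchHQB"
    using flips_distinct notin_patch unfolding pyth_iter_2m by auto
  finally have diff: "(pythagoras_ext m j ^^ (2 * m)) {prototile m j 1} - {tile tileCHP, tile tileCHQ}
      = tile ` ({base 1} \<union> patchHQB)" .
  let ?c = "of_real (\<mu> ^ (2 * m)) :: complex"
  have A: "?c * vA = 0" and B: "?c * vB m j = pB" and C: "?c * vC m j = pC"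
    using a_pos unfolding lam_2m vertices of_real_mult_Complex by (simp_all add: points_def)
  have "foot pC 0 pB = (a * a) *\<^sub>R pB"
  proof -
    have "(cmod pB)\<^sup>2 = 1 / (a * a * (a * a))"
      using a_pos by (simp add: pB_def cmod_power2, simp add: power2_eq_square field_simps b_sq b_sq_left)
    then show ?thesis
      using a_pos by (simp add: foot_def inner_complex_def, simp add: pC_def pB_def)
  qed
  then have H: "foot pC 0 pB = pH"
    using a_pos by (simp add: points_def complex_eq_iff)
  have P: "foot pH pC 0 = pP"
    using a_pos
    by (simp add: foot_def inner_complex_def cmod_power2, simp add: points_def complex_eq_iff power2_eq_square field_simps)
  have Q: "foot pH pC pB = pQ"
    using a_pos b_pos
    by (simp add: foot_def inner_complex_def cmod_power2, simp add: points_def complex_eq_iff power2_eq_square field_simps)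
  have "pythia_first m j = tile ` ({base 1} \<union> patchHQB) \<union> {tile tileCPQ, tile tileHPQ}"
    unfolding pythia_first_def Let_def A B C H P Q
    unfolding tile_CHP[symmetric] tile_CHQ[symmetric] tile_CPQ[symmetric] tile_HPQ[symmetric] diff ..
  then show ?thesis
    unfolding pythia_poses_1_def by blast
qed

lemma funpow_pythagoras_ext:
  assumes "packing P"
  shows "(pythagoras_ext m j ^^ n) (tile ` P) = tile ` (pyth_ext ^^ n) P \<and> packing ((pyth_ext ^^ n) P)"
proof (induction n)
  case (Suc n)
  then have "pythagoras_ext m j (tile ` (pyth_ext ^^ n) P) = tile ` pyth_ext ((pyth_ext ^^ n) P)"
    using pythagoras_eq_tile by (intro subst_ext_tile) (auto simp: packing_def)
  then show ?case
    using Suc packing_sub[OF dissects_pyth] by simp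
qed (use assms in simp)

lemma pythia_eq_tile: "pythia m j i = tile ` pythia_poses i"
  unfolding pythia_def pythia_first_eq_tile pythia_poses_def
  using funpow_pythagoras_ext[OF packing_pythia_poses_1] by blast

lemma finite_pythia_poses_1: "finite pythia_poses_1"
  using finite_patchHQB by (simp add: pythia_poses_1_def)

lemma pythia_poses_eq_sub: "pythia_poses i = sub (\<mu> ^ (i - 1)) (pyth_iter (i - 1)) pythia_poses_1"
  by (simp add: pythia_poses_def funpow_sub)

lemma dissects_pythia: "dissects (\<mu> ^ (2 * m)) pythia_poses"
  unfolding dissects_def
proof (intro conjI ballI)
  show "\<mu> ^ (2 * m) > 0" using lam_gt_1 by simp
  fix i assume i: "i \<in> {1..m}"
  note dis = dissects_iter[OF dissects_pyth, of "i - 1"]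
  show "finite (pythia_poses i)"
    unfolding pythia_poses_eq_sub by (rule finite_sub[OF dis finite_pythia_poses_1 packing_pythia_poses_1])
  show "packing (pythia_poses i)"
    unfolding pythia_poses_eq_sub by (rule packing_sub[OF dis packing_pythia_poses_1])
  fix c assume "c \<in> pythia_poses i"
  then have "tile c \<subseteq> (*) (of_real (\<mu> ^ (i - 1))) ` (*) (of_real (\<mu> ^ (2 * m))) ` prototile m j 1"
    unfolding pythia_poses_eq_sub using packing_pythia_poses_1 pythia_poses_1_subset
    by (intro sub_subset[OF dis]) (auto simp: packing_def)
  also have "\<dots> = (*) (of_real (\<mu> ^ (2 * m))) ` (*) (of_real (\<mu> ^ (i - 1))) ` prototile m j 1"
    unfolding image_image by (simp only: mult.left_commute)
  also have "(*) (of_real (\<mu> ^ (i - 1))) ` prototile m j 1 = prototile m j i"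
    using scaled_prototile[of "i - 1"] i by simp
  finally show "tile c \<subseteq> (*) (of_real (\<mu> ^ (2 * m))) ` prototile m j i" .
qed

text \<open>The area of prototile \<open>i\<close> relative to the first one: squared hypotenuses
  are powers of \<eta>.\<close>

definition weight :: "nat \<Rightarrow> real" where "weight i = \<eta> ^ (i - 1)"

lemma weight_pos: "weight i > 0"
  using eta_root(1) by (simp add: weight_def)

lemma weight_pyth:
  assumes "i \<in> {1..m}"
  shows "(\<Sum>c\<in>pyth_poses i. weight (ptype c)) = \<eta> * weight i"
proof (cases "i < m")
  case True
  then show ?thesis
    using assms by (cases i) (simp_all add: pyth_poses_def weight_def)
next
  case False
  then have "i = m" using assms by simp
  have "childA \<noteq> childB" using j by (simp add: childA_def childB_def)
  have "\<eta> * weight i = \<eta> ^ m"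
    using j power_minus_mult[of m \<eta>] by (simp add: weight_def \<open>i = m\<close> mult.commute)
  then show ?thesis
    using \<open>childA \<noteq> childB\<close> False by (simp add: pyth_poses_def weight_def childA_def childB_def eta_root(2))
qed

lemma weight_pyth_iter: "i \<in> {1..m} \<Longrightarrow> (\<Sum>c\<in>pyth_iter n i. weight (ptype c)) = \<eta> ^ n * weight i"
  by (rule weight_iter[OF dissects_pyth weight_pos weight_pyth])

lemma weight_pythia:
  assumes "i \<in> {1..m}"
  shows "(\<Sum>c\<in>pythia_poses i. weight (ptype c)) = \<eta> ^ (2 * m) * weight i"
proof -
  have "1 \<in> {1..m}" using j by simp
  have inj: "inj_on (pcomp moveHQB) (pyth_iter (2 * j) 1)"
    by (rule inj_on_subset[OF pcomp_inj]) (simp_all add: moveHQB_def)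
  have "(\<Sum>c\<in>patchHQB. weight (ptype c)) = (\<Sum>c\<in>pyth_iter (2 * j) 1. weight (ptype c))"
    unfolding patchHQB_def by (subst sum.reindex[OF inj]) simp
  also have "\<dots> = \<eta> ^ (2 * j)"
    using weight_pyth_iter[OF \<open>1 \<in> {1..m}\<close>, of "2 * j"] by (simp add: weight_def)
  finally have patch: "(\<Sum>c\<in>patchHQB. weight (ptype c)) = \<eta> ^ (2 * j)" .
  have "(\<Sum>c\<in>pythia_poses_1. weight (ptype c)) =
      (\<Sum>c\<in>{base 1, tileCPQ, tileHPQ}. weight (ptype c)) + \<eta> ^ (2 * j)"
    unfolding pythia_poses_1_def patch[symmetric] using finite_patchHQB notin_patch
    by (intro sum.union_disjoint) auto
  \<comment> \<open>Corner tile, both halves of the rectangle and \<open>HQB\<close>: the total is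
    the square of \<open>1 + \<eta> ^ j = \<eta> ^ m\<close>.\<close>
  also have "\<dots> = 1 + 2 * \<eta> ^ j + \<eta> ^ (2 * j)"
  proof -
    have "ptype tileCPQ = Suc j" "ptype tileHPQ = Suc j"
      by (simp_all add: tileCPQ_def tileHPQ_def)
    then show ?thesis
      using flips_distinct by (simp add: weight_def)
  qed
  also have "\<dots> = (\<eta> ^ m)\<^sup>2"
    unfolding eta_root(2) mult.commute[of 2] power_mult by (simp add: power2_eq_square algebra_simps)
  finally have first: "(\<Sum>c\<in>pythia_poses_1. weight (ptype c)) = \<eta> ^ (2 * m)"
    by (simp add: mult.commute[of 2] power_mult)
  have valid: "ptype p \<in> {1..m}" if "p \<in> pythia_poses_1" for p
    using packing_pythia_poses_1 that by (auto simp: packing_def valid_def)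
  have "(\<Sum>c\<in>pythia_poses i. weight (ptype c)) =
      (\<Sum>p\<in>pythia_poses_1. \<Sum>c\<in>pyth_iter (i - 1) (ptype p). weight (ptype c))"
    unfolding pythia_poses_eq_sub
    by (simp add: sum_sub[OF dissects_iter[OF dissects_pyth] finite_pythia_poses_1 packing_pythia_poses_1])
  also have "\<dots> = (\<Sum>p\<in>pythia_poses_1. \<eta> ^ (i - 1) * weight (ptype p))"
    using valid by (intro sum.cong refl weight_pyth_iter) auto
  also have "\<dots> = \<eta> ^ (2 * m) * weight i"
    by (simp only: sum_distrib_left[symmetric] first) (simp add: weight_def)
  finally show ?thesis .
qed

end

section \<open>Angles in the Pythia substitution\<close>

context pythagoras_parameters
begin

lemma ex_pyth_iter_unflipped: "n < m \<Longrightarrow> \<exists>p\<in>pyth_iter n 1. ptype p = Suc n \<and> \<not> pflip p \<and> prot p = 1"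
  by (simp only: pyth_iter_small) simp

text \<open>From level \<open>m\<close> to below \<open>2 * m\<close> one dissection has taken place
  and its part at \<open>A\<close> has only grown since. One level range lower there is no
  dissection, one higher there are two, whose turns cancel.\<close>

lemma ex_pyth_iter_flipped:
  assumes "m \<le> n" "n < 2 * m"
  shows "\<exists>p\<in>pyth_iter n 1. ptype p = Suc (n - m) \<and> pflip p \<and> prot p = cnj \<omega>"
proof -
  have "pyth_iter (n - m) 1 = {base (Suc (n - m))}"
    using assms by (intro pyth_iter_small) auto
  moreover have "pyth_iter n 1 = pyth_iter ((n - m) + m) 1"
    using assms by simp
  ultimately have "pcomp (pscale (\<mu> ^ (n - m)) childA) (base (Suc (n - m))) \<in> pyth_iter n 1"
    by (simp only: pyth_iter_split) simp
  then show ?thesis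
    by (rule bexI[rotated]) (simp add: childA_def)
qed

lemma ex_pyth_iter_deep:
  assumes "2 * m \<le> n" "n < 3 * m"
  shows "\<exists>p\<in>pyth_iter n 1. ptype p = Suc (n - 2 * m) \<and> \<not> pflip p \<and> prot p = 1"
proof -
  have small: "pyth_iter (n - 2 * m) 1 = {base (Suc (n - 2 * m))}"
    using assms by (intro pyth_iter_small) auto
  have mono: "P \<subseteq> Q \<Longrightarrow> (pyth_ext ^^ k) P \<subseteq> (pyth_ext ^^ k) Q" for k P Q
    by (induction k) (simp_all add: sub_mono)
  have "{base 1} \<subseteq> pyth_iter (2 * m) 1"
    unfolding pyth_iter_2m by blast
  then have "pyth_iter (n - 2 * m) 1 \<subseteq> (pyth_ext ^^ (n - 2 * m)) (pyth_iter (2 * m) 1)"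
    unfolding iter_def[of _ _ "n - 2 * m"] by (rule mono)
  also have "\<dots> = pyth_iter ((n - 2 * m) + 2 * m) 1"
    by (rule pyth_iter_add[symmetric])
  also have "(n - 2 * m) + 2 * m = n"
    using assms by simp
  finally have "base (Suc (n - 2 * m)) \<in> pyth_iter n 1"
    unfolding small by blast
  then show ?thesis
    by (rule bexI[rotated]) simp
qed

lemma pythia_poses_base:
  assumes "e < m"
  shows "\<exists>p\<in>pythia_poses (Suc e). ptype p = Suc e \<and> \<not> pflip p \<and> prot p = 1"
proof -
  have "pcomp (pscale (\<mu> ^ e) (base 1)) (base (Suc e)) \<in> pythia_poses (Suc e)"
    unfolding pythia_poses_eq_sub sub_def pythia_poses_1_def using pyth_iter_small[OF assms] by force
  then show ?thesis by (rule bexI[rotated]) simp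
qed

text \<open>The flipped diagonal in use: \<open>CPQ\<close> is reflected but turned only by a right
  angle, so it conjugates what lies inside.\<close>

lemma pythia_poses_CPQ:
  assumes "q \<in> pyth_iter (e + j) 1"
  shows "\<exists>p\<in>pythia_poses (Suc e). ptype p = ptype q \<and> (pflip p \<longleftrightarrow> \<not> pflip q) \<and> prot p = \<i> * cnj (prot q)"
proof -
  have "q \<in> pyth_iter e (ptype tileCPQ)"
    using assms pyth_iter_shift[OF j(2), of e] by (simp add: tileCPQ_def)
  then have "pcomp (pscale (\<mu> ^ e) tileCPQ) q \<in> pythia_poses (Suc e)"
    unfolding pythia_poses_eq_sub sub_def pythia_poses_1_def by auto
  then show ?thesis by (rule bexI[rotated]) (simp add: tileCPQ_def)
qed

lemma pythia_poses_HQB: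
  assumes "q \<in> pyth_iter (e + 2 * j) 1"
  shows "\<exists>p\<in>pythia_poses (Suc e). ptype p = ptype q \<and> pflip p = pflip q \<and> prot p = prot q"
proof -
  have "(pyth_ext ^^ e) patchHQB = pcomp (pscale (\<mu> ^ e) moveHQB) ` pyth_iter (e + 2 * j) 1"
    unfolding patchHQB_def funpow_pyth_ext_pcomp pyth_iter_add ..
  moreover have "(pyth_ext ^^ e) patchHQB \<subseteq> pythia_poses (Suc e)"
    unfolding pythia_poses_eq_sub funpow_sub sub_def pythia_poses_1_def by auto
  ultimately have "pcomp (pscale (\<mu> ^ e) moveHQB) q \<in> pythia_poses (Suc e)"
    using assms by blast
  then show ?thesis by (rule bexI[rotated]) (simp add: moveHQB_def)
qed

text \<open>
  Fourth powers of rotations ignore right angles. In the Pythagoras substitution they are \<open>1\<close> for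
  unflipped and \<open>cnj \<omega> ^ 4\<close> for flipped tiles; each unflipped tile followed by a flipped diagonal
  and then by an odd number of dissections contributes a factor \<open>\<omega> ^ 4\<close>.
\<close>

definition reach :: "nat \<Rightarrow> nat \<Rightarrow> nat \<Rightarrow> bool \<Rightarrow> complex \<Rightarrow> bool" where
  "reach n i i' f z \<longleftrightarrow>
     (\<exists>p\<in>iter (\<mu> ^ (2 * m)) pythia_poses n i. ptype p = i' \<and> pflip p = f \<and> prot p ^ 4 = z)"

lemma reach_trans:
  assumes "reach n i i1 f z" "reach n' i1 i2 f' z'"
  shows "reach (n' + n) i i2 (f \<noteq> f') (z * (if f then cnj z' else z'))"
proof -
  obtain p where p: "p \<in> iter (\<mu> ^ (2 * m)) pythia_poses n i" "ptype p = i1" "pflip p = f" "prot p ^ 4 = z"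
    using assms(1) unfolding reach_def by blast
  obtain q where q: "q \<in> iter (\<mu> ^ (2 * m)) pythia_poses n' i1" "ptype q = i2" "pflip q = f'" "prot q ^ 4 = z'"
    using assms(2) unfolding reach_def by blast
  have "pcomp (pscale ((\<mu> ^ (2 * m)) ^ n') p) q \<in> iter (\<mu> ^ (2 * m)) pythia_poses (n' + n) i"
    unfolding iter_add sub_def using p q by blast
  then show ?thesis
    unfolding reach_def using p q by (intro bexI) (auto simp: power_mult_distrib)
qed

lemma reach_1:
  assumes "p \<in> pythia_poses i" "ptype p = i'" "pflip p = f" "prot p ^ 4 = z"
  shows "reach 1 i i' f z"
  using assms by (auto simp: reach_def)

lemma reach_self: "e < m \<Longrightarrow> reach 1 (Suc e) (Suc e) False 1"
  using pythia_poses_base by (metis reach_1 power_one)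

text \<open>The corner tile of a supertile repeats its type, chirality and rotation one level down,
  so paths can be padded to a common length.\<close>

lemma reach_shift:
  assumes "reach n i i' f z" "e' < m" "i' = Suc e'"
  shows "reach (Suc n) i i' f z"
  using reach_trans[OF assms(1), of 1 i' False 1] reach_self[OF assms(2)] assms(3) by (cases f) simp_all

text \<open>\<open>HQB\<close> counts as level \<open>e + 2 * j\<close>; in this range it has been
  dissected exactly once.\<close>

lemma reach_flipped_step:
  assumes "e < m" "m \<le> e + 2 * j" "e + 2 * j < 2 * m"
  shows "\<exists>n e'. e' < m \<and> reach n (Suc e) (Suc e') True (cnj \<omega> ^ 4)"
proof -
  obtain q where q: "q \<in> pyth_iter (e + 2 * j) 1" "ptype q = Suc (e + 2 * j - m)" "pflip q" "prot q = cnj \<omega>"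
    using ex_pyth_iter_flipped assms by blast
  then obtain p where "p \<in> pythia_poses (Suc e)" "ptype p = Suc (e + 2 * j - m)" "pflip p" "prot p = cnj \<omega>"
    using pythia_poses_HQB by metis
  then have "reach 1 (Suc e) (Suc (e + 2 * j - m)) True (cnj \<omega> ^ 4)"
    by (intro reach_1) auto
  moreover have "e + 2 * j - m < m" using assms by simp
  ultimately show ?thesis by blast
qed

lemma reach_via:
  assumes "e' < m" "reach 1 (Suc e) (Suc e') False 1"
    and "\<exists>n e''. e'' < m \<and> reach n (Suc e') (Suc e'') True z"
  shows "\<exists>n e''. e'' < m \<and> reach n (Suc e) (Suc e'') True z"
proof -
  obtain n e'' where n: "e'' < m" "reach n (Suc e') (Suc e'') True z"
    using assms(3) by blast
  have "reach (n + 1) (Suc e) (Suc e'') True z"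
    using reach_trans[OF assms(2) n(2)] by simp
  then show ?thesis using n(1) by blast
qed

text \<open>As long as \<open>HQB\<close> is undissected it is a single larger tile of index raised
  by \<open>2 * j\<close>. Since \<open>2 * j < m\<close>, the index cannot jump over the range with
  one dissection.\<close>

lemma reach_flipped_small:
  assumes "2 * j < m" "e < m"
  shows "\<exists>n e'. e' < m \<and> reach n (Suc e) (Suc e') True (cnj \<omega> ^ 4)"
  using assms(2)
proof (induction "m - e" arbitrary: e rule: less_induct)
  case less
  show ?case
  proof (cases "e + 2 * j < m")
    case False
    then show ?thesis
      using less.prems assms(1) by (intro reach_flipped_step) auto
  next
    case True
    obtain q where "q \<in> pyth_iter (e + 2 * j) 1" "ptype q = Suc (e + 2 * j)" "\<not> pflip q" "prot q = 1"
      using ex_pyth_iter_unflipped[OF True] by blast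
    then obtain p where "p \<in> pythia_poses (Suc e)" "ptype p = Suc (e + 2 * j)" "\<not> pflip p" "prot p = 1"
      using pythia_poses_HQB by metis
    then have "reach 1 (Suc e) (Suc (e + 2 * j)) False 1"
      by (intro reach_1) auto
    moreover have "\<exists>n e'. e' < m \<and> reach n (Suc (e + 2 * j)) (Suc e') True (cnj \<omega> ^ 4)"
      using True j by (intro less.hyps) auto
    ultimately show ?thesis
      by (rule reach_via[OF True])
  qed
qed

text \<open>If \<open>HQB\<close> has been dissected twice, it contains an unflipped tile of index
  lowered by \<open>2 * m - 2 * j\<close>, and the descent ends in the range with one
  dissection.\<close>

lemma reach_flipped_large:
  assumes "m \<le> 2 * j" "e < m"
  shows "\<exists>n e'. e' < m \<and> reach n (Suc e) (Suc e') True (cnj \<omega> ^ 4)"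
  using assms(2)
proof (induction e rule: less_induct)
  case (less e)
  show ?case
  proof (cases "e + 2 * j < 2 * m")
    case True
    then show ?thesis
      using less.prems assms(1) by (intro reach_flipped_step) auto
  next
    case False
    define e' where "e' = e + 2 * j - 2 * m"
    have e': "e' < e" "e' < m" using False j less.prems by (auto simp: e'_def)
    obtain q where "q \<in> pyth_iter (e + 2 * j) 1" "ptype q = Suc e'" "\<not> pflip q" "prot q = 1"
      using ex_pyth_iter_deep[of "e + 2 * j"] False j less.prems unfolding e'_def by auto
    then obtain p where "p \<in> pythia_poses (Suc e)" "ptype p = Suc e'" "\<not> pflip p" "prot p = 1"
      using pythia_poses_HQB by metis
    then have "reach 1 (Suc e) (Suc e') False 1"
      by (intro reach_1) auto
    then show ?thesis
      using less.IH[OF e'] by (rule reach_via[OF e'(2)])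
  qed
qed

lemma reach_flipped: "e < m \<Longrightarrow> \<exists>n e'. e' < m \<and> reach n (Suc e) (Suc e') True (cnj \<omega> ^ 4)"
  using reach_flipped_small reach_flipped_large by (cases "2 * j < m") auto

text \<open>If \<open>CPQ\<close> is still undissected, it is a reflected tile below which a
  dissection is reached, with its turn conjugated. Otherwise the dissection has already happened
  inside \<open>CPQ\<close>.\<close>

lemma reach_turn:
  assumes "e < m"
  shows "\<exists>n e'. e' < m \<and> reach n (Suc e) (Suc e') False (\<omega> ^ 4)"
proof (cases "e + j < m")
  case True
  obtain q where "q \<in> pyth_iter (e + j) 1" "ptype q = Suc (e + j)" "\<not> pflip q" "prot q = 1"
    using ex_pyth_iter_unflipped[OF True] by blast
  then obtain p where p: "p \<in> pythia_poses (Suc e)" "ptype p = Suc (e + j)" "pflip p" "prot p = \<i> * cnj 1"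
    using pythia_poses_CPQ by metis
  have "reach 1 (Suc e) (Suc (e + j)) True 1"
    by (rule reach_1[OF p(1,2)]) (use p in \<open>simp_all add: power4_eq_xxxx\<close>)
  moreover obtain n e' where "e' < m" "reach n (Suc (e + j)) (Suc e') True (cnj \<omega> ^ 4)"
    using reach_flipped[OF True] by blast
  ultimately have "reach (n + 1) (Suc e) (Suc e') False (\<omega> ^ 4)"
    using reach_trans by fastforce
  then show ?thesis using \<open>e' < m\<close> by blast
next
  case False
  obtain q where "q \<in> pyth_iter (e + j) 1" "ptype q = Suc (e + j - m)" "pflip q" "prot q = cnj \<omega>"
    using ex_pyth_iter_flipped[of "e + j"] False assms j by auto
  then obtain p where p: "p \<in> pythia_poses (Suc e)" "ptype p = Suc (e + j - m)" "\<not> pflip p" "prot p = \<i> * cnj (cnj \<omega>)"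
    using pythia_poses_CPQ by metis
  have "reach 1 (Suc e) (Suc (e + j - m)) False (\<omega> ^ 4)"
  proof (rule reach_1[OF p(1,2)])
    show "prot p ^ 4 = \<omega> ^ 4"
      by (simp add: p(4) power_mult_distrib)
  qed (use p(3) in simp)
  moreover have "e + j - m < m" using assms j by simp
  ultimately show ?thesis by blast
qed

lemma reach_turns:
  assumes "e < m"
  shows "\<exists>n e'. e' < m \<and> reach n (Suc e) (Suc e') False (\<omega> ^ (4 * r))"
proof (induction r)
  case 0
  then show ?case using reach_self[OF assms] assms by auto
next
  case (Suc r)
  then obtain n e' where 1: "e' < m" "reach n (Suc e) (Suc e') False (\<omega> ^ (4 * r))" by blast
  obtain n' e'' where 2: "e'' < m" "reach n' (Suc e') (Suc e'') False (\<omega> ^ 4)"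
    using reach_turn[OF 1(1)] by blast
  have "reach (n' + n) (Suc e) (Suc e'') False (\<omega> ^ (4 * Suc r))"
    using reach_trans[OF 1(2) 2(2)] by (simp add: power_add mult.commute)
  then show ?case using 2(1) by blast
qed

lemma omega_not_root_of_unity:
  assumes "n \<ge> 1"
  shows "\<omega> ^ n \<noteq> 1"
proof -
  define y where "y = 1 / \<eta>"
  have y: "0 < y" "y < 1" using eta_gt_1 by (auto simp: y_def)
  \<comment> \<open>\<open>p\<close> is, up to sign, the reciprocal polynomial of
    \<open>x ^ m - x ^ j - 1\<close>, hence vanishes at the inverse of \<eta>.\<close>
  define q :: "int poly" where "q = monom 1 (m - j) - 1"
  define p where "p = monom 1 m + q"
  have "degree q \<le> m - j"
    unfolding q_def by (intro degree_diff_le degree_monom_le) simp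
  then have "degree q < degree (monom (1::int) m)"
    using j by (simp add: degree_monom_eq)
  then have "lead_coeff p = 1"
    unfolding p_def by (simp add: degree_add_eq_left lead_coeff_add_le coeff_eq_0 degree_monom_eq)
  moreover have "coeff p 0 = - 1"
    using j by (simp add: p_def q_def)
  moreover have "ipoly p y = 0"
  proof -
    have "ipoly p y = y ^ m + y ^ (m - j) - 1"
      by (simp add: p_def q_def)
    also have "y ^ (m - j) = \<eta> ^ j * y ^ m"
      using j eta_root(1) by (simp add: y_def power_divide power_diff)
    also have "y ^ m + \<eta> ^ j * y ^ m - 1 = \<eta> ^ m * y ^ m - 1"
      by (simp add: eta_root(2) algebra_simps)
    also have "\<dots> = 0"
      using eta_root(1) by (simp add: y_def power_divide)
    finally show ?thesis .
  qed
  moreover have "(Re \<omega>)\<^sup>2 = y ^ m"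
    by (simp add: a_def y_def power_divide lam_even_power flip: power_mult)
       (simp add: mult.commute[of m] lam_even_power)
  ultimately show ?thesis
    using y norm_omega j assms by (intro not_root_of_unity[of y p \<omega> m n]) auto
qed

definition separated :: "nat \<Rightarrow> nat \<Rightarrow> nat \<Rightarrow> bool" where
  "separated e n i \<longleftrightarrow> (\<exists>p\<in>iter (\<mu> ^ (2 * m)) pythia_poses n i. \<exists>q\<in>iter (\<mu> ^ (2 * m)) pythia_poses n i.
     ptype p = ptype q \<and> pflip p = pflip q \<and> prot p ^ e \<noteq> prot q ^ e)"

lemma reach_mono:
  assumes "reach n i (Suc e') f z" "e' < m" "n \<le> n'"
  shows "reach n' i (Suc e') f z"
  using assms(3)
proof (induction n' rule: dec_induct)
  case base
  show ?case by fact
next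
  case (step n')
  show ?case by (rule reach_shift[OF step.IH assms(2) refl])
qed

text \<open>Separation at all large levels, not just one, allows a common level to be chosen for all
  types.\<close>

lemma ex_separated:
  assumes "d < m" "e \<ge> 1"
  shows "\<exists>n0. \<forall>n\<ge>n0. separated e n (Suc d)"
proof -
  have "\<forall>r. \<exists>n e'. e' < m \<and> reach n (Suc d) (Suc e') False (\<omega> ^ (4 * r))"
    using reach_turns[OF assms(1)] by blast
  then obtain n t where nt: "\<And>r. t r < m" "\<And>r. reach (n r) (Suc d) (Suc (t r)) False (\<omega> ^ (4 * r))"
    by metis
  \<comment> \<open>\<open>m + 1\<close> numbers of turns compete for \<open>m\<close>
    types.\<close>
  have "\<not> inj_on t {..m}"
  proof
    assume "inj_on t {..m}"
    then have "card (t ` {..m}) = Suc m" by (simp add: card_image)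
    moreover have "card (t ` {..m}) \<le> card {..<m}"
      using nt(1) by (intro card_mono) auto
    ultimately show False by simp
  qed
  then obtain r r' where "r \<noteq> r'" "t r = t r'"
    by (auto simp: inj_on_def)
  then obtain r r' where r: "r < r'" "t r = t r'"
    by (metis linorder_neqE_nat)
  have "separated e k (Suc d)" if k: "k \<ge> max (n r) (n r')" for k
  proof -
    have "reach k (Suc d) (Suc (t r)) False (\<omega> ^ (4 * r))" "reach k (Suc d) (Suc (t r)) False (\<omega> ^ (4 * r'))"
      using reach_mono[OF nt(2)[of r] nt(1), of k] reach_mono[OF nt(2)[of r'] nt(1), of k] r(2) k by auto
    then obtain p q where p: "p \<in> iter (\<mu> ^ (2 * m)) pythia_poses k (Suc d)" "q \<in> iter (\<mu> ^ (2 * m)) pythia_poses k (Suc d)"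
      "ptype p = ptype q" "pflip p = pflip q" and rot: "prot p ^ 4 = \<omega> ^ (4 * r)" "prot q ^ 4 = \<omega> ^ (4 * r')"
      unfolding reach_def by auto
    have "prot p ^ e \<noteq> prot q ^ e"
    proof
      \<comment> \<open>Fourth powers remove the unknown right angles; what remains would make
        \<omega> a root of unity.\<close>
      assume "prot p ^ e = prot q ^ e"
      then have "(prot p ^ 4) ^ e = (prot q ^ 4) ^ e"
        by (metis mult.commute power_mult)
      then have "\<omega> ^ (4 * r * e) = \<omega> ^ (4 * r' * e)"
        by (simp only: rot power_mult)
      also have "4 * r' * e = 4 * r * e + 4 * (r' - r) * e"
        using r(1) by (metis add_mult_distrib le_add_diff_inverse less_imp_le_nat mult.commute)
      finally have "\<omega> ^ (4 * r * e) * \<omega> ^ (4 * (r' - r) * e) = \<omega> ^ (4 * r * e) * 1"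
        by (simp add: power_add)
      moreover have "\<omega> \<noteq> 0" using norm_omega by auto
      ultimately have "\<omega> ^ (4 * (r' - r) * e) = 1" by simp
      then show False
        using omega_not_root_of_unity[of "4 * (r' - r) * e"] r(1) assms(2) by simp
    qed
    then show ?thesis
      using p unfolding separated_def by blast
  qed
  then show ?thesis by blast
qed

lemma ex_uniformly_separated:
  assumes "e \<ge> 1"
  shows "\<exists>n. \<forall>i\<in>{1..m}. separated e n i"
proof -
  have "\<forall>d. \<exists>n0. d < m \<longrightarrow> (\<forall>n\<ge>n0. separated e n (Suc d))"
    using ex_separated[OF _ assms] by blast
  then obtain n0 where n0: "\<And>d n. d < m \<Longrightarrow> n \<ge> n0 d \<Longrightarrow> separated e n (Suc d)"
    by metis
  have "separated e (Max (n0 ` {..<m})) i" if i: "i \<in> {1..m}" for i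
  proof -
    obtain d where d: "i = Suc d" "d < m" using i by (cases i) auto
    then have "n0 d \<le> Max (n0 ` {..<m})" by (intro Max_ge) auto
    then show ?thesis using n0 d by simp
  qed
  then show ?thesis by blast
qed

lemma angle_sums_pythia:
  assumes "e \<ge> 1" "\<epsilon> > 0"
  shows "\<exists>L. \<forall>i\<in>{1..m}. cmod (\<Sum>c\<in>iter (\<mu> ^ (2 * m)) pythia_poses L i. prot c ^ e)
    \<le> \<epsilon> * real (card (iter (\<mu> ^ (2 * m)) pythia_poses L i))"
proof -
  obtain k where k: "\<And>i. i \<in> {1..m} \<Longrightarrow> separated e k i"
    using ex_uniformly_separated[OF assms(1)] by blast
  show ?thesis
    by (rule angle_sum_negligible[OF dissects_pythia weight_pos weight_pythia k[unfolded separated_def] assms(2)])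
qed

end

theorem theorem6p2:
  fixes m j :: nat and \<T> :: "complex set set"
  assumes "m \<ge> 3" and "1 \<le> j" and "j < m" and "gcd m j = 1"
    and "substitution_tiling m (prototile m j) (lam m j ^ (2 * m)) (pythia m j) \<T>"
  shows "statistical_circular_symmetry m (prototile m j) \<T>"
proof -
  interpret pythagoras_parameters m j
    by unfold_locales fact+
  show ?thesis
    using dissects_pythia pythia_eq_tile angle_sums_pythia assms(5)
    by (rule statistical_circular_symmetry_criterion)
qed

end
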